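(* Let $\mathcal{X},\mathcal{Y},\mathcal{Z}$ be finite alphabets, let $P_{Z|X}:\mathcal{X}\to\mathcal{Z}$ be the communication channel and $W=P^0_{Y|X}$, $V=P^1_{Y|X}:\mathcal{X}\to\mathcal{Y}$ the two sensing channels, with $W(y|x)V(y|x)\neq 0$ for all $x,y$; let $b:\mathcal{X}\to\mathbb{R}_{+}$ be a cost function and $B\ge 0$. Then the rate-exponent region $\mathcal{R}$ (defined in the context) equals the set of all non-negative triples $(R,E_0,E_1)$ such that $$R\le I(P_X,P_{Z|X}),\qquad E_0\le D(W_s\|W\,|\,P_X),\qquad E_1\le D(W_s\|V\,|\,P_X)$$ for some input distribution $P_X$ on $\mathcal{X}$ with $\mathbb{E}_{P_X}[b(X)]\le B$ and some $s\in[0,1]$.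
   Context: Setting: channels are stationary and memoryless: $P_{Z^n|X^n}(z^n|x^n)=\prod_{i}P_{Z|X}(z_i|x_i)$, $W_n(y^n|x^n)=\prod_i W(y_i|x_i)$, $V_n(y^n|x^n)=\prod_i V(y_i|x_i)$; the unknown parameter $\theta\in\{0,1\}$ selects $W_n$ ($\theta=0$) or $V_n$ ($\theta=1$) as the sensing channel. An $(n,|\mathcal{M}_n|)$-code consists of a message set $\mathcal{M}_n=\{1,\dots,|\mathcal{M}_n|\}$, an encoder $f_n:\mathcal{M}_n\to\mathcal{X}^n$ whose codewords satisfy $\frac1n\sum_{i=1}^n b(x_i)\le B$ (codebook $\mathcal{C}_n$ = set of codewords), a decoder $\varphi_n:\mathcal{Z}^n\to\mathcal{M}_n$, and a discrimination function $\psi_n:\mathcal{Y}^n\times\mathcal{M}_n\to\{0,1\}$ (which depends on the message only through the codeword, so written $\psi_n(y^n,x^n)$). Maximal decoding error: $P_{e,n}=\max_m \Pr[\varphi_n(Z^n)\ne m\mid M=m]$. For a codeword $x^n$, $\varepsilon_{0,n}(x^n)=\sum_{y^n:\psi_n(y^n,x^n)=1}W_n(y^n|x^n)$ and $\varepsilon_{1,n}(x^n)=\sum_{y^n:\psi_n(y^n,x^n)=0}V_n(y^n|x^n)$; $\varepsilon_{j,n}(\mathcal{C}_n)=\max_{x^n\in\mathcal{C}_n}\varepsilon_{j,n}(x^n)$. Only discrimination functions are allowed for which there is a constant $\tau<1$ with $\max\{\varepsilon_{0,n}(\mathcal{C}_n),\varepsilon_{1,n}(\mathcal{C}_n)\}\le\tau$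 for all $n$. A triple $(R,E_0,E_1)$ is achievable if there is a sequence of such codes with $P_{e,n}\to0$, $R=\liminf_n\frac1n\log|\mathcal{M}_n|$, $E_0=\liminf_n -\frac1n\log\varepsilon_{0,n}(\mathcal{C}_n)$, $E_1=\liminf_n-\frac1n\log\varepsilon_{1,n}(\mathcal{C}_n)$. $\mathcal{R}$ is the closure of the set of achievable triples. Tilted channel: $W_s(y|x)=\frac{W(y|x)^{1-s}V(y|x)^s}{\sum_{y'}W(y'|x)^{1-s}V(y'|x)^s}$. Conditional divergence: $D(P_{Y|X}\|Q_{Y|X}|P_X)=\sum_x P_X(x)\sum_y P_{Y|X}(y|x)\log\frac{P_{Y|X}(y|x)}{Q_{Y|X}(y|x)}$. $I(P_X,P_{Z|X})$ is the mutual information between input $X\sim P_X$ and output of $P_{Z|X}$.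
   Formalization: The formal theorem additionally assumes that the sensing output alphabet Y has at least two letters; if |Y|=1, every discrimination function has one error equal to 1, so no code is allowed and the region is empty, although the stated set contains (0,0,0) whenever some letter has cost at most B. *)

theory Defs
  imports "HOL-Analysis.Analysis" "HOL-Library.Liminf_Limsup"
begin

text \<open>Channels are represented as functions Q :: 'a => 'b => real with Q x y = Q(y|x).
  All logarithms are natural logarithms (the base is immaterial as long as it is used consistently).\<close>

definition stochastic :: "('a::finite \<Rightarrow> 'b::finite \<Rightarrow> real) \<Rightarrow> bool" where
  "stochastic Q \<longleftrightarrow> (\<forall>x y. 0 \<le> Q x y) \<and> (\<forall>x. (\<Sum>y\<in>UNIV. Q x y) = 1)"

definition distribution :: "('a::finite \<Rightarrow> real) \<Rightarrow> bool" where
  "distribution P \<longleftrightarrow> (\<forall>x. 0 \<le> P x) \<and> (\<Sum>x\<in>UNIV. P x) = 1"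

definition prodch :: "('a \<Rightarrow> 'b \<Rightarrow> real) \<Rightarrow> 'a list \<Rightarrow> 'b list \<Rightarrow> real" where
  "prodch Q xs ys = (\<Prod>i<length xs. Q (xs ! i) (ys ! i))"

definition seqs :: "nat \<Rightarrow> 'a list set" where
  "seqs n = {xs. length xs = n}"

definition tilted :: "('a \<Rightarrow> 'b::finite \<Rightarrow> real) \<Rightarrow> ('a \<Rightarrow> 'b \<Rightarrow> real) \<Rightarrow> real \<Rightarrow> 'a \<Rightarrow> 'b \<Rightarrow> real" where
  "tilted W V s x y =
     (W x y powr (1 - s) * V x y powr s) / (\<Sum>y'\<in>UNIV. W x y' powr (1 - s) * V x y' powr s)"

definition cond_div :: "('a::finite \<Rightarrow> 'b::finite \<Rightarrow> real) \<Rightarrow> ('a \<Rightarrow> 'b \<Rightarrow> real) \<Rightarrow> ('a \<Rightarrow> real) \<Rightarrow> real" where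
  "cond_div P Q PX = (\<Sum>x\<in>UNIV. PX x * (\<Sum>y\<in>UNIV. P x y * ln (P x y / Q x y)))"

text \<open>Mutual information I(P_X, P_{Z|X}); terms with P_X(x) P_{Z|X}(z|x) = 0 vanish
  (convention 0 log 0 = 0), since they are multiplied by 0.\<close>
definition mutual_info :: "('a::finite \<Rightarrow> real) \<Rightarrow> ('a \<Rightarrow> 'c::finite \<Rightarrow> real) \<Rightarrow> real" where
  "mutual_info PX Q = (\<Sum>x\<in>UNIV. \<Sum>z\<in>UNIV.
      PX x * Q x z * ln (Q x z / (\<Sum>x'\<in>UNIV. PX x' * Q x' z)))"

text \<open>An (n, M)-code: messages {1..M}, encoder f, decoder phi, discrimination function psi
  (psi y x = True means the decision theta = 1).\<close>
definition is_code :: "('a \<Rightarrow> real) \<Rightarrow> real \<Rightarrow> nat \<Rightarrow> nat \<Rightarrow> (nat \<Rightarrow> 'a list)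
    \<Rightarrow> ('c list \<Rightarrow> nat) \<Rightarrow> ('b list \<Rightarrow> 'a list \<Rightarrow> bool) \<Rightarrow> bool" where
  "is_code b B n M f phi psi \<longleftrightarrow>
     1 \<le> M \<and>
     (\<forall>m\<in>{1..M}. length (f m) = n \<and> (\<Sum>i<n. b (f m ! i)) / real n \<le> B) \<and>
     (\<forall>z\<in>seqs n. phi z \<in> {1..M})"

definition max_dec_err :: "('a \<Rightarrow> 'c::finite \<Rightarrow> real) \<Rightarrow> nat \<Rightarrow> nat \<Rightarrow> (nat \<Rightarrow> 'a list)
    \<Rightarrow> ('c list \<Rightarrow> nat) \<Rightarrow> real" where
  "max_dec_err Q n M f phi =
     Max ((\<lambda>m. \<Sum>z\<in>{z\<in>seqs n. phi z \<noteq> m}. prodch Q (f m) z) ` {1..M})"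

definition eps0 :: "('a \<Rightarrow> 'b::finite \<Rightarrow> real) \<Rightarrow> ('b list \<Rightarrow> 'a list \<Rightarrow> bool) \<Rightarrow> 'a list \<Rightarrow> real" where
  "eps0 W psi xs = (\<Sum>ys\<in>{ys\<in>seqs (length xs). psi ys xs}. prodch W xs ys)"

definition eps1 :: "('a \<Rightarrow> 'b::finite \<Rightarrow> real) \<Rightarrow> ('b list \<Rightarrow> 'a list \<Rightarrow> bool) \<Rightarrow> 'a list \<Rightarrow> real" where
  "eps1 V psi xs = (\<Sum>ys\<in>{ys\<in>seqs (length xs). \<not> psi ys xs}. prodch V xs ys)"

definition eps_code :: "('a list \<Rightarrow> real) \<Rightarrow> nat \<Rightarrow> (nat \<Rightarrow> 'a list) \<Rightarrow> real" where
  "eps_code e M f = Max (e ` f ` {1..M})"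

definition achievable ::
  "('a::finite \<Rightarrow> 'c::finite \<Rightarrow> real) \<Rightarrow> ('a \<Rightarrow> 'b::finite \<Rightarrow> real) \<Rightarrow> ('a \<Rightarrow> 'b \<Rightarrow> real)
   \<Rightarrow> ('a \<Rightarrow> real) \<Rightarrow> real \<Rightarrow> (real \<times> real \<times> real) set" where
  "achievable Q W V b B = {(R, E0, E1). \<exists>(M :: nat \<Rightarrow> nat) (f :: nat \<Rightarrow> nat \<Rightarrow> 'a list)
       (phi :: nat \<Rightarrow> 'c list \<Rightarrow> nat) (psi :: nat \<Rightarrow> 'b list \<Rightarrow> 'a list \<Rightarrow> bool) (\<tau>::real).
     (\<forall>n\<ge>1. is_code b B n (M n) (f n) (phi n) (psi n)) \<and>
     \<tau> < 1 \<and>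
     (\<forall>n\<ge>1. max (eps_code (eps0 W (psi n)) (M n) (f n)) (eps_code (eps1 V (psi n)) (M n) (f n)) \<le> \<tau>) \<and>
     (\<lambda>n. max_dec_err Q n (M n) (f n) (phi n)) \<longlonglongrightarrow> 0 \<and>
     ereal R = liminf (\<lambda>n. ereal (ln (real (M n)) / real n)) \<and>
     ereal E0 = liminf (\<lambda>n. ereal (- ln (eps_code (eps0 W (psi n)) (M n) (f n)) / real n)) \<and>
     ereal E1 = liminf (\<lambda>n. ereal (- ln (eps_code (eps1 V (psi n)) (M n) (f n)) / real n))}"

definition rate_exp_region ::
  "('a::finite \<Rightarrow> 'c::finite \<Rightarrow> real) \<Rightarrow> ('a \<Rightarrow> 'b::finite \<Rightarrow> real) \<Rightarrow> ('a \<Rightarrow> 'b \<Rightarrow> real)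
   \<Rightarrow> ('a \<Rightarrow> real) \<Rightarrow> real \<Rightarrow> (real \<times> real \<times> real) set" where
  "rate_exp_region Q W V b B = closure (achievable Q W V b B)"

end

theory Submission
  imports Defs "HOL-Real_Asymp.Real_Asymp"
begin

text \<open>
  The converse keeps only the codewords of the most frequent type \<open>P\<close>; as there are polynomially many
  types, this costs no rate. All these codewords have the same information density mean
  \<open>n I(P, P\<^sub>Z\<^sub>|\<^sub>X)\<close>, so comparing with the i.i.d. output distribution bounds their number. For one such
  codeword, a change of measure to the tilted channel \<open>W\<^sub>s\<close> shows that for every \<open>s\<close> at least one of
  the two exponent bounds holds; the first holds at \<open>s = 1\<close>, the second at \<open>s = 0\<close>, both on closed
  sets, and connectedness of \<open>[0, 1]\<close> yields an \<open>s\<close> at which both hold. Compactness passes to the limit.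

  For achievability, Feinstein's greedy construction is run on input sequences whose letter frequencies
  are close to \<open>P\<close>, which controls cost, information density and exponents of every codeword at once.
  The likelihood ratio test with threshold given by \<open>W\<^sub>s\<close> attains the two divergences. Since the
  exponents of an achievable triple are exact, smaller exponents are realised by reassigning two
  disjoint cylinder sets of prescribed probability.
\<close>

subsection \<open>Product weights and typical sequences\<close>

text \<open>All three bounds must hold with one \<open>P\<close> and one \<open>s\<close>. In the
  converse the rate and both exponents are therefore read off a single codeword, whose letter
  frequencies serve as \<open>P\<close>. The constant \<tau> < 1 enters at the ends of [0, 1]: under
  \<open>V\<close> (s = 1) the set deciding for 1 has probability at least 1 - \<tau>, and under
  \<open>W\<close> (s = 0) its complement has. In between, one of the two sets has probability at
  least 1/2 under the tilted channel, and a set likely there cannot be too unlikely under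
  \<open>W\<close> or \<open>V\<close>.

  In the direct part the errors must stay bounded away from 1 even if an exponent is 0. This is why
  a cylinder is confined by its first letter: with \<open>c\<close> a common lower bound of all
  entries and two distinct output letters, one letter has probability at most 1 - c. Constructions
  need strict inequalities as slack, but at rate 0 or at exponents (0, 0) these can be unattainable,
  for instance if \<open>W\<close> and \<open>V\<close> agree on the support of \<open>P\<close>.
  Such cases are built directly; the closure absorbs the other losses.\<close>

definition prod_weight :: "(nat \<Rightarrow> 'b \<Rightarrow> real) \<Rightarrow> nat \<Rightarrow> 'b list \<Rightarrow> real" where
  "prod_weight g n ys = (\<Prod>i<n. g i (ys ! i))"

text \<open>Given a codeword, the outputs are independent but not identically distributed, hence
  weights whose factors depend on the position; i.i.d. input and output laws are the constant
  case.\<close>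

lemma prodch_eq_prod_weight:
  "length xs = n \<Longrightarrow> prodch Q xs = prod_weight (\<lambda>i. Q (xs ! i)) n"
  by (auto simp: prodch_def prod_weight_def fun_eq_iff)

lemma finite_seqs [simp]: "finite (seqs n :: 'b::finite list set)"
proof -
  have "finite {xs :: 'b list. set xs \<subseteq> UNIV \<and> length xs = n}"
    by (rule finite_lists_length_eq) simp
  then show ?thesis by (simp add: seqs_def)
qed

lemma seqs_Suc: "seqs (Suc n) = (\<lambda>(ys, y). ys @ [y]) ` (seqs n \<times> UNIV)"
proof -
  have "xs \<in> (\<lambda>(ys, y). ys @ [y]) ` (seqs n \<times> UNIV)" if "length xs = Suc n" for xs :: "'b list"
  proof -
    have "xs = butlast xs @ [last xs]" using that by (metis append_butlast_last_id length_0_conv nat.distinct(1))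
    moreover have "length (butlast xs) = n" using that by simp
    ultimately show ?thesis by (force simp: seqs_def)
  qed
  then show ?thesis by (auto simp: seqs_def)
qed

lemma sum_seqs_Suc:
  "(\<Sum>xs\<in>seqs (Suc n). F xs) = (\<Sum>ys\<in>seqs n. \<Sum>y\<in>(UNIV::'b::finite set). F (ys @ [y]) :: real)"
proof -
  have inj: "inj_on (\<lambda>(ys, y::'b). ys @ [y]) (seqs n \<times> UNIV)" by (auto simp: inj_on_def)
  show ?thesis
    unfolding seqs_Suc sum.reindex[OF inj]
    by (simp add: sum.cartesian_product case_prod_unfold)
qed

lemma prod_weight_snoc:
  "length ys = n \<Longrightarrow> prod_weight g (Suc n) (ys @ [y]) = prod_weight g n ys * g n y"
  by (simp add: prod_weight_def nth_append)

lemma sum_coords_snoc: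
  "length ys = n \<Longrightarrow> (\<Sum>i<Suc n. h i ((ys @ [y]) ! i)) = (\<Sum>i<n. h i (ys ! i)) + (h n y :: real)"
  by (simp add: nth_append)

text \<open>The factors are arbitrary reals: besides probabilities, the identity is applied to
  \<open>P x * Q x (z ! i)\<close> to obtain the output law, and to factors set to zero off a
  cylinder.\<close>

lemma sum_prod_weight:
  fixes g :: "nat \<Rightarrow> 'b::finite \<Rightarrow> real"
  shows "(\<Sum>ys\<in>seqs n. prod_weight g n ys) = (\<Prod>i<n. \<Sum>y\<in>UNIV. g i y)"
proof (induction n)
  case 0
  then show ?case by (simp add: seqs_def prod_weight_def)
next
  case (Suc n)
  have "(\<Sum>ys\<in>seqs (Suc n). prod_weight g (Suc n) ys)
      = (\<Sum>ys\<in>seqs n. \<Sum>y\<in>UNIV. prod_weight g n ys * g n y)"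
    unfolding sum_seqs_Suc by (intro sum.cong refl) (simp add: prod_weight_snoc seqs_def)
  also have "\<dots> = (\<Sum>ys\<in>seqs n. prod_weight g n ys) * (\<Sum>y\<in>UNIV. g n y)"
    by (simp add: sum_product)
  finally show ?case using Suc.IH by simp
qed

lemma sum_prod_weight_eq_1:
  fixes g :: "nat \<Rightarrow> 'b::finite \<Rightarrow> real"
  assumes "\<And>i. i < n \<Longrightarrow> (\<Sum>y\<in>UNIV. g i y) = 1"
  shows "(\<Sum>ys\<in>seqs n. prod_weight g n ys) = 1"
  unfolding sum_prod_weight using assms by simp

lemma prod_weight_nonneg:
  "(\<And>i y. i < n \<Longrightarrow> 0 \<le> g i y) \<Longrightarrow> 0 \<le> prod_weight g n ys"
  by (auto simp: prod_weight_def intro!: prod_nonneg)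

lemma sum_weighted_square:
  fixes w S :: real
  shows "(\<Sum>y\<in>A. w * g y * (S + h y)\<^sup>2)
    = w * (S\<^sup>2 * (\<Sum>y\<in>A. g y) + 2 * S * (\<Sum>y\<in>A. g y * h y) + (\<Sum>y\<in>A. g y * (h y)\<^sup>2))"
  by (simp add: sum_distrib_left sum.distrib algebra_simps power2_eq_square)

text \<open>Induction on the last coordinate: the cross term of the square carries the mean of the
  new summand, which is 0, so the variances of independent coordinates add.\<close>

lemma prod_weight_second_moment:
  fixes g h :: "nat \<Rightarrow> 'b::finite \<Rightarrow> real"
  assumes "\<And>i. i < n \<Longrightarrow> (\<Sum>y\<in>UNIV. g i y) = 1"
    and "\<And>i. i < n \<Longrightarrow> (\<Sum>y\<in>UNIV. g i y * h i y) = 0"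
  shows "(\<Sum>ys\<in>seqs n. prod_weight g n ys * (\<Sum>i<n. h i (ys ! i))\<^sup>2)
       = (\<Sum>i<n. \<Sum>y\<in>UNIV. g i y * (h i y)\<^sup>2)"
  using assms
proof (induction n)
  case 0
  then show ?case by simp
next
  case (Suc n)
  let ?S = "\<lambda>ys. \<Sum>i<n. h i (ys ! i)"
  have "(\<Sum>ys\<in>seqs (Suc n). prod_weight g (Suc n) ys * (\<Sum>i<Suc n. h i (ys ! i))\<^sup>2)
      = (\<Sum>ys\<in>seqs n. \<Sum>y\<in>UNIV. prod_weight g n ys * g n y * (?S ys + h n y)\<^sup>2)"
    unfolding sum_seqs_Suc
    by (intro sum.cong refl) (simp only: prod_weight_snoc sum_coords_snoc seqs_def mem_Collect_eq)
  also have "\<dots> = (\<Sum>ys\<in>seqs n. prod_weight g n ys * ((?S ys)\<^sup>2 * (\<Sum>y\<in>UNIV. g n y)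
                   + 2 * ?S ys * (\<Sum>y\<in>UNIV. g n y * h n y) + (\<Sum>y\<in>UNIV. g n y * (h n y)\<^sup>2)))"
    by (intro sum.cong refl sum_weighted_square)
  also have "\<dots> = (\<Sum>ys\<in>seqs n. prod_weight g n ys * (?S ys)\<^sup>2)
                + (\<Sum>ys\<in>seqs n. prod_weight g n ys) * (\<Sum>y\<in>UNIV. g n y * (h n y)\<^sup>2)"
    using Suc.prems by (simp add: algebra_simps sum.distrib sum_distrib_right)
  also have "(\<Sum>ys\<in>seqs n. prod_weight g n ys) = 1"
    by (rule sum_prod_weight_eq_1) (use Suc.prems in simp)
  finally show ?case using Suc by simp
qed

lemma prod_weight_chebyshev:
  fixes g h :: "nat \<Rightarrow> 'b::finite \<Rightarrow> real"
  assumes nn: "\<And>i y. i < n \<Longrightarrow> 0 \<le> g i y"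
    and one: "\<And>i. i < n \<Longrightarrow> (\<Sum>y\<in>UNIV. g i y) = 1"
    and mean: "\<And>i. i < n \<Longrightarrow> (\<Sum>y\<in>UNIV. g i y * h i y) = 0"
    and var: "\<And>i. i < n \<Longrightarrow> (\<Sum>y\<in>UNIV. g i y * (h i y)\<^sup>2) \<le> v"
    and pos: "0 < n" "0 < \<gamma>"
  shows "(\<Sum>ys | ys \<in> seqs n \<and> real n * \<gamma> \<le> \<bar>\<Sum>i<n. h i (ys ! i)\<bar>. prod_weight g n ys)
       \<le> v / (real n * \<gamma>\<^sup>2)"
proof -
  let ?S = "\<lambda>ys. \<Sum>i<n. h i (ys ! i)"
  let ?B = "{ys \<in> seqs n. real n * \<gamma> \<le> \<bar>?S ys\<bar>}"
  have "(\<Sum>ys\<in>?B. prod_weight g n ys) * (real n * \<gamma>)\<^sup>2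
      = (\<Sum>ys\<in>?B. prod_weight g n ys * (real n * \<gamma>)\<^sup>2)"
    by (rule sum_distrib_right)
  also have "\<dots> \<le> (\<Sum>ys\<in>?B. prod_weight g n ys * (?S ys)\<^sup>2)"
  proof (intro sum_mono mult_left_mono prod_weight_nonneg nn)
    fix ys assume "ys \<in> ?B"
    then have "\<bar>real n * \<gamma>\<bar> \<le> \<bar>?S ys\<bar>" using pos by simp
    then show "(real n * \<gamma>)\<^sup>2 \<le> (?S ys)\<^sup>2" by (simp add: abs_le_square_iff)
  qed
  also have "\<dots> \<le> (\<Sum>ys\<in>seqs n. prod_weight g n ys * (?S ys)\<^sup>2)"
    by (intro sum_mono2) (auto intro!: mult_nonneg_nonneg prod_weight_nonneg nn)
  also have "\<dots> = (\<Sum>i<n. \<Sum>y\<in>UNIV. g i y * (h i y)\<^sup>2)"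
    by (rule prod_weight_second_moment) (use one mean in auto)
  also have "\<dots> \<le> (\<Sum>i<n. v)"
    by (intro sum_mono var) simp
  also have "\<dots> = real n * v" by simp
  finally show ?thesis
    using pos by (simp add: field_simps power2_eq_square)
qed

section \<open>Relative entropy, typical sequences and change of measure\<close>

definition kl :: "('b::finite \<Rightarrow> real) \<Rightarrow> ('b \<Rightarrow> real) \<Rightarrow> real" where
  "kl p q = (\<Sum>y\<in>UNIV. p y * ln (p y / q y))"

text \<open>Sequences of weight 0 are excluded because their log-ratios are meaningless: with
  \<open>ln 0 = 0\<close> they could pass the deviation test.\<close>

definition typical :: "(nat \<Rightarrow> 'b::finite \<Rightarrow> real) \<Rightarrow> (nat \<Rightarrow> 'b \<Rightarrow> real) \<Rightarrow> nat \<Rightarrow> real \<Rightarrow> 'b list set" where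
  "typical p q n \<gamma> = {ys \<in> seqs n. 0 < prod_weight p n ys \<and>
     \<bar>\<Sum>i<n. ln (p i (ys ! i) / q i (ys ! i)) - kl (p i) (q i)\<bar> < real n * \<gamma>}"

context
  fixes p q :: "nat \<Rightarrow> 'b::finite \<Rightarrow> real" and n :: nat
  assumes p_nonneg: "\<And>i y. i < n \<Longrightarrow> 0 \<le> p i y"
    and p_sum: "\<And>i. i < n \<Longrightarrow> (\<Sum>y\<in>UNIV. p i y) = 1"
begin

lemma typical_compl:
  assumes var: "\<And>i. i < n \<Longrightarrow> (\<Sum>y\<in>UNIV. p i y * (ln (p i y / q i y))\<^sup>2) \<le> v"
    and pos: "0 < n" "0 < \<gamma>"
  shows "(\<Sum>ys\<in>seqs n - typical p q n \<gamma>. prod_weight p n ys) \<le> v / (real n * \<gamma>\<^sup>2)"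
proof -
  let ?h = "\<lambda>i y. ln (p i y / q i y) - kl (p i) (q i)"
  let ?B = "{ys. ys \<in> seqs n \<and> real n * \<gamma> \<le> \<bar>\<Sum>i<n. ?h i (ys ! i)\<bar>}"
  have mean: "(\<Sum>y\<in>UNIV. p i y * ?h i y) = 0" if "i < n" for i
  proof -
    have "(\<Sum>y\<in>UNIV. p i y * ?h i y) = kl (p i) (q i) - (\<Sum>y\<in>UNIV. p i y) * kl (p i) (q i)"
      by (simp add: kl_def right_diff_distrib sum_subtractf flip: sum_distrib_right)
    then show ?thesis using p_sum[OF that] by simp
  qed
  \<comment> \<open>Centring only lowers the second moment, so a bound \<open>v\<close> on the
    uncentred one is enough.\<close>
  have hvar: "(\<Sum>y\<in>UNIV. p i y * (?h i y)\<^sup>2) \<le> v" if "i < n" for i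
  proof -
    have "(\<Sum>y\<in>UNIV. p i y * (?h i y)\<^sup>2)
        = (- kl (p i) (q i))\<^sup>2 * (\<Sum>y\<in>UNIV. p i y) + 2 * (- kl (p i) (q i)) * kl (p i) (q i)
           + (\<Sum>y\<in>UNIV. p i y * (ln (p i y / q i y))\<^sup>2)"
      using sum_weighted_square[of 1 "p i" "- kl (p i) (q i)" "\<lambda>y. ln (p i y / q i y)" UNIV]
      by (simp add: kl_def[symmetric])
    also have "\<dots> \<le> (\<Sum>y\<in>UNIV. p i y * (ln (p i y / q i y))\<^sup>2)"
      using p_sum[OF that] by (simp add: power2_eq_square)
    finally show ?thesis using var[OF that] by linarith
  qed
  have "(\<Sum>ys\<in>seqs n - typical p q n \<gamma>. prod_weight p n ys)
      = (\<Sum>ys\<in>(seqs n - typical p q n \<gamma>) \<inter> ?B. prod_weight p n ys)"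
  proof (intro sum.mono_neutral_right ballI)
    fix ys assume "ys \<in> (seqs n - typical p q n \<gamma>) - (seqs n - typical p q n \<gamma>) \<inter> ?B"
    then have "\<not> 0 < prod_weight p n ys"
      by (auto simp: typical_def not_le)
    then show "prod_weight p n ys = 0"
      using prod_weight_nonneg[of n p ys] p_nonneg by force
  qed auto
  also have "\<dots> \<le> (\<Sum>ys\<in>?B. prod_weight p n ys)"
    by (intro sum_mono2) (auto intro: prod_weight_nonneg p_nonneg)
  also have "\<dots> \<le> v / (real n * \<gamma>\<^sup>2)"
    by (rule prod_weight_chebyshev[OF p_nonneg p_sum mean hvar pos])
  finally show ?thesis .
qed

lemma typical_ratio:
  assumes q_pos: "\<And>i y. i < n \<Longrightarrow> 0 < p i y \<Longrightarrow> 0 < q i y" and ys: "ys \<in> typical p q n \<gamma>"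
  shows "prod_weight p n ys \<le> exp ((\<Sum>i<n. kl (p i) (q i)) + real n * \<gamma>) * prod_weight q n ys"
    and "prod_weight q n ys \<le> exp (- (\<Sum>i<n. kl (p i) (q i)) + real n * \<gamma>) * prod_weight p n ys"
proof -
  let ?L = "\<Sum>i<n. ln (p i (ys ! i) / q i (ys ! i))"
  have ppos: "0 < p i (ys ! i)" if "i < n" for i
  proof -
    have "prod_weight p n ys \<noteq> 0" using ys by (simp add: typical_def)
    then have "p i (ys ! i) \<noteq> 0" using that by (simp add: prod_weight_def)
    then show ?thesis using p_nonneg[OF that, of "ys ! i"] by simp
  qed
  have "exp ?L = (\<Prod>i<n. p i (ys ! i) / q i (ys ! i))"
    by (simp add: exp_sum ppos q_pos)
  also have "\<dots> = prod_weight p n ys / prod_weight q n ys"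
    by (simp add: prod_weight_def prod_dividef)
  finally have e: "exp ?L = prod_weight p n ys / prod_weight q n ys" .
  have Q: "0 < prod_weight q n ys"
    unfolding prod_weight_def by (intro prod_pos) (use ppos q_pos in auto)
  have P: "0 < prod_weight p n ys"
    using ys by (simp add: typical_def)
  have dev: "\<bar>?L - (\<Sum>i<n. kl (p i) (q i))\<bar> < real n * \<gamma>"
    using ys by (simp add: typical_def sum_subtractf)
  have "prod_weight p n ys = exp ?L * prod_weight q n ys" using e Q by simp
  also have "\<dots> \<le> exp ((\<Sum>i<n. kl (p i) (q i)) + real n * \<gamma>) * prod_weight q n ys"
    using dev Q by simp
  finally show "prod_weight p n ys \<le> exp ((\<Sum>i<n. kl (p i) (q i)) + real n * \<gamma>) * prod_weight q n ys" .
  have "prod_weight q n ys = exp (- ?L) * prod_weight p n ys"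
    unfolding exp_minus e using P Q by simp
  also have "\<dots> \<le> exp (- (\<Sum>i<n. kl (p i) (q i)) + real n * \<gamma>) * prod_weight p n ys"
    using dev P by simp
  finally show "prod_weight q n ys \<le> exp (- (\<Sum>i<n. kl (p i) (q i)) + real n * \<gamma>) * prod_weight p n ys" .
qed

text \<open>On typical sequences the density of \<open>p\<close> relative to \<open>q\<close> is at
  most the exponential factor, and the atypical ones have small \<open>p\<close>-weight by
  Chebyshev. Read backwards, a set likely under \<open>p\<close> cannot be too unlikely under
  \<open>q\<close>; this drives both the bound on the exponents and the bound on the rate.\<close>

lemma change_of_measure:
  assumes q_nonneg: "\<And>i y. i < n \<Longrightarrow> 0 \<le> q i y"
    and q_pos: "\<And>i y. i < n \<Longrightarrow> 0 < p i y \<Longrightarrow> 0 < q i y"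
    and var: "\<And>i. i < n \<Longrightarrow> (\<Sum>y\<in>UNIV. p i y * (ln (p i y / q i y))\<^sup>2) \<le> v"
    and pos: "0 < n" "0 < \<gamma>" and A: "A \<subseteq> seqs n"
  shows "(\<Sum>ys\<in>A. prod_weight p n ys)
     \<le> exp ((\<Sum>i<n. kl (p i) (q i)) + real n * \<gamma>) * (\<Sum>ys\<in>A. prod_weight q n ys) + v / (real n * \<gamma>\<^sup>2)"
proof -
  let ?G = "typical p q n \<gamma>" and ?e = "exp ((\<Sum>i<n. kl (p i) (q i)) + real n * \<gamma>)"
  have fin: "finite A" using A finite_seqs by (rule finite_subset)
  have "(\<Sum>ys\<in>A. prod_weight p n ys)
      = (\<Sum>ys\<in>A \<inter> ?G. prod_weight p n ys) + (\<Sum>ys\<in>A - ?G. prod_weight p n ys)"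
    using sum.Int_Diff[OF fin] .
  also have "(\<Sum>ys\<in>A \<inter> ?G. prod_weight p n ys) \<le> (\<Sum>ys\<in>A \<inter> ?G. ?e * prod_weight q n ys)"
    by (intro sum_mono typical_ratio(1)) (use q_pos in auto)
  also have "\<dots> \<le> (\<Sum>ys\<in>A. ?e * prod_weight q n ys)"
    by (intro sum_mono2) (auto simp: fin intro!: mult_nonneg_nonneg prod_weight_nonneg q_nonneg)
  also have "(\<Sum>ys\<in>A - ?G. prod_weight p n ys) \<le> (\<Sum>ys\<in>seqs n - ?G. prod_weight p n ys)"
    by (intro sum_mono2) (use A in \<open>auto intro: prod_weight_nonneg p_nonneg\<close>)
  also have "\<dots> \<le> v / (real n * \<gamma>\<^sup>2)"
    by (rule typical_compl[OF var pos])
  finally show ?thesis by (simp add: sum_distrib_left)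
qed

end

subsection \<open>Letter frequencies and bounds on the code size\<close>

definition letter_freq :: "'a list \<Rightarrow> 'a \<Rightarrow> real" where
  "letter_freq xs a = real (card {i. i < length xs \<and> xs ! i = a}) / real (length xs)"

lemma sum_over_letters:
  fixes \<phi> :: "'a::finite \<Rightarrow> real"
  assumes "length xs = n" "0 < n"
  shows "(\<Sum>i<n. \<phi> (xs ! i)) = real n * (\<Sum>a\<in>UNIV. letter_freq xs a * \<phi> a)"
proof -
  have "(\<Sum>i<n. \<phi> (xs ! i)) = (\<Sum>i<n. \<Sum>a\<in>UNIV. if xs ! i = a then \<phi> a else 0)"
    by simp
  also have "\<dots> = (\<Sum>a\<in>UNIV. \<Sum>i<n. if xs ! i = a then \<phi> a else 0)"
    by (rule sum.swap)
  also have "\<dots> = (\<Sum>a\<in>UNIV. \<Sum>i\<in>{i. i < n \<and> xs ! i = a}. \<phi> a)"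
    by (rule sum.cong[OF refl]) (subst sum.inter_filter[symmetric], auto)
  also have "\<dots> = (\<Sum>a\<in>UNIV. real n * (letter_freq xs a * \<phi> a))"
    using assms by (intro sum.cong refl) (simp add: letter_freq_def)
  finally show ?thesis by (simp add: sum_distrib_left)
qed

lemma letter_freq_nonneg: "0 \<le> letter_freq xs a"
  by (simp add: letter_freq_def)

lemma distribution_letter_freq:
  assumes "length (xs :: 'a::finite list) = n" "0 < n"
  shows "distribution (letter_freq xs)"
  using sum_over_letters[OF assms, of "\<lambda>_. 1"] assms(2)
  by (simp add: distribution_def letter_freq_nonneg)

lemma stochastic_nonneg: "stochastic Q \<Longrightarrow> 0 \<le> Q x y"
  and stochastic_sum: "stochastic Q \<Longrightarrow> (\<Sum>y\<in>UNIV. Q x y) = 1"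
  by (auto simp: stochastic_def)

lemma stochastic_le_1: "stochastic Q \<Longrightarrow> Q x y \<le> 1"
  using member_le_sum[of y UNIV "Q x"] by (simp add: stochastic_def)

lemma sum_prodch:
  fixes Q :: "'a::finite \<Rightarrow> 'b::finite \<Rightarrow> real"
  assumes "stochastic Q" "length xs = n"
  shows "(\<Sum>ys\<in>seqs n. prodch Q xs ys) = 1"
  unfolding prodch_eq_prod_weight[OF assms(2)]
  by (rule sum_prod_weight_eq_1) (rule stochastic_sum[OF assms(1)])

lemma prodch_nonneg: "stochastic Q \<Longrightarrow> 0 \<le> prodch Q xs ys"
  by (auto simp: prodch_def stochastic_def intro!: prod_nonneg)

lemma sum_prodch_Diff:
  fixes Q :: "'a::finite \<Rightarrow> 'b::finite \<Rightarrow> real"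
  assumes "stochastic Q" "length xs = n" "A \<subseteq> seqs n"
  shows "(\<Sum>ys\<in>seqs n - A. prodch Q xs ys) = 1 - (\<Sum>ys\<in>A. prodch Q xs ys)"
  using sum_diff[OF finite_seqs assms(3), of "prodch Q xs"] sum_prodch[OF assms(1,2)] by simp

text \<open>All entries lie between \<open>c\<close> and 1, so the log-ratio is at most
  \<open>\<bar>ln c\<bar>\<close> in absolute value. The bound depends on \<open>c\<close> alone,
  which later makes the Chebyshev error uniform in the tilting parameter.\<close>

lemma kl_variance_le:
  fixes p q :: "'b::finite \<Rightarrow> real"
  assumes "\<And>y. c \<le> p y" "\<And>y. p y \<le> 1" "\<And>y. c \<le> q y" "\<And>y. q y \<le> 1" "0 < c" "(\<Sum>y\<in>UNIV. p y) = 1"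
  shows "(\<Sum>y\<in>UNIV. p y * (ln (p y / q y))\<^sup>2) \<le> (ln c)\<^sup>2"
proof -
  have "p y * (ln (p y / q y))\<^sup>2 \<le> p y * (ln c)\<^sup>2" for y
  proof -
    have pos: "0 < p y" "0 < q y" using assms(1)[of y] assms(3)[of y] assms(5) by linarith+
    have "ln c \<le> ln (p y)" "ln (p y) \<le> 0" "ln c \<le> ln (q y)" "ln (q y) \<le> 0"
      using assms(1-5) pos by auto
    then have "\<bar>ln (p y / q y)\<bar> \<le> \<bar>ln c\<bar>" unfolding ln_divide_pos[OF pos] by linarith
    then show ?thesis using pos by (intro mult_left_mono) (auto simp: abs_le_square_iff)
  qed
  then have "(\<Sum>y\<in>UNIV. p y * (ln (p y / q y))\<^sup>2) \<le> (\<Sum>y\<in>UNIV. p y * (ln c)\<^sup>2)"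
    by (rule sum_mono)
  also have "\<dots> = (ln c)\<^sup>2" using assms(6) by (simp flip: sum_distrib_right)
  finally show ?thesis .
qed

lemma cond_div_eq_kl: "cond_div P Q PX = (\<Sum>x\<in>UNIV. PX x * kl (P x) (Q x))"
  by (simp add: cond_div_def kl_def)

text \<open>Half of \<open>\<kappa>\<close> pays the Chebyshev error of the change of measure. One
  \<open>\<gamma>\<close> pays the deviation of the log-likelihood ratio, the other the constant
  factor \<open>\<kappa> / 2\<close> after taking logarithms.\<close>

lemma error_exponent_le_cond_div:
  fixes P U :: "'a::finite \<Rightarrow> 'b::finite \<Rightarrow> real"
  assumes P: "stochastic P" "\<And>x y. c \<le> P x y" and U: "stochastic U" "\<And>x y. c \<le> U x y"
    and c: "0 < c" and xs: "length xs = n" "0 < n" and A: "A \<subseteq> seqs n"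
    and \<kappa>: "0 < \<kappa>" "\<kappa> \<le> (\<Sum>ys\<in>A. prodch P xs ys)"
    and large: "0 < \<gamma>" "(ln c)\<^sup>2 / (real n * \<gamma>\<^sup>2) \<le> \<kappa> / 2" "- ln (\<kappa> / 2) \<le> real n * \<gamma>"
  shows "- ln (\<Sum>ys\<in>A. prodch U xs ys) / real n \<le> cond_div P U (letter_freq xs) + 2 * \<gamma>"
proof -
  let ?e = "\<Sum>ys\<in>A. prodch U xs ys" and ?D = "cond_div P U (letter_freq xs)"
  have U_pos: "0 < U x y" for x y using U(2)[of x y] c by linarith
  have "(\<Sum>ys\<in>A. prodch P xs ys)
      \<le> exp ((\<Sum>i<n. kl (P (xs ! i)) (U (xs ! i))) + real n * \<gamma>) * ?e + (ln c)\<^sup>2 / (real n * \<gamma>\<^sup>2)"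
    unfolding prodch_eq_prod_weight[OF xs(1)]
    by (rule change_of_measure)
       (use P U c U_pos xs(2) large(1) A in \<open>auto simp: stochastic_nonneg stochastic_sum stochastic_le_1
          intro!: kl_variance_le\<close>)
  also have "(\<Sum>i<n. kl (P (xs ! i)) (U (xs ! i))) = real n * ?D"
    using sum_over_letters[OF xs, of "\<lambda>x. kl (P x) (U x)"] by (simp add: cond_div_eq_kl)
  finally have *: "\<kappa> / 2 \<le> exp (real n * ?D + real n * \<gamma>) * ?e"
    using \<kappa> large(2) by linarith
  have e: "0 < ?e"
  proof (rule ccontr)
    assume "\<not> 0 < ?e"
    then have "exp (real n * ?D + real n * \<gamma>) * ?e \<le> 0" by (intro mult_nonneg_nonpos) auto
    then show False using * \<kappa> by linarith
  qed
  have "ln (\<kappa> / 2) \<le> ln (exp (real n * ?D + real n * \<gamma>) * ?e)"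
    using * \<kappa>(1) by (subst ln_le_cancel_iff) (use e in auto)
  also have "\<dots> = real n * ?D + real n * \<gamma> + ln ?e"
    using e by (simp add: ln_mult)
  finally have "- ln ?e \<le> real n * (?D + 2 * \<gamma>)"
    using large(3) by (simp add: algebra_simps)
  then show ?thesis using xs(2) by (simp add: field_simps)
qed

lemma mutual_info_eq_kl:
  "mutual_info P Q = (\<Sum>x\<in>UNIV. P x * kl (Q x) (\<lambda>z. \<Sum>x'\<in>UNIV. P x' * Q x' z))"
  by (simp add: mutual_info_def kl_def sum_distrib_left mult.assoc)

lemma output_sum:
  fixes Q :: "'a::finite \<Rightarrow> 'c::finite \<Rightarrow> real"
  assumes "stochastic Q" "distribution P"
  shows "(\<Sum>z\<in>UNIV. \<Sum>x\<in>UNIV. P x * Q x z) = 1"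
proof -
  have "(\<Sum>z\<in>UNIV. \<Sum>x\<in>UNIV. P x * Q x z) = (\<Sum>x\<in>UNIV. P x * (\<Sum>z\<in>UNIV. Q x z))"
    by (subst sum.swap) (simp add: sum_distrib_left)
  then show ?thesis using assms by (simp add: stochastic_def distribution_def)
qed

lemma output_ge:
  fixes Q :: "'a::finite \<Rightarrow> 'c::finite \<Rightarrow> real"
  assumes "stochastic Q" "distribution P"
  shows "P x * Q x z \<le> (\<Sum>x\<in>UNIV. P x * Q x z)"
  by (rule member_le_sum) (use assms in \<open>auto simp: stochastic_def distribution_def\<close>)

lemma output_nonneg:
  fixes Q :: "'a::finite \<Rightarrow> 'c::finite \<Rightarrow> real"
  assumes "stochastic Q" "distribution P"
  shows "0 \<le> (\<Sum>x\<in>UNIV. P x * Q x z)"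
  by (rule sum_nonneg) (use assms in \<open>auto simp: stochastic_def distribution_def\<close>)

lemma output_le_1:
  fixes Q :: "'a::finite \<Rightarrow> 'c::finite \<Rightarrow> real"
  assumes "stochastic Q" "distribution P"
  shows "(\<Sum>x\<in>UNIV. P x * Q x z) \<le> 1"
  using member_le_sum[of z UNIV "\<lambda>z. \<Sum>x\<in>UNIV. P x * Q x z"] output_nonneg[OF assms]
    output_sum[OF assms] by simp

lemma letter_freq_ge:
  assumes "i < length xs"
  shows "1 / real (length xs) \<le> letter_freq xs (xs ! i)"
proof -
  have "card {i} \<le> card {j. j < length xs \<and> xs ! j = xs ! i}"
    using assms by (intro card_mono) auto
  then show ?thesis by (simp add: letter_freq_def divide_right_mono)
qed

text \<open>A packing argument: changing measure to the output law gives each decoding set weight at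
  least \<open>exp (- n (I + \<gamma>)) / 4\<close>, and disjoint sets have total weight at most 1.
  The 1/4 is what the Chebyshev error leaves of the success probability 1/2. The common type
  provides one output law for all codewords.\<close>

lemma constant_composition_card_le:
  fixes Q :: "'a::finite \<Rightarrow> 'c::finite \<Rightarrow> real"
  assumes Q: "stochastic Q" and q: "\<And>x z. 0 < Q x z \<Longrightarrow> q \<le> Q x z" "0 < q" "q \<le> 1"
    and fin: "finite S" and len: "\<And>m. m \<in> S \<Longrightarrow> length (f m) = n"
    and freq: "\<And>m. m \<in> S \<Longrightarrow> letter_freq (f m) = P" and P: "distribution P"
    and D: "\<And>m. m \<in> S \<Longrightarrow> D m \<subseteq> seqs n" "disjoint_family_on D S"
    and dec: "\<And>m. m \<in> S \<Longrightarrow> 1 / 2 \<le> (\<Sum>z\<in>D m. prodch Q (f m) z)"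
    and pos: "0 < n" "0 < \<gamma>" and large: "(ln (real n) - ln q)\<^sup>2 / (real n * \<gamma>\<^sup>2) \<le> 1 / 4"
  shows "real (card S) \<le> 4 * exp (real n * (mutual_info P Q + \<gamma>))"
proof -
  define r where "r = (\<lambda>z. \<Sum>x\<in>UNIV. P x * Q x z)"
  let ?r = "prod_weight (\<lambda>_. r) n"
  let ?e = "exp (real n * (mutual_info P Q + \<gamma>))"
  have r_nn: "0 \<le> r z" and r_le: "r z \<le> 1" for z
    unfolding r_def by (rule output_nonneg[OF Q P], rule output_le_1[OF Q P])
  have one: "1 / 4 \<le> ?e * (\<Sum>z\<in>D m. ?r z)" if m: "m \<in> S" for m
  proof -
    let ?x = "\<lambda>i. f m ! i"
    \<comment> \<open>Letters of a codeword have frequency at least \<open>1/n\<close>, so log-likelihood ratios are \<open>O(ln n)\<close>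
      and the Chebyshev error still vanishes, uniformly in the type.\<close>
    have ratio: "Q (?x i) z / real n \<le> r z" if "i < n" for i z
    proof -
      have "1 / real n \<le> P (?x i)"
        using letter_freq_ge[of i "f m"] that m by (simp add: len freq)
      then have "1 / real n * Q (?x i) z \<le> P (?x i) * Q (?x i) z"
        by (intro mult_right_mono stochastic_nonneg Q)
      also have "\<dots> \<le> r z" unfolding r_def by (rule output_ge[OF Q P])
      finally show ?thesis by simp
    qed
    have r_pos: "0 < r z" if "i < n" "0 < Q (?x i) z" for i z
      by (rule less_le_trans[OF _ ratio[OF that(1)]]) (use that(2) pos in simp)
    have var: "(\<Sum>z\<in>UNIV. Q (?x i) z * (ln (Q (?x i) z / r z))\<^sup>2) \<le> (ln (real n) - ln q)\<^sup>2"
      if i: "i < n" for i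
    proof -
      have "Q (?x i) z * (ln (Q (?x i) z / r z))\<^sup>2 \<le> Q (?x i) z * (ln (real n) - ln q)\<^sup>2" for z
      proof (cases "Q (?x i) z = 0")
        case False
        then have Qp: "0 < Q (?x i) z" using stochastic_nonneg[OF Q, of "?x i" z] by simp
        have rp: "0 < r z" by (rule r_pos[OF i Qp])
        have "ln (Q (?x i) z / real n) \<le> ln (r z)" using ratio[OF i, of z] Qp pos rp by simp
        then have "ln (Q (?x i) z) - ln (r z) \<le> ln (real n)" using Qp pos by (simp add: ln_div)
        moreover have "ln q \<le> ln (Q (?x i) z)" "ln (r z) \<le> 0" "ln q \<le> 0" "0 \<le> ln (real n)"
          using q Qp rp r_le[of z] pos by auto
        ultimately have "\<bar>ln (Q (?x i) z / r z)\<bar> \<le> \<bar>ln (real n) - ln q\<bar>"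
          unfolding ln_divide_pos[OF Qp rp] by linarith
        then show ?thesis using Qp by (intro mult_left_mono) (auto simp: abs_le_square_iff)
      qed simp
      then have "(\<Sum>z\<in>UNIV. Q (?x i) z * (ln (Q (?x i) z / r z))\<^sup>2)
          \<le> (\<Sum>z\<in>UNIV. Q (?x i) z * (ln (real n) - ln q)\<^sup>2)"
        by (rule sum_mono)
      then show ?thesis using stochastic_sum[OF Q, of "?x i"] by (simp flip: sum_distrib_right)
    qed
    have "(\<Sum>z\<in>D m. prodch Q (f m) z)
       \<le> exp ((\<Sum>i<n. kl (Q (?x i)) r) + real n * \<gamma>) * (\<Sum>z\<in>D m. ?r z)
         + (ln (real n) - ln q)\<^sup>2 / (real n * \<gamma>\<^sup>2)"
      unfolding prodch_eq_prod_weight[OF len[OF m]]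
      by (rule change_of_measure)
         (use r_nn r_pos var pos D(1)[OF m] in \<open>auto simp: stochastic_nonneg[OF Q] stochastic_sum[OF Q]\<close>)
    also have "(\<Sum>i<n. kl (Q (?x i)) r) = real n * mutual_info P Q"
      using sum_over_letters[OF len[OF m] pos(1), of "\<lambda>x. kl (Q x) r"]
      by (simp add: mutual_info_eq_kl freq[OF m] r_def)
    finally show ?thesis using dec[OF m] large unfolding distrib_left by linarith
  qed
  have finD: "finite (D m)" if "m \<in> S" for m
    using D(1)[OF that] finite_seqs by (rule finite_subset)
  have "real (card S) * (1 / 4) \<le> (\<Sum>m\<in>S. ?e * (\<Sum>z\<in>D m. ?r z))"
    using sum_bounded_below[of S "1/4" "\<lambda>m. ?e * (\<Sum>z\<in>D m. ?r z)"] one by simp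
  also have "\<dots> = ?e * (\<Sum>z\<in>\<Union>(D ` S). ?r z)"
    unfolding sum_distrib_left[symmetric]
    by (subst sum.UNION_disjoint_family) (use fin D finD in auto)
  also have "(\<Sum>z\<in>\<Union>(D ` S). ?r z) \<le> (\<Sum>z\<in>seqs n. ?r z)"
    by (intro sum_mono2) (use D r_nn in \<open>auto intro: prod_weight_nonneg\<close>)
  also have "\<dots> = 1"
    by (rule sum_prod_weight_eq_1) (simp add: r_def output_sum[OF Q P])
  finally show ?thesis by simp
qed

text \<open>Pigeonhole on the vectors of letter counts: if every class were smaller than the
  average, the classes could not add up to \<open>M\<close>.\<close>

lemma constant_composition_subcode:
  fixes f :: "nat \<Rightarrow> 'a::finite list"
  assumes len: "\<And>m. m \<in> {1..M} \<Longrightarrow> length (f m) = n" and M: "1 \<le> M"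
  obtains S P where "S \<subseteq> {1..M}" "S \<noteq> {}" "\<And>m. m \<in> S \<Longrightarrow> letter_freq (f m) = P"
    "M \<le> (n + 1) ^ CARD('a) * card S"
proof -
  \<comment> \<open>Integer counts take values in \<open>{..n}\<close>, which bounds the number of
    classes; equal counts at equal length give equal frequencies.\<close>
  define g where "g m = (\<lambda>a. card {i. i < n \<and> f m ! i = a})" for m
  have g_le: "g m a \<le> n" for m a
    using card_mono[of "{..<n}" "{i. i < n \<and> f m ! i = a}"] by (auto simp: g_def)
  have "card (g ` {1..M}) \<le> card ((UNIV :: 'a set) \<rightarrow>\<^sub>E {..n})"
    by (intro card_mono finite_PiE) (auto simp: g_le)
  also have "\<dots> = (n + 1) ^ CARD('a)" by (simp add: card_PiE)
  finally have img: "card (g ` {1..M}) \<le> (n + 1) ^ CARD('a)" .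
  let ?F = "\<lambda>t. {m. m \<in> {1..M} \<and> g m = t}"
  have "\<exists>t\<in>g ` {1..M}. M \<le> (n + 1) ^ CARD('a) * card (?F t)"
  proof (rule ccontr)
    assume "\<not> ?thesis"
    then have less: "(n + 1) ^ CARD('a) * card (?F t) < M" if "t \<in> g ` {1..M}" for t
      using that by (meson not_le)
    have "(n + 1) ^ CARD('a) * M = (n + 1) ^ CARD('a) * (\<Sum>t\<in>g ` {1..M}. card (?F t))"
      using sum.image_gen[of "{1..M}" "\<lambda>_. 1::nat" g] by simp
    also have "\<dots> < (\<Sum>t\<in>g ` {1..M}. M)"
      unfolding sum_distrib_left using M by (intro sum_strict_mono less) auto
    also have "\<dots> \<le> (n + 1) ^ CARD('a) * M" using img by simp
    finally show False by simp
  qed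
  then obtain m0 where m0: "m0 \<in> {1..M}" "M \<le> (n + 1) ^ CARD('a) * card (?F (g m0))" by blast
  show thesis
  proof (rule that[of "?F (g m0)" "letter_freq (f m0)"])
    fix m assume "m \<in> ?F (g m0)"
    then have "g m = g m0" "length (f m) = length (f m0)" using len m0(1) by auto
    then show "letter_freq (f m) = letter_freq (f m0)"
      using len[OF m0(1)] by (simp add: letter_freq_def fun_eq_iff g_def)
  qed (use m0 in auto)
qed

subsection \<open>Cylinder sets of prescribed probability\<close>

lemma sum_Un_le:
  fixes f :: "'b \<Rightarrow> real"
  assumes "finite A" "finite B" "\<And>y. 0 \<le> f y"
  shows "sum f (A \<union> B) \<le> sum f A + sum f B"
  using sum.union_inter[OF assms(1,2), of f] sum_nonneg[of "A \<inter> B" f] assms(3) by fastforce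

text \<open>The first letter is reserved so that the cylinders for two different letters \<open>u\<close> are disjoint.\<close>

definition cylinder :: "'b \<Rightarrow> (nat \<Rightarrow> 'b) \<Rightarrow> nat \<Rightarrow> nat \<Rightarrow> 'b list set" where
  "cylinder u a n k = {ys \<in> seqs n. ys ! 0 = u \<and> (\<forall>i. 0 < i \<and> i < k \<longrightarrow> ys ! i = a i)}"

lemma sum_cylinder:
  fixes p :: "nat \<Rightarrow> 'b::finite \<Rightarrow> real"
  assumes one: "\<And>i. i < n \<Longrightarrow> (\<Sum>y\<in>UNIV. p i y) = 1" and k: "1 \<le> k" "k \<le> n"
  shows "(\<Sum>ys\<in>cylinder u a n k. prod_weight p n ys) = p 0 u * (\<Prod>i=1..<k. p i (a i))"
proof -
  define b where "b i = (if i = 0 then u else a i)" for i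
  \<comment> \<open>Factors set to zero off the cylinder turn the restricted sum into a full one,
    which factorises.\<close>
  define g where "g i y = (if i < k \<and> y \<noteq> b i then 0 else p i y)" for i y
  have mem: "ys \<in> cylinder u a n k \<longleftrightarrow> ys \<in> seqs n \<and> (\<forall>i<k. ys ! i = b i)" for ys
    using k unfolding cylinder_def b_def by auto
  have "(\<Sum>ys\<in>cylinder u a n k. prod_weight p n ys) = (\<Sum>ys\<in>cylinder u a n k. prod_weight g n ys)"
    by (intro sum.cong refl) (auto simp: mem g_def prod_weight_def intro!: prod.cong)
  also have "\<dots> = (\<Sum>ys\<in>seqs n. prod_weight g n ys)"
  proof (intro sum.mono_neutral_left ballI)
    fix ys assume "ys \<in> seqs n - cylinder u a n k"
    then obtain i where "i < k" "ys ! i \<noteq> b i" by (auto simp: mem)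
    then have "g i (ys ! i) = 0" "i < n" using k by (auto simp: g_def)
    then show "prod_weight g n ys = 0" by (auto simp: prod_weight_def)
  qed (auto simp: mem)
  also have "\<dots> = (\<Prod>i<n. \<Sum>y\<in>UNIV. g i y)" by (rule sum_prod_weight)
  also have "\<dots> = (\<Prod>i<n. if i < k then p i (b i) else 1)"
  proof (intro prod.cong refl)
    fix i assume i: "i \<in> {..<n}"
    have "(\<Sum>y\<in>UNIV. g i y) = (\<Sum>y\<in>UNIV. if y = b i then p i y else 0)" if "i < k"
      using that by (intro sum.cong) (auto simp: g_def)
    moreover have "(\<Sum>y\<in>UNIV. g i y) = (\<Sum>y\<in>UNIV. p i y)" if "\<not> i < k"
      using that by (intro sum.cong) (auto simp: g_def)
    ultimately show "(\<Sum>y\<in>UNIV. g i y) = (if i < k then p i (b i) else 1)"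
      using one i by auto
  qed
  also have "\<dots> = (\<Prod>i<k. if i < k then p i (b i) else 1)"
    by (intro prod.mono_neutral_right) (use k in auto)
  also have "{..<k} = insert 0 {1..<k}" using k by auto
  also have "(\<Prod>i\<in>insert 0 {1..<k}. if i < k then p i (b i) else 1) = p 0 u * (\<Prod>i=1..<k. p i (a i))"
    using k by (subst prod.insert) (auto simp: b_def intro!: prod.cong)
  finally show ?thesis .
qed

text \<open>Prescribing one more letter multiplies the probability by a factor between
  \<open>c\<close> and 1, so it descends without large jumps. The first length at which it is at
  most \<open>L / c\<close> is chosen; if this is not the shortest length, the previous value
  exceeded \<open>L / c\<close>, and the new one still exceeds \<open>L\<close>.\<close>

lemma cylinder_of_weight:
  fixes p :: "nat \<Rightarrow> 'b::finite \<Rightarrow> real"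
  assumes one: "\<And>i. i < n \<Longrightarrow> (\<Sum>y\<in>UNIV. p i y) = 1" and ge: "\<And>i y. i < n \<Longrightarrow> c \<le> p i y"
    and c: "0 < c" and n: "0 < n" and L: "0 < L" "L \<le> 1" and a: "(\<Prod>i<n. p i (a i)) \<le> L"
  obtains S where "S \<subseteq> {ys \<in> seqs n. ys ! 0 = u}"
    "c * L \<le> (\<Sum>ys\<in>S. prod_weight p n ys)" "(\<Sum>ys\<in>S. prod_weight p n ys) \<le> L / c"
    "(\<Sum>ys\<in>S. prod_weight p n ys) \<le> p 0 u"
proof -
  define F where "F k = p 0 u * (\<Prod>i=1..<k. p i (a i))" for k
  have pos: "0 < p i y" if "i < n" for i y using ge[OF that, of y] c by linarith
  have le1: "p i y \<le> 1" if "i < n" for i y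
    using member_le_sum[of y UNIV "p i"] pos[OF that] one[OF that] by (simp add: less_imp_le)
  have c1: "c \<le> 1" using ge[of 0 u] le1[of 0 u] n by linarith
  \<comment> \<open>The first letter is \<open>u\<close> instead of \<open>a 0\<close>; this costs
    at most the factor \<open>1 / c\<close>, which is the slack in the upper bound.\<close>
  have "F n \<le> L / c"
  proof -
    have set: "{..<n} = insert 0 {1..<n}" using n by auto
    have nn: "0 \<le> (\<Prod>i=1..<n. p i (a i))" by (intro prod_nonneg) (auto simp: pos less_imp_le)
    have "c * F n \<le> c * (\<Prod>i=1..<n. p i (a i))"
      unfolding F_def using le1[OF n, of u] pos[OF n, of u] nn c
      by (intro mult_left_mono mult_left_le_one_le) auto
    also have "\<dots> \<le> p 0 (a 0) * (\<Prod>i=1..<n. p i (a i))"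
      using ge[OF n] nn by (intro mult_right_mono) auto
    also have "\<dots> = (\<Prod>i<n. p i (a i))" unfolding set by simp
    also have "\<dots> \<le> L" by (rule a)
    finally show ?thesis using c by (simp add: field_simps)
  qed
  then have ex: "1 \<le> n \<and> F n \<le> L / c" using n by simp
  define k where "k = (LEAST k. 1 \<le> k \<and> F k \<le> L / c)"
  have k: "1 \<le> k" "F k \<le> L / c" using LeastI[of "\<lambda>k. 1 \<le> k \<and> F k \<le> L / c", OF ex] by (auto simp: k_def)
  have kn: "k \<le> n" unfolding k_def by (rule Least_le) (rule ex)
  have lower: "c * L \<le> F k"
  proof (cases "k = 1")
    case True
    have "c * L \<le> c * 1" using L c by (intro mult_left_mono) auto
    then show ?thesis using True ge[OF n, of u] by (simp add: F_def)
  next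
    case False
    then obtain j where j: "k = Suc j" "1 \<le> j" using k(1) by (cases k) auto
    then have "L / c < F j"
      using not_less_Least[of j "\<lambda>k. 1 \<le> k \<and> F k \<le> L / c"] by (auto simp: k_def)
    then have "L \<le> F j * c" using c by (simp add: field_simps)
    also have "\<dots> \<le> F j * p j (a j)"
    proof (intro mult_left_mono ge)
      show "j < n" using j kn by simp
      show "0 \<le> F j" using \<open>L / c < F j\<close> L c by (meson divide_nonneg_pos less_le order_trans)
    qed
    also have "\<dots> = F k" using j by (simp add: F_def)
    finally have "L \<le> F k" .
    moreover have "c * L \<le> 1 * L" using c1 L by (intro mult_right_mono) auto
    ultimately show ?thesis by simp
  qed
  have "F k \<le> p 0 u"
    unfolding F_def using pos[OF n, of u] kn
    by (intro mult_right_le_one_le prod_nonneg prod_le_1) (auto simp: le1 pos less_imp_le)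
  then show thesis
    using that[of "cylinder u a n k"] k lower sum_cylinder[of n p k u a] one kn
    by (auto simp: F_def cylinder_def)
qed

lemma kl_le_neg_ln:
  fixes p q :: "'b::finite \<Rightarrow> real"
  assumes "\<And>y. 0 < p y" "(\<Sum>y\<in>UNIV. p y) = 1" "0 < q a" "\<And>y. q a \<le> q y"
  shows "kl p q \<le> - ln (q a)"
proof -
  have "p y * ln (p y / q y) \<le> p y * - ln (q a)" for y
  proof -
    have "p y \<le> 1" using member_le_sum[of y UNIV p] assms(1,2) by (simp add: less_imp_le)
    moreover have "0 < q y" using assms(3,4) by (meson less_le_trans)
    moreover have "ln (q a) \<le> ln (q y)" using assms(3,4) \<open>0 < q y\<close> by simp
    moreover have "ln (p y) \<le> 0" using assms(1)[of y] \<open>p y \<le> 1\<close> by simp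
    ultimately have "ln (p y / q y) \<le> - ln (q a)"
      using ln_divide_pos[OF assms(1)[of y] \<open>0 < q y\<close>] by linarith
    then show ?thesis using assms(1)[of y] by (intro mult_left_mono) auto
  qed
  then have "kl p q \<le> (\<Sum>y\<in>UNIV. p y * - ln (q a))" unfolding kl_def by (rule sum_mono)
  then show ?thesis unfolding sum_distrib_right[symmetric] assms(2) by simp
qed

text \<open>A divergence from \<open>U x\<close> is at most minus the logarithm of the least entry
  of \<open>U x\<close>. Choosing the least likely letter everywhere thus gives a sequence of
  probability at most \<open>exp (- E)\<close>, along which cylinders can shrink to that
  order.\<close>

lemma prod_min_letter_le:
  fixes P U :: "'x::finite \<Rightarrow> 'y::finite \<Rightarrow> real"
  assumes P: "stochastic P" "\<And>x y. 0 < P x y" and U: "\<And>x y. 0 < U x y"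
    and e: "E \<le> (\<Sum>i<n. kl (P (xs ! i)) (U (xs ! i)))"
  obtains a where "(\<Prod>i<n. U (xs ! i) (a i)) \<le> exp (- E)"
proof -
  have "\<exists>a. \<forall>y. U x a \<le> U x y" for x
  proof -
    have "Min (range (U x)) \<in> range (U x)" by (intro Min_in) auto
    then obtain a where "U x a = Min (range (U x))" by (metis imageE)
    then show ?thesis by (metis Min_le finite finite_imageI rangeI)
  qed
  then obtain a where a: "\<And>x y. U x (a x) \<le> U x y" by metis
  have "(\<Prod>i<n. U (xs ! i) (a (xs ! i))) = exp (\<Sum>i<n. ln (U (xs ! i) (a (xs ! i))))"
    by (simp add: exp_sum U)
  also have "\<dots> \<le> exp (- E)"
  proof -
    have "(\<Sum>i<n. kl (P (xs ! i)) (U (xs ! i))) \<le> (\<Sum>i<n. - ln (U (xs ! i) (a (xs ! i))))"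
      by (intro sum_mono kl_le_neg_ln P stochastic_sum U a)
    then show ?thesis using e by (simp add: sum_negf)
  qed
  finally show thesis by (rule that)
qed

subsection \<open>Feinstein codes with codewords of nearly fixed type\<close>

text \<open>The support condition keeps the output law positive at every output that a codeword can
  produce, and it saves the cost constraint when the letters in the support of \<open>P\<close> all
  cost exactly \<open>B\<close>.\<close>

definition near_type :: "('a \<Rightarrow> real) \<Rightarrow> nat \<Rightarrow> real \<Rightarrow> 'a list set" where
  "near_type P n \<delta> = {xs \<in> seqs n. (\<forall>i<n. 0 < P (xs ! i)) \<and> (\<forall>a. \<bar>letter_freq xs a - P a\<bar> \<le> \<delta>)}"

lemma near_type_mono: "\<delta> \<le> \<delta>' \<Longrightarrow> near_type P n \<delta> \<subseteq> near_type P n \<delta>'"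
  by (auto simp: near_type_def) (meson order_trans)

lemma near_type_length: "xs \<in> near_type P n \<delta> \<Longrightarrow> length xs = n"
  by (simp add: near_type_def seqs_def)

lemma near_type_average:
  fixes \<phi> :: "'a::finite \<Rightarrow> real"
  assumes "xs \<in> near_type P n \<delta>" "0 < n"
  shows "\<bar>(\<Sum>i<n. \<phi> (xs ! i)) - real n * (\<Sum>a\<in>UNIV. P a * \<phi> a)\<bar> \<le> real n * (\<delta> * (\<Sum>a\<in>UNIV. \<bar>\<phi> a\<bar>))"
proof -
  have "\<bar>(\<Sum>a\<in>UNIV. letter_freq xs a * \<phi> a) - (\<Sum>a\<in>UNIV. P a * \<phi> a)\<bar>
      = \<bar>\<Sum>a\<in>UNIV. (letter_freq xs a - P a) * \<phi> a\<bar>"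
    by (simp add: sum_subtractf left_diff_distrib)
  also have "\<dots> \<le> (\<Sum>a\<in>UNIV. \<bar>letter_freq xs a - P a\<bar> * \<bar>\<phi> a\<bar>)"
    using sum_abs[of "\<lambda>a. (letter_freq xs a - P a) * \<phi> a" UNIV] by (simp add: abs_mult)
  also have "\<dots> \<le> (\<Sum>a\<in>UNIV. \<delta> * \<bar>\<phi> a\<bar>)"
    by (intro sum_mono mult_right_mono) (use assms in \<open>auto simp: near_type_def\<close>)
  finally have *: "\<bar>(\<Sum>a\<in>UNIV. letter_freq xs a * \<phi> a) - (\<Sum>a\<in>UNIV. P a * \<phi> a)\<bar> \<le> \<delta> * (\<Sum>a\<in>UNIV. \<bar>\<phi> a\<bar>)"
    by (simp add: sum_distrib_left)
  have "\<bar>(\<Sum>i<n. \<phi> (xs ! i)) - real n * (\<Sum>a\<in>UNIV. P a * \<phi> a)\<bar>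
      = real n * \<bar>(\<Sum>a\<in>UNIV. letter_freq xs a * \<phi> a) - (\<Sum>a\<in>UNIV. P a * \<phi> a)\<bar>"
    unfolding sum_over_letters[OF near_type_length[OF assms(1)] assms(2)]
    by (simp add: abs_mult flip: right_diff_distrib)
  then show ?thesis using * by (simp add: mult_left_mono)
qed

lemma sum_centered_indicator:
  fixes g :: "'a::finite \<Rightarrow> real"
  shows "(\<Sum>x\<in>UNIV. g x * ((if x = a then 1 else 0) - t)) = g a - (\<Sum>x\<in>UNIV. g x) * t"
proof -
  have "(\<Sum>x\<in>UNIV. g x * (if x = a then 1 else 0)) = (\<Sum>x\<in>UNIV. if x = a then g x else 0)"
    by (intro sum.cong) auto
  then show ?thesis by (simp add: right_diff_distrib sum_subtractf sum_distrib_right)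
qed

lemma sum_UNION_le:
  fixes f :: "'b \<Rightarrow> real"
  assumes "finite I" "\<And>i. i \<in> I \<Longrightarrow> finite (B i)" "\<And>y. 0 \<le> f y"
  shows "sum f (\<Union>i\<in>I. B i) \<le> (\<Sum>i\<in>I. sum f (B i))"
  using assms(1,2)
proof (induction I rule: finite_induct)
  case (insert i I)
  have "sum f (B i \<union> (\<Union>i\<in>I. B i)) \<le> sum f (B i) + sum f (\<Union>i\<in>I. B i)"
    by (rule sum_Un_le) (use insert assms(3) in auto)
  then show ?case using insert by force
qed simp

text \<open>Chebyshev for the centred indicator of each letter, whose variance is at most 1, and a
  union bound over the letters.\<close>

lemma near_type_prob:
  fixes P :: "'a::finite \<Rightarrow> real"
  assumes P: "distribution P" and pos: "0 < n" "0 < \<delta>"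
  shows "1 - real CARD('a) / (real n * \<delta>\<^sup>2) \<le> (\<Sum>xs\<in>near_type P n \<delta>. prod_weight (\<lambda>_. P) n xs)"
proof -
  let ?w = "prod_weight (\<lambda>_. P) n" and ?T = "near_type P n \<delta>"
  have P_nn: "0 \<le> P x" and P_sum: "(\<Sum>x\<in>UNIV. P x) = 1" for x
    using P by (auto simp: distribution_def)
  have P_le: "P x \<le> 1" for x using member_le_sum[of x UNIV P] P_nn P_sum by simp
  have w_nn: "0 \<le> ?w xs" for xs by (rule prod_weight_nonneg) (rule P_nn)
  let ?h = "\<lambda>a x. (if x = a then 1 else 0) - P a"
  let ?B = "\<lambda>a. {xs \<in> seqs n. real n * \<delta> \<le> \<bar>\<Sum>i<n. ?h a (xs ! i)\<bar>}"
  have B: "(\<Sum>xs\<in>?B a. ?w xs) \<le> 1 / (real n * \<delta>\<^sup>2)" for a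
  proof (rule prod_weight_chebyshev)
    show "(\<Sum>x\<in>UNIV. P x * ?h a x) = 0"
      unfolding sum_centered_indicator P_sum by simp
    have "(\<Sum>x\<in>UNIV. P x * (?h a x)\<^sup>2) \<le> (\<Sum>x\<in>UNIV. P x * 1)"
      using P_nn[of a] P_le[of a] by (intro sum_mono mult_left_mono P_nn) (auto simp: abs_square_le_1)
    then show "(\<Sum>x\<in>UNIV. P x * (?h a x)\<^sup>2) \<le> 1" using P_sum by simp
  qed (use P_nn P_sum pos in auto)
  have sumh: "(\<Sum>i<n. ?h a (xs ! i)) = real n * (letter_freq xs a - P a)" if "xs \<in> seqs n" for xs a
  proof -
    have len: "length xs = n" using that by (simp add: seqs_def)
    have "(\<Sum>b\<in>UNIV. letter_freq xs b * ?h a b) = letter_freq xs a - (\<Sum>b\<in>UNIV. letter_freq xs b) * P a"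
      by (rule sum_centered_indicator)
    then show ?thesis
      using distribution_letter_freq[OF len pos(1)] sum_over_letters[OF len pos(1), of "?h a"]
      by (simp add: distribution_def)
  qed
  \<comment> \<open>A sequence outside \<open>?T\<close> has a deviating letter frequency or
    contains a letter of probability 0, and in the latter case its weight vanishes.\<close>
  have "(\<Sum>xs\<in>seqs n - ?T. ?w xs) = (\<Sum>xs\<in>(seqs n - ?T) \<inter> (\<Union>a. ?B a). ?w xs)"
  proof (intro sum.mono_neutral_right ballI)
    fix xs assume xs: "xs \<in> seqs n - ?T - (seqs n - ?T) \<inter> (\<Union>a. ?B a)"
    then have seq: "xs \<in> seqs n" and lt: "\<bar>\<Sum>i<n. ?h a (xs ! i)\<bar> < real n * \<delta>" for a
      by (auto simp: not_le)
    have "real n * \<bar>letter_freq xs a - P a\<bar> < real n * \<delta>" for a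
      using lt[of a] unfolding sumh[OF seq] by (simp add: abs_mult)
    then have "\<bar>letter_freq xs a - P a\<bar> \<le> \<delta>" for a using pos by (simp add: less_imp_le)
    then obtain i where "i < n" "\<not> 0 < P (xs ! i)" using xs by (auto simp: near_type_def)
    then have "P (xs ! i) = 0" using P_nn[of "xs ! i"] by simp
    then show "?w xs = 0" using \<open>i < n\<close> by (auto simp: prod_weight_def)
  qed auto
  also have "\<dots> \<le> (\<Sum>xs\<in>(\<Union>a. ?B a). ?w xs)"
    by (intro sum_mono2) (auto simp: w_nn)
  also have "\<dots> \<le> (\<Sum>a\<in>UNIV. \<Sum>xs\<in>?B a. ?w xs)"
    by (rule sum_UNION_le) (auto simp: w_nn)
  also have "\<dots> \<le> real CARD('a) * (1 / (real n * \<delta>\<^sup>2))"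
    using sum_bounded_above[of UNIV "\<lambda>a. \<Sum>xs\<in>?B a. ?w xs", OF B] by simp
  finally have "(\<Sum>xs\<in>seqs n - ?T. ?w xs) \<le> real CARD('a) / (real n * \<delta>\<^sup>2)" by simp
  moreover have "(\<Sum>xs\<in>seqs n. ?w xs) = 1" by (rule sum_prod_weight_eq_1) (rule P_sum)
  moreover have "?T \<subseteq> seqs n" by (auto simp: near_type_def)
  ultimately show ?thesis using sum_diff[OF finite_seqs, of ?T n ?w] by simp
qed

text \<open>A new codeword receives \<open>G x\<close> minus the union \<open>E\<close> of the
  decoding sets already used. On \<open>G (f m)\<close> the output measure is at most
  \<open>exp (- \<theta>)\<close> times the channel law, so \<open>E\<close> has output measure at
  most \<open>M * exp (- \<theta>)\<close>. While this is below \<open>a * \<epsilon>\<close>, some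
  \<open>x\<close> in \<open>T\<close> makes \<open>E\<close> unlikely. Every single codeword
  obtains an error bound, as maximal error requires.\<close>

lemma feinstein:
  fixes k :: "'a \<Rightarrow> 'b \<Rightarrow> real" and w :: "'a \<Rightarrow> real"
  assumes fin: "finite X" "finite Z" and T: "T \<subseteq> X" and w: "\<And>x. 0 \<le> w x"
    and k: "\<And>x z. 0 \<le> k x z" "\<And>x. x \<in> T \<Longrightarrow> (\<Sum>z\<in>Z. k x z) \<le> 1"
    and G: "\<And>x. x \<in> T \<Longrightarrow> G x \<subseteq> Z" "\<And>x. x \<in> T \<Longrightarrow> (\<Sum>z\<in>Z - G x. k x z) \<le> \<epsilon>"
    and r: "\<And>x z. x \<in> T \<Longrightarrow> z \<in> G x \<Longrightarrow> (\<Sum>x'\<in>X. w x' * k x' z) \<le> exp (- \<theta>) * k x z"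
    and a: "a \<le> (\<Sum>x\<in>T. w x)" and \<epsilon>: "0 \<le> \<epsilon>"
  shows "real M \<le> exp \<theta> * a * \<epsilon> \<Longrightarrow> \<exists>f D. (\<forall>m\<in>{1..M}. f m \<in> T \<and> D m \<subseteq> G (f m) \<and>
           (\<Sum>z\<in>Z - D m. k (f m) z) \<le> 2 * \<epsilon>) \<and> disjoint_family_on D {1..M}"
proof (induction M)
  case 0
  then show ?case by (auto simp: disjoint_family_on_def)
next
  case (Suc M)
  then have "real M \<le> exp \<theta> * a * \<epsilon>" by simp
  from Suc.IH[OF this] obtain f D where IH: "\<And>m. m \<in> {1..M} \<Longrightarrow> f m \<in> T" "\<And>m. m \<in> {1..M} \<Longrightarrow> D m \<subseteq> G (f m)"
    "\<And>m. m \<in> {1..M} \<Longrightarrow> (\<Sum>z\<in>Z - D m. k (f m) z) \<le> 2 * \<epsilon>" "disjoint_family_on D {1..M}"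
    by blast
  define r where "r z = (\<Sum>x\<in>X. w x * k x z)" for z
  define E where "E = (\<Union>m\<in>{1..M}. D m)"
  have DZ: "D m \<subseteq> Z" if "m \<in> {1..M}" for m using IH(1,2)[OF that] G(1) by blast
  then have EZ: "E \<subseteq> Z" unfolding E_def by blast
  have finE: "finite E" using EZ fin(2) by (rule finite_subset)
  have finD: "finite (D m)" if "m \<in> {1..M}" for m using DZ[OF that] fin(2) by (rule finite_subset)
  have rE: "(\<Sum>z\<in>E. r z) \<le> real M * exp (- \<theta>)"
  proof -
    have "(\<Sum>z\<in>D m. r z) \<le> exp (- \<theta>)" if m: "m \<in> {1..M}" for m
    proof -
      have "(\<Sum>z\<in>D m. r z) \<le> (\<Sum>z\<in>D m. exp (- \<theta>) * k (f m) z)"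
        unfolding r_def by (intro sum_mono assms(9)) (use IH(1,2)[OF m] in auto)
      also have "\<dots> \<le> (\<Sum>z\<in>Z. exp (- \<theta>) * k (f m) z)"
        by (intro sum_mono2) (use fin DZ[OF m] k in auto)
      also have "\<dots> \<le> exp (- \<theta>) * 1"
        unfolding sum_distrib_left[symmetric] by (intro mult_left_mono k IH m) auto
      finally show ?thesis by simp
    qed
    then have "(\<Sum>m\<in>{1..M}. \<Sum>z\<in>D m. r z) \<le> (\<Sum>m\<in>{1..M}. exp (- \<theta>))"
      by (rule sum_mono)
    moreover have "(\<Sum>z\<in>E. r z) = (\<Sum>m\<in>{1..M}. \<Sum>z\<in>D m. r z)"
      unfolding E_def by (rule sum.UNION_disjoint_family) (use IH(4) finD in auto)
    ultimately show ?thesis by simp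
  qed
  \<comment> \<open>If every \<open>x\<close> in \<open>T\<close> gave \<open>E\<close> more than
    \<open>\<epsilon>\<close>, averaging with the weights \<open>w\<close> would force
    \<open>exp \<theta> * a * \<epsilon> \<le> M\<close>, although even \<open>Suc M\<close> is
    within this bound.\<close>
  have "\<exists>x\<in>T. (\<Sum>z\<in>E. k x z) \<le> \<epsilon>"
  proof (rule ccontr)
    assume "\<not> ?thesis"
    then have gt: "\<epsilon> \<le> (\<Sum>z\<in>E. k x z)" if "x \<in> T" for x using that by (meson not_le less_imp_le)
    have "a * \<epsilon> \<le> (\<Sum>x\<in>T. w x) * \<epsilon>" using a \<epsilon> by (intro mult_right_mono)
    also have "\<dots> \<le> (\<Sum>x\<in>T. w x * (\<Sum>z\<in>E. k x z))"
      unfolding sum_distrib_right by (intro sum_mono mult_left_mono gt w)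
    also have "\<dots> \<le> (\<Sum>x\<in>X. w x * (\<Sum>z\<in>E. k x z))"
      by (intro sum_mono2) (use fin T w k in \<open>auto intro!: mult_nonneg_nonneg sum_nonneg\<close>)
    also have "\<dots> = (\<Sum>z\<in>E. r z)"
      unfolding r_def sum_distrib_left by (rule sum.swap)
    also have "\<dots> \<le> real M * exp (- \<theta>)" by (rule rE)
    finally have "exp \<theta> * (a * \<epsilon>) \<le> exp \<theta> * (real M * exp (- \<theta>))" by (intro mult_left_mono) auto
    then have "exp \<theta> * a * \<epsilon> \<le> real M" by (simp add: exp_minus field_simps)
    then show False using Suc.prems by simp
  qed
  then obtain x where x: "x \<in> T" "(\<Sum>z\<in>E. k x z) \<le> \<epsilon>" by blast
  \<comment> \<open>One \<open>\<epsilon>\<close> for leaving \<open>G x\<close>, one for falling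
    into \<open>E\<close>.\<close>
  have new: "(\<Sum>z\<in>Z - (G x - E). k x z) \<le> 2 * \<epsilon>"
  proof -
    have "(\<Sum>z\<in>Z - (G x - E). k x z) \<le> (\<Sum>z\<in>(Z - G x) \<union> E. k x z)"
      by (intro sum_mono2) (use fin finE k in auto)
    also have "\<dots> \<le> (\<Sum>z\<in>Z - G x. k x z) + (\<Sum>z\<in>E. k x z)"
      by (rule sum_Un_le) (use fin finE k in auto)
    finally show ?thesis using G(2)[OF x(1)] x(2) by linarith
  qed
  have eq: "{1..Suc M} = insert (Suc M) {1..M}" by auto
  have "disjoint_family_on (D(Suc M := G x - E)) {1..Suc M}"
    using IH(4) unfolding eq disjoint_family_on_def E_def by auto
  moreover have "\<forall>m\<in>{1..Suc M}. (f(Suc M := x)) m \<in> T \<and> (D(Suc M := G x - E)) m \<subseteq> G ((f(Suc M := x)) m) \<and>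
      (\<Sum>z\<in>Z - (D(Suc M := G x - E)) m. k ((f(Suc M := x)) m) z) \<le> 2 * \<epsilon>"
    using IH(1-3) x(1) new by auto
  ultimately show ?case by blast
qed

lemma code_exists:
  fixes Q :: "'a::finite \<Rightarrow> 'c::finite \<Rightarrow> real"
  assumes Q: "stochastic Q" and P: "distribution P" and R: "0 \<le> R" "R < mutual_info P Q"
  obtains \<delta>1 v where "0 < \<delta>1"
    "\<And>\<delta> n. \<lbrakk>0 < \<delta>; \<delta> \<le> \<delta>1; 0 < n; 1 / 2 \<le> (\<Sum>xs\<in>near_type P n \<delta>. prod_weight (\<lambda>_. P) n xs)\<rbrakk> \<Longrightarrow>
      \<exists>f phi. (\<forall>m\<in>{1..nat \<lfloor>exp (real n * R)\<rfloor>}. f m \<in> near_type P n \<delta> \<and>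
         (\<Sum>z\<in>{z\<in>seqs n. phi z \<noteq> m}. prodch Q (f m) z) \<le> v / real n) \<and>
         (\<forall>z. phi z \<in> {1..nat \<lfloor>exp (real n * R)\<rfloor>})"
proof -
  define r where "r = (\<lambda>z. \<Sum>x\<in>UNIV. P x * Q x z)"
  \<comment> \<open>The gap between information and rate is \<open>4 * \<gamma>\<close>: one
    \<open>\<gamma>\<close> for the letter frequencies of a codeword, one for typicality, and two to
    outgrow the factors \<open>1 / 2\<close> and \<open>?\<epsilon>\<close> in Feinstein's size
    bound.\<close>
  define \<gamma> where "\<gamma> = (mutual_info P Q - R) / 4"
  have \<gamma>: "0 < \<gamma>" using R by (simp add: \<gamma>_def)
  define \<phi> where "\<phi> = (\<lambda>x. kl (Q x) r)"
  define \<Phi> where "\<Phi> = (\<Sum>x\<in>UNIV. \<bar>\<phi> x\<bar>)"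
  have \<Phi>: "0 \<le> \<Phi>" by (simp add: \<Phi>_def sum_nonneg)
  \<comment> \<open>The summand \<open>\<gamma>\<close> guarantees \<open>\<gamma> \<le> v\<close>,
    so that \<open>?\<epsilon>\<close> is not too small for the size bound even if all variances
    vanish.\<close>
  define v where "v = \<gamma> + (\<Sum>x\<in>UNIV. \<Sum>z\<in>UNIV. Q x z * (ln (Q x z / r z))\<^sup>2)"
  have var: "(\<Sum>z\<in>UNIV. Q x z * (ln (Q x z / r z))\<^sup>2) \<le> v" for x
    using member_le_sum[of x UNIV "\<lambda>x. \<Sum>z\<in>UNIV. Q x z * (ln (Q x z / r z))\<^sup>2"] \<gamma>
    by (simp add: v_def sum_nonneg stochastic_nonneg[OF Q])
  have v: "\<gamma> \<le> v" by (simp add: v_def sum_nonneg stochastic_nonneg[OF Q])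
  have P_nn: "0 \<le> P x" for x using P by (simp add: distribution_def)
  define \<delta>1 where "\<delta>1 = \<gamma> / (\<Phi> + 1)"
  show thesis
  proof (rule that[of \<delta>1 "2 * (v / \<gamma>\<^sup>2)"])
    show "0 < \<delta>1" using \<gamma> \<Phi> by (simp add: \<delta>1_def)
    fix \<delta> :: real and n :: nat
    assume \<delta>: "0 < \<delta>" "\<delta> \<le> \<delta>1" and n: "0 < n"
      and T: "1 / 2 \<le> (\<Sum>xs\<in>near_type P n \<delta>. prod_weight (\<lambda>_. P) n xs)"
    let ?M = "nat \<lfloor>exp (real n * R)\<rfloor>"
    let ?T = "near_type P n \<delta>" and ?\<epsilon> = "v / (real n * \<gamma>\<^sup>2)"
    let ?\<theta> = "real n * (mutual_info P Q - 2 * \<gamma>)"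
    let ?G = "\<lambda>x. typical (\<lambda>i. Q (x ! i)) (\<lambda>_. r) n \<gamma>"
    have \<delta>\<Phi>: "\<delta> * \<Phi> \<le> \<gamma>"
    proof -
      have "\<delta> * \<Phi> \<le> \<delta>1 * (\<Phi> + 1)" using \<delta> \<Phi> \<open>0 < \<delta>1\<close> by (intro mult_mono) auto
      also have "\<dots> = \<gamma>" using \<Phi> by (simp add: \<delta>1_def)
      finally show ?thesis .
    qed
    \<comment> \<open>The average runs over the full i.i.d. input law and not over its restriction
      to \<open>?T\<close>, so that the output law is again a product.\<close>
    have out: "(\<Sum>x\<in>seqs n. prod_weight (\<lambda>_. P) n x * prodch Q x z) = prod_weight (\<lambda>_. r) n z" for z
    proof -
      have "(\<Sum>x\<in>seqs n. prod_weight (\<lambda>_. P) n x * prodch Q x z)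
          = (\<Sum>x\<in>seqs n. prod_weight (\<lambda>i x. P x * Q x (z ! i)) n x)"
        by (intro sum.cong refl) (simp add: prod_weight_def prodch_def seqs_def prod.distrib)
      also have "\<dots> = prod_weight (\<lambda>_. r) n z"
        unfolding sum_prod_weight by (simp add: prod_weight_def r_def)
      finally show ?thesis .
    qed
    have "\<exists>f D. (\<forall>m\<in>{1..?M}. f m \<in> ?T \<and> D m \<subseteq> ?G (f m) \<and>
           (\<Sum>z\<in>seqs n - D m. prodch Q (f m) z) \<le> 2 * ?\<epsilon>) \<and> disjoint_family_on D {1..?M}"
    proof (rule feinstein[where X = "seqs n" and w = "prod_weight (\<lambda>_. P) n" and \<theta> = ?\<theta> and a = "1/2"])
      fix x assume x: "x \<in> ?T"
      have len: "length x = n" by (rule near_type_length[OF x])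
      show "(\<Sum>z\<in>seqs n. prodch Q x z) \<le> 1" using sum_prodch[OF Q len] by simp
      show "?G x \<subseteq> seqs n" by (auto simp: typical_def)
      show "(\<Sum>z\<in>seqs n - ?G x. prodch Q x z) \<le> ?\<epsilon>"
        unfolding prodch_eq_prod_weight[OF len]
        by (rule typical_compl) (use var n \<gamma> in \<open>auto simp: stochastic_nonneg[OF Q] stochastic_sum[OF Q]\<close>)
      fix z assume z: "z \<in> ?G x"
      have r_pos: "0 < r z" if "i < n" "0 < Q (x ! i) z" for i z
      proof -
        have "0 < P (x ! i) * Q (x ! i) z" using x that by (simp add: near_type_def)
        also have "\<dots> \<le> r z" unfolding r_def by (rule output_ge[OF Q P])
        finally show ?thesis .
      qed
      have I: "(\<Sum>a\<in>UNIV. P a * \<phi> a) = mutual_info P Q"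
        by (simp add: mutual_info_eq_kl \<phi>_def r_def)
      have "real n * (mutual_info P Q) - real n * (\<delta> * \<Phi>) \<le> (\<Sum>i<n. kl (Q (x ! i)) r)"
        using near_type_average[OF x n, of \<phi>] unfolding I \<Phi>_def[symmetric] by (simp add: \<phi>_def)
      moreover have "real n * (\<delta> * \<Phi>) \<le> real n * \<gamma>" using \<delta>\<Phi> by (intro mult_left_mono) auto
      ultimately have D: "- (\<Sum>i<n. kl (Q (x ! i)) r) + real n * \<gamma> \<le> - ?\<theta>"
        by (simp add: algebra_simps)
      have "prod_weight (\<lambda>_. r) n z \<le> exp (- (\<Sum>i<n. kl (Q (x ! i)) r) + real n * \<gamma>) * prodch Q x z"
        unfolding prodch_eq_prod_weight[OF len]
        by (rule typical_ratio(2)) (use r_pos z in \<open>auto simp: stochastic_nonneg[OF Q] stochastic_sum[OF Q]\<close>)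
      also have "\<dots> \<le> exp (- ?\<theta>) * prodch Q x z"
        using D by (intro mult_right_mono prodch_nonneg Q) simp
      finally show "(\<Sum>x\<in>seqs n. prod_weight (\<lambda>_. P) n x * prodch Q x z) \<le> exp (- ?\<theta>) * prodch Q x z"
        unfolding out .
    next
      have "real ?M \<le> exp (real n * R)" by simp
      also have "\<dots> = exp (real n * R) * 1" by simp
      also have "\<dots> \<le> exp (real n * R) * (exp (real n * (2 * \<gamma>)) * (1 / 2) * ?\<epsilon>)"
      proof (intro mult_left_mono)
        have "real n * (2 * \<gamma>) \<le> exp (real n * (2 * \<gamma>))"
          using exp_ge_add_one_self[of "real n * (2 * \<gamma>)"] by linarith
        then have "(real n * (2 * \<gamma>)) * \<gamma> \<le> exp (real n * (2 * \<gamma>)) * v"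
          using v \<gamma> by (intro mult_mono) auto
        then show "1 \<le> exp (real n * (2 * \<gamma>)) * (1 / 2) * ?\<epsilon>"
          using n \<gamma> by (simp add: field_simps power2_eq_square)
      qed simp
      also have "\<dots> = exp ?\<theta> * (1 / 2) * ?\<epsilon>"
      proof -
        have "?\<theta> = real n * R + real n * (2 * \<gamma>)" by (simp add: \<gamma>_def field_simps)
        then have "exp ?\<theta> = exp (real n * R) * exp (real n * (2 * \<gamma>))" by (simp only: exp_add)
        then show ?thesis by simp
      qed
      finally show "real ?M \<le> exp ?\<theta> * (1 / 2) * ?\<epsilon>" .
    qed (use T v \<gamma> P_nn in \<open>auto simp: near_type_def intro!: prodch_nonneg Q prod_weight_nonneg\<close>)
    then obtain f D where fD: "\<And>m. m \<in> {1..?M} \<Longrightarrow> f m \<in> ?T"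
        "\<And>m. m \<in> {1..?M} \<Longrightarrow> (\<Sum>z\<in>seqs n - D m. prodch Q (f m) z) \<le> 2 * ?\<epsilon>" "disjoint_family_on D {1..?M}"
      by blast
    have M1: "1 \<le> ?M" using R n by (simp add: le_nat_floor le_floor_iff nat_le_eq_zle)
    \<comment> \<open>Outputs in no decoding set go to message 1; the error bound already counts
      them as errors for every codeword.\<close>
    define phi where "phi z = (if \<exists>m\<in>{1..?M}. z \<in> D m then (SOME m. m \<in> {1..?M} \<and> z \<in> D m) else 1)" for z
    have phi_in: "phi z \<in> {1..?M}" for z
    proof (cases "\<exists>m\<in>{1..?M}. z \<in> D m")
      case True
      then have "\<exists>m. m \<in> {1..?M} \<and> z \<in> D m" by blast
      then have "(SOME m. m \<in> {1..?M} \<and> z \<in> D m) \<in> {1..?M}" by (rule someI2_ex) simp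
      then show ?thesis using True by (simp add: phi_def)
    next
      case False then show ?thesis using M1 by (auto simp: phi_def)
    qed
    have phi_eq: "phi z = m" if m: "m \<in> {1..?M}" "z \<in> D m" for z m
    proof -
      have ex: "\<exists>m. m \<in> {1..?M} \<and> z \<in> D m" using m by blast
      have "(SOME m. m \<in> {1..?M} \<and> z \<in> D m) = m"
      proof (rule someI2_ex[OF ex])
        fix m' assume "m' \<in> {1..?M} \<and> z \<in> D m'"
        then show "m' = m" using m disjoint_family_onD[OF fD(3), of m' m] by blast
      qed
      then show ?thesis using m by (auto simp: phi_def)
    qed
    have "(\<Sum>z\<in>{z\<in>seqs n. phi z \<noteq> m}. prodch Q (f m) z) \<le> 2 * (v / \<gamma>\<^sup>2) / real n" if m: "m \<in> {1..?M}" for m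
    proof -
      have "(\<Sum>z\<in>{z\<in>seqs n. phi z \<noteq> m}. prodch Q (f m) z) \<le> (\<Sum>z\<in>seqs n - D m. prodch Q (f m) z)"
        by (intro sum_mono2) (use phi_eq[OF m] in \<open>auto intro: prodch_nonneg Q\<close>)
      also have "\<dots> \<le> 2 * ?\<epsilon>" by (rule fD(2)[OF m])
      finally show ?thesis by (simp add: field_simps)
    qed
    then show "\<exists>f phi. (\<forall>m\<in>{1..?M}. f m \<in> near_type P n \<delta> \<and>
         (\<Sum>z\<in>{z\<in>seqs n. phi z \<noteq> m}. prodch Q (f m) z) \<le> 2 * (v / \<gamma>\<^sup>2) / real n) \<and>
         (\<forall>z. phi z \<in> {1..?M})"
      using fD(1) phi_in by blast
  qed
qed

text \<open>At rate 0 a strict inequality may be impossible because the information can vanish.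
  There \<open>exp 0 = 1\<close> leaves a single message, decoded without error.\<close>

lemma code_exists_at_admissible_rate:
  fixes Q :: "'x::finite \<Rightarrow> 'z::finite \<Rightarrow> real"
  assumes Q: "stochastic Q" and P: "distribution P" and R: "0 \<le> R" "R = 0 \<or> R < mutual_info P Q"
  obtains \<delta>1 v where "0 < \<delta>1"
    "\<And>\<delta> n. \<lbrakk>0 < \<delta>; \<delta> \<le> \<delta>1; 0 < n; 1 / 2 \<le> (\<Sum>xs\<in>near_type P n \<delta>. prod_weight (\<lambda>_. P) n xs)\<rbrakk> \<Longrightarrow>
      \<exists>f phi. (\<forall>m\<in>{1..nat \<lfloor>exp (real n * R)\<rfloor>}. f m \<in> near_type P n \<delta> \<and>
         (\<Sum>z\<in>{z\<in>seqs n. phi z \<noteq> m}. prodch Q (f m) z) \<le> v / real n) \<and>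
         (\<forall>z. phi z \<in> {1..nat \<lfloor>exp (real n * R)\<rfloor>})"
proof (cases "R = 0")
  case True
  show thesis
  proof (rule that[of 1 0])
    fix \<delta> :: real and n :: nat
    assume "1 / 2 \<le> (\<Sum>xs\<in>near_type P n \<delta>. prod_weight (\<lambda>_. P) n xs)"
    then have "near_type P n \<delta> \<noteq> {}" by auto
    then obtain xs where xs: "xs \<in> near_type P n \<delta>" by blast
    show "\<exists>f phi. (\<forall>m\<in>{1..nat \<lfloor>exp (real n * R)\<rfloor>}. f m \<in> near_type P n \<delta> \<and>
         (\<Sum>z\<in>{z\<in>seqs n. phi z \<noteq> m}. prodch Q (f m) z) \<le> 0 / real n) \<and>
         (\<forall>z. phi z \<in> {1..nat \<lfloor>exp (real n * R)\<rfloor>})"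
      using xs True by (intro exI[of _ "\<lambda>_. xs"] exI[of _ "\<lambda>_. 1"]) auto
  qed simp
next
  case False
  then show thesis using code_exists[OF Q P R(1)] R(2) that by blast
qed

subsection \<open>Rates and achievable triples\<close>

lemma ln_over_n_tendsto:
  fixes a :: "nat \<Rightarrow> real"
  assumes lk: "0 < l" "0 < k"
    and le: "\<forall>\<^sub>F n in sequentially. l * exp (real n * x) \<le> a n \<and> a n \<le> k * exp (real n * x)"
  shows "(\<lambda>n. ln (a n) / real n) \<longlonglongrightarrow> x"
proof (rule tendsto_sandwich)
  have "\<forall>\<^sub>F n in sequentially. ln l / real n + x \<le> ln (a n) / real n \<and> ln (a n) / real n \<le> ln k / real n + x"
    using le eventually_gt_at_top[of 0]
  proof eventually_elim
    case (elim n)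
    have "0 < l * exp (real n * x)" using lk by simp
    then have pos: "0 < a n" using elim by linarith
    have "ln (l * exp (real n * x)) \<le> ln (a n)" "ln (a n) \<le> ln (k * exp (real n * x))"
      using elim pos lk by auto
    then have "ln l + real n * x \<le> ln (a n)" "ln (a n) \<le> ln k + real n * x"
      using lk by (simp_all add: ln_mult)
    then have "(ln l + real n * x) / real n \<le> ln (a n) / real n" "ln (a n) / real n \<le> (ln k + real n * x) / real n"
      by (auto intro: divide_right_mono)
    then show ?case using elim by (simp add: add_divide_distrib)
  qed
  then show "\<forall>\<^sub>F n in sequentially. ln l / real n + x \<le> ln (a n) / real n"
    "\<forall>\<^sub>F n in sequentially. ln (a n) / real n \<le> ln k / real n + x"
    by (auto elim: eventually_mono)
  show "(\<lambda>n. ln l / real n + x) \<longlonglongrightarrow> x" "(\<lambda>n. ln k / real n + x) \<longlonglongrightarrow> x"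
    by real_asymp+
qed

lemma liminf_eq_of_tendsto:
  "X \<longlonglongrightarrow> x \<Longrightarrow> ereal x = liminf (\<lambda>n. ereal (X n))"
  by (intro lim_imp_Liminf[symmetric]) auto

lemma eps_code_bounds:
  assumes "1 \<le> M" "\<And>m. m \<in> {1..M} \<Longrightarrow> l \<le> e (f m) \<and> e (f m) \<le> h"
  shows "l \<le> eps_code e M f" "eps_code e M f \<le> h"
proof -
  have ne: "e ` f ` {1..M} \<noteq> {}" using assms(1) by auto
  have "Max (e ` f ` {1..M}) \<in> e ` f ` {1..M}" by (rule Max_in) (use ne in auto)
  then show "l \<le> eps_code e M f" "eps_code e M f \<le> h"
    using assms(2) unfolding eps_code_def by auto
qed

lemma eps_code_ge:
  "m \<in> {1..M} \<Longrightarrow> e (f m) \<le> eps_code e M f"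
  unfolding eps_code_def by (intro Max_ge) auto

lemma eps0_eq: "length xs = n \<Longrightarrow> eps0 W psi xs = (\<Sum>ys\<in>{ys \<in> seqs n. psi ys xs}. prodch W xs ys)"
  by (simp add: eps0_def)

lemma eps1_eq: "length xs = n \<Longrightarrow> eps1 V psi xs = (\<Sum>ys\<in>seqs n - {ys \<in> seqs n. psi ys xs}. prodch V xs ys)"
  by (auto simp: eps1_def intro!: sum.cong)

text \<open>Passing to the most frequent type divides \<open>M\<close> by at most
  \<open>(n + 1) ^ CARD('x)\<close>. Assumption \<open>n4\<close> absorbs the logarithm of this
  factor, together with \<open>ln 4\<close>, into one \<open>\<gamma>\<close>; the other comes from
  the packing bound.\<close>

lemma code_rate_le:
  fixes Q :: "'x::finite \<Rightarrow> 'z::finite \<Rightarrow> real"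
  assumes Q: "stochastic Q" and q: "0 < q" "q \<le> 1" "\<And>x z. 0 < Q x z \<Longrightarrow> q \<le> Q x z"
    and code: "is_code b B n M f phi psi" and n0: "0 < n" and \<gamma>: "0 < \<gamma>"
    and nerr: "max_dec_err Q n M f phi < 1 / 2"
    and n3: "(ln (real n) - ln q)\<^sup>2 / real n < \<gamma>\<^sup>2 / 4"
    and n4: "(ln 4 + real CARD('x) * ln (real n + 1)) / real n < \<gamma>"
  obtains m where "m \<in> {1..M}" "ln (real M) / real n \<le> mutual_info (letter_freq (f m)) Q + 2 * \<gamma>"
proof -
  have M1: "1 \<le> M" and len: "\<And>m. m \<in> {1..M} \<Longrightarrow> length (f m) = n"
    using code by (auto simp: is_code_def)
  obtain S P where S: "S \<subseteq> {1..M}" "S \<noteq> {}" and freq: "\<And>m. m \<in> S \<Longrightarrow> letter_freq (f m) = P"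
    and card_S: "M \<le> (n + 1) ^ CARD('x) * card S"
    using constant_composition_subcode[of M f n] len M1 by metis
  obtain m where m: "m \<in> S" "m \<in> {1..M}" using S by blast
  have P: "distribution P" using distribution_letter_freq[OF len[OF m(2)] n0] freq[OF m(1)] by simp
  have "real (card S) \<le> 4 * exp (real n * (mutual_info P Q + \<gamma>))"
  proof (rule constant_composition_card_le[where f = "f" and D = "\<lambda>m. {z \<in> seqs n. phi z = m}" and q = q])
    fix m assume "m \<in> S"
    then have m: "m \<in> {1..M}" using S by blast
    have "(\<Sum>z\<in>{z\<in>seqs n. phi z \<noteq> m}. prodch Q (f m) z) \<le> max_dec_err Q n M f phi"
      unfolding max_dec_err_def by (intro Max_ge) (use m in auto)
    moreover have "{z\<in>seqs n. phi z \<noteq> m} = seqs n - {z \<in> seqs n. phi z = m}" by auto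
    ultimately show "1 / 2 \<le> (\<Sum>z\<in>{z \<in> seqs n. phi z = m}. prodch Q (f m) z)"
      using nerr sum_prodch_Diff[OF Q len[OF m], of "{z \<in> seqs n. phi z = m}"] by auto
    show "length (f m) = n" by (rule len[OF m])
  next
    show "(ln (real n) - ln q)\<^sup>2 / (real n * \<gamma>\<^sup>2) \<le> 1 / 4"
      using n3 n0 \<gamma> by (simp add: field_simps)
    show "finite S" using S(1) by (rule finite_subset) simp
    show "disjoint_family_on (\<lambda>m. {z \<in> seqs n. phi z = m}) S" by (auto simp: disjoint_family_on_def)
    show "\<And>m. m \<in> S \<Longrightarrow> {z \<in> seqs n. phi z = m} \<subseteq> seqs n" by blast
  qed (fact Q q freq P n0 \<gamma>)+
  then have "real (n + 1) ^ CARD('x) * real (card S) \<le> real (n + 1) ^ CARD('x) * (4 * exp (real n * (mutual_info P Q + \<gamma>)))"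
    by (intro mult_left_mono) auto
  moreover have "real M \<le> real (n + 1) ^ CARD('x) * real (card S)"
    using card_S by (metis of_nat_le_iff of_nat_mult of_nat_power)
  ultimately have "real M \<le> real (n + 1) ^ CARD('x) * (4 * exp (real n * (mutual_info P Q + \<gamma>)))"
    by linarith
  then have "ln (real M) \<le> ln (real (n + 1) ^ CARD('x) * (4 * exp (real n * (mutual_info P Q + \<gamma>))))"
    using M1 by (subst ln_le_cancel_iff) (auto intro!: mult_pos_pos)
  also have "\<dots> = (ln 4 + real CARD('x) * ln (real n + 1)) + real n * (mutual_info P Q + \<gamma>)"
    by (simp add: ln_mult ln_realpow add.commute)
  also have "\<dots> \<le> real n * \<gamma> + real n * (mutual_info P Q + \<gamma>)"
    using n4 n0 by (simp add: divide_less_eq mult.commute)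
  also have "\<dots> = real n * (mutual_info P Q + 2 * \<gamma>)" by (simp add: algebra_simps)
  finally have "ln (real M) / real n \<le> mutual_info P Q + 2 * \<gamma>"
    using n0 by (simp add: divide_le_eq mult.commute)
  then show thesis using that[OF m(2)] freq[OF m(1)] by simp
qed

text \<open>The strict inequalities leave the slack that the tests consume. The pair (0, 0) stands
  apart because both divergences vanish when \<open>W\<close> and \<open>V\<close> agree on the
  support of \<open>P\<close>.\<close>

definition admissible_exponents ::
  "('x::finite \<Rightarrow> 'y::finite \<Rightarrow> real) \<Rightarrow> ('x \<Rightarrow> 'y \<Rightarrow> real) \<Rightarrow> ('x \<Rightarrow> real) \<Rightarrow> real \<Rightarrow> real \<Rightarrow> bool" where
  "admissible_exponents W V P e0 e1 \<longleftrightarrow> 0 \<le> e0 \<and> 0 \<le> e1 \<and> (e0 = 0 \<and> e1 = 0 \<or>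
     (\<exists>s\<in>{0..1}. e0 < cond_div (tilted W V s) W P \<and> e1 < cond_div (tilted W V s) V P))"

lemma achievableE:
  fixes Q :: "'x::finite \<Rightarrow> 'z::finite \<Rightarrow> real" and W V :: "'x \<Rightarrow> 'y::finite \<Rightarrow> real"
  assumes "(R, E0, E1) \<in> achievable Q W V b B"
  obtains M f psi \<tau> and phi :: "nat \<Rightarrow> 'z list \<Rightarrow> nat" where
    "\<forall>n\<ge>1. is_code b B n (M n) (f n) (phi n) (psi n)" "\<tau> < 1"
    "\<forall>n\<ge>1. max (eps_code (eps0 W (psi n)) (M n) (f n)) (eps_code (eps1 V (psi n)) (M n) (f n)) \<le> \<tau>"
    "(\<lambda>n. max_dec_err Q n (M n) (f n) (phi n)) \<longlonglongrightarrow> 0"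
    "ereal R = liminf (\<lambda>n. ereal (ln (real (M n)) / real n))"
    "ereal E0 = liminf (\<lambda>n. ereal (- ln (eps_code (eps0 W (psi n)) (M n) (f n)) / real n))"
    "ereal E1 = liminf (\<lambda>n. ereal (- ln (eps_code (eps1 V (psi n)) (M n) (f n)) / real n))"
  using assms unfolding achievable_def mem_Collect_eq prod.case
  by (elim exE conjE) (rule that)

text \<open>Non-negativity of the triple is left out, so that the predicate also applies to triples
  lowered by a small amount.\<close>

definition dominated_by ::
  "('x::finite \<Rightarrow> 'z::finite \<Rightarrow> real) \<Rightarrow> ('x \<Rightarrow> 'y::finite \<Rightarrow> real) \<Rightarrow> ('x \<Rightarrow> 'y \<Rightarrow> real) \<Rightarrow> ('x \<Rightarrow> real) \<Rightarrow> real
    \<Rightarrow> ('x \<Rightarrow> real) \<Rightarrow> real \<Rightarrow> real \<Rightarrow> real \<Rightarrow> real \<Rightarrow> bool" where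
  "dominated_by Q W V b B P s R E0 E1 \<longleftrightarrow>
     distribution P \<and> (\<Sum>x\<in>UNIV. P x * b x) \<le> B \<and> s \<in> {0..1} \<and> R \<le> mutual_info P Q \<and>
     E0 \<le> cond_div (tilted W V s) W P \<and> E1 \<le> cond_div (tilted W V s) V P"

lemma positive_entries_ge:
  fixes Q :: "'x::finite \<Rightarrow> 'z::finite \<Rightarrow> real"
  obtains q where "0 < q" "q \<le> 1" "\<And>x z. 0 < Q x z \<Longrightarrow> q \<le> Q x z"
proof -
  \<comment> \<open>The inserted 1 makes the set nonempty and forces the minimum to be at most
    1.\<close>
  let ?S = "insert 1 {Q x z | x z. 0 < Q x z}"
  have "{Q x z | x z. 0 < Q x z} \<subseteq> (\<lambda>(x, z). Q x z) ` UNIV" by auto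
  then have "finite {Q x z | x z. 0 < Q x z}" by (rule finite_subset) simp
  then have fin: "finite ?S" by simp
  show thesis
  proof (rule that[of "Min ?S"])
    have "Min ?S \<in> ?S" by (rule Min_in) (use fin in auto)
    then show "0 < Min ?S" by auto
    show "Min ?S \<le> 1" by (rule Min_le) (use fin in auto)
    show "Min ?S \<le> Q x z" if "0 < Q x z" for x z by (rule Min_le) (use fin that in auto)
  qed
qed

subsection \<open>Continuity of the information quantities\<close>

lemma continuous_on_xlnx: "continuous_on {0..} (\<lambda>x::real. x * ln x)"
  unfolding continuous_on_eq_continuous_within
proof
  fix x :: real assume "x \<in> {0..}"
  then show "continuous (at x within {0..}) (\<lambda>x. x * ln x)"
  proof (cases "x = 0")
    case True
    have "((\<lambda>x::real. x * ln x) \<longlongrightarrow> 0) (at_right 0)" by real_asymp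
    then show ?thesis using True by (simp add: continuous_within at_within_Ici_at_right)
  next
    case False
    then show ?thesis by (intro continuous_intros) auto
  qed
qed

text \<open>The defining logarithm is singular where an output probability tends to 0. As a
  difference of entropies, the input distribution enters only linearly or through
  \<open>x * ln x\<close>, which is continuous at 0.\<close>

lemma mutual_info_eq_entropies:
  assumes Q: "stochastic Q" and P: "distribution P"
  shows "mutual_info P Q = (\<Sum>x\<in>UNIV. P x * (\<Sum>z\<in>UNIV. Q x z * ln (Q x z)))
    - (\<Sum>z\<in>UNIV. (\<Sum>x\<in>UNIV. P x * Q x z) * ln (\<Sum>x\<in>UNIV. P x * Q x z))"
proof -
  define r where "r z = (\<Sum>x\<in>UNIV. P x * Q x z)" for z
  have "P x * Q x z * ln (Q x z / r z) = P x * (Q x z * ln (Q x z)) - P x * Q x z * ln (r z)" for x z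
  proof (cases "P x * Q x z = 0")
    case False
    then have "0 < P x * Q x z" using P Q by (simp add: distribution_def stochastic_def less_le)
    moreover have "P x * Q x z \<le> r z" unfolding r_def by (rule output_ge[OF Q P])
    moreover have "0 < Q x z" using False stochastic_nonneg[OF Q, of x z] by (simp add: less_le)
    ultimately show ?thesis by (simp add: ln_divide_pos algebra_simps)
  qed auto
  then have "mutual_info P Q = (\<Sum>x\<in>UNIV. \<Sum>z\<in>UNIV. P x * (Q x z * ln (Q x z)))
      - (\<Sum>x\<in>UNIV. \<Sum>z\<in>UNIV. P x * Q x z * ln (r z))"
    by (simp add: mutual_info_def r_def[symmetric] sum_subtractf)
  also have "(\<Sum>x\<in>UNIV. \<Sum>z\<in>UNIV. P x * Q x z * ln (r z)) = (\<Sum>z\<in>UNIV. r z * ln (r z))"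
    by (subst sum.swap) (simp add: r_def sum_distrib_right)
  finally show ?thesis by (simp add: r_def sum_distrib_left)
qed

lemma mutual_info_tendsto:
  fixes P :: "nat \<Rightarrow> 'x::finite \<Rightarrow> real" and Q :: "'x \<Rightarrow> 'z::finite \<Rightarrow> real"
  assumes Q: "stochastic Q" and P: "\<And>k. distribution (P k)" "distribution P'" and lim: "\<And>x. (\<lambda>k. P k x) \<longlonglongrightarrow> P' x"
  shows "(\<lambda>k. mutual_info (P k) Q) \<longlonglongrightarrow> mutual_info P' Q"
proof -
  have ent: "(\<lambda>k. (\<Sum>x\<in>UNIV. P k x * Q x z) * ln (\<Sum>x\<in>UNIV. P k x * Q x z))
      \<longlonglongrightarrow> (\<Sum>x\<in>UNIV. P' x * Q x z) * ln (\<Sum>x\<in>UNIV. P' x * Q x z)" for z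
    by (rule continuous_on_tendsto_compose[OF continuous_on_xlnx])
       (auto intro!: tendsto_intros lim output_nonneg Q P always_eventually)
  show ?thesis
    unfolding mutual_info_eq_entropies[OF Q P(1)] mutual_info_eq_entropies[OF Q P(2)]
    by (intro tendsto_diff tendsto_sum ent tendsto_mult_right lim)
qed

text \<open>This is \<open>ln t \<le> t - 1\<close> at \<open>t = q y / p y\<close>, summed over
  \<open>y\<close>; equality there holds only for \<open>t = 1\<close>.\<close>

lemma kl_nonneg:
  assumes "\<And>y. 0 < p y" "\<And>y. 0 < q y" "(\<Sum>y\<in>UNIV. p y) = 1" "(\<Sum>y\<in>UNIV. q y) = 1"
  shows "0 \<le> kl p q" and "p \<noteq> q \<Longrightarrow> 0 < kl p q"
proof -
  have le: "p y - q y \<le> p y * ln (p y / q y)" for y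
  proof -
    have "ln (q y / p y) \<le> q y / p y - 1" using assms(1,2) by (intro ln_le_minus_one) simp
    then have "p y * ln (q y / p y) \<le> p y * (q y / p y - 1)"
      using assms(1)[of y] by (intro mult_left_mono) auto
    then show ?thesis using assms(1)[of y] assms(2)[of y] by (simp add: ln_divide_pos algebra_simps)
  qed
  have zero: "(\<Sum>y\<in>UNIV. p y - q y) = 0" using assms(3,4) by (simp add: sum_subtractf)
  show "0 \<le> kl p q" unfolding kl_def using sum_mono[of UNIV "\<lambda>y. p y - q y", OF le] zero by simp
  assume "p \<noteq> q"
  then obtain y where y: "p y \<noteq> q y" by auto
  have "p y - q y \<noteq> p y * ln (p y / q y)"
  proof
    assume eq: "p y - q y = p y * ln (p y / q y)"
    have "p y * ln (q y / p y) = p y * (q y / p y - 1)"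
      using eq assms(1)[of y] assms(2)[of y] by (simp add: ln_divide_pos algebra_simps)
    then have "ln (q y / p y) = q y / p y - 1" using assms(1)[of y] by simp
    then have "q y / p y = 1" using assms(1,2) by (intro ln_eq_minus_one) auto
    then show False using y assms(1)[of y] by simp
  qed
  then have "(\<Sum>y\<in>UNIV. p y - q y) < (\<Sum>y\<in>UNIV. p y * ln (p y / q y))"
    using le by (intro sum_strict_mono_ex1) (auto simp: less_le)
  then show "0 < kl p q" using zero by (simp add: kl_def)
qed

lemma kl_self: "(\<And>y. 0 < p y) \<Longrightarrow> kl p p = 0"
  by (simp add: kl_def less_imp_neq[symmetric])

text \<open>If no letter is cheaper than \<open>B\<close>, a mean cost of at most \<open>B\<close>
  forces every letter of positive probability to cost exactly \<open>B\<close>. The distinction is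
  needed because codewords of approximate type could otherwise exceed a budget that \<open>P\<close>
  meets with equality.\<close>

lemma cheap_letter:
  fixes b :: "'x::finite \<Rightarrow> real"
  assumes P: "distribution P" and cost: "(\<Sum>x\<in>UNIV. P x * b x) \<le> B"
  obtains x0 where "b x0 < B" | x0 where "0 < P x0" "\<And>x. 0 < P x \<Longrightarrow> b x = B"
proof (cases "\<exists>x. b x < B")
  case False
  then have ge: "B \<le> b x" for x by (meson not_le)
  have P_nn: "0 \<le> P x" for x using P by (simp add: distribution_def)
  have "(\<Sum>x\<in>UNIV. P x * (b x - B)) = (\<Sum>x\<in>UNIV. P x * b x) - (\<Sum>x\<in>UNIV. P x) * B"
    by (simp add: right_diff_distrib sum_subtractf sum_distrib_right)
  then have "(\<Sum>x\<in>UNIV. P x * (b x - B)) \<le> 0" using P cost by (simp add: distribution_def)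
  moreover have nn: "0 \<le> P x * (b x - B)" for x using P_nn ge by simp
  ultimately have "(\<Sum>x\<in>UNIV. P x * (b x - B)) = 0" by (meson order_antisym sum_nonneg)
  then have "P x * (b x - B) = 0" for x using nn by (simp add: sum_nonneg_eq_0_iff)
  then have "b x = B" if "0 < P x" for x using that by (metis eq_iff_diff_eq_0 less_irrefl mult_eq_0_iff)
  moreover have "\<exists>x. 0 < P x"
  proof (rule ccontr)
    assume "\<not> ?thesis"
    then have "(\<Sum>x\<in>UNIV. P x) \<le> 0" by (intro sum_nonpos) (auto simp: not_less)
    then show False using P by (simp add: distribution_def)
  qed
  ultimately show thesis using that(2) by blast
qed (use that(1) in blast)

text \<open>Slack in the mean cost absorbs the deviation of the letter frequencies; without slack,
  all letters of the support cost exactly \<open>B\<close>, and codewords contain only such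
  letters.\<close>

lemma near_type_cost:
  fixes b :: "'x::finite \<Rightarrow> real"
  assumes "(\<Sum>x\<in>UNIV. P x * b x) < B \<or> (\<forall>x. 0 < P x \<longrightarrow> b x = B)"
  obtains \<delta> where "0 < \<delta>" "\<And>n xs. \<lbrakk>0 < n; xs \<in> near_type P n \<delta>\<rbrakk> \<Longrightarrow> (\<Sum>i<n. b (xs ! i)) / real n \<le> B"
  using assms
proof
  assume less: "(\<Sum>x\<in>UNIV. P x * b x) < B"
  let ?S = "(\<Sum>x\<in>UNIV. \<bar>b x\<bar>)" and ?E = "\<Sum>x\<in>UNIV. P x * b x"
  let ?\<delta> = "(B - ?E) / (?S + 1)"
  have S: "0 \<le> ?S" by (simp add: sum_nonneg)
  have \<delta>: "0 < ?\<delta>" using less S by (intro divide_pos_pos) linarith+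
  show thesis
  proof (rule that[OF \<delta>])
    fix n xs assume n: "0 < n" and xs: "xs \<in> near_type P n ?\<delta>"
    have "?\<delta> * ?S \<le> ?\<delta> * (?S + 1)" using \<delta> by (intro mult_left_mono) auto
    also have "\<dots> = B - ?E"
    proof -
      have "?S + 1 \<noteq> 0" using S by linarith
      then show ?thesis by simp
    qed
    finally have "real n * (?\<delta> * ?S) \<le> real n * (B - ?E)" by (intro mult_left_mono) auto
    then have "(\<Sum>i<n. b (xs ! i)) \<le> real n * B"
      using near_type_average[OF xs n, of b] unfolding right_diff_distrib[of "real n"] by linarith
    then show "(\<Sum>i<n. b (xs ! i)) / real n \<le> B" using n by (simp add: divide_le_eq mult.commute)
  qed
next
  assume eq: "\<forall>x. 0 < P x \<longrightarrow> b x = B"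
  show thesis
  proof (rule that[of 1])
    fix n xs assume n: "0 < n" and xs: "xs \<in> near_type P n 1"
    then have "(\<Sum>i<n. b (xs ! i)) = (\<Sum>i<n. B)" using eq by (intro sum.cong) (auto simp: near_type_def)
    then show "(\<Sum>i<n. b (xs ! i)) / real n \<le> B" using n by simp
  qed simp
qed

subsection \<open>Tilted channels and discrimination tests\<close>

context
  fixes W V :: "'x::finite \<Rightarrow> 'y::finite \<Rightarrow> real" and c :: real
  assumes W: "stochastic W" and V: "stochastic V"
    and c_pos: "0 < c" and W_ge: "\<And>x y. c \<le> W x y" and V_ge: "\<And>x y. c \<le> V x y"
begin

lemma W_pos: "0 < W x y" and V_pos: "0 < V x y"
  using W_ge[of x y] V_ge[of x y] c_pos by linarith+

text \<open>\<open>ln (normalizer s x)\<close> is the cumulant generating function, at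
  \<open>s\<close>, of the log-likelihood ratio \<open>ln (V x y / W x y)\<close> under
  \<open>W x\<close>.\<close>

definition normalizer :: "real \<Rightarrow> 'x \<Rightarrow> real" where
  "normalizer s x = (\<Sum>y\<in>UNIV. W x y powr (1 - s) * V x y powr s)"

lemma normalizer_pos: "0 < normalizer s x"
  unfolding normalizer_def
  by (intro sum_pos) (use W_pos V_pos in \<open>auto simp: less_le\<close>)

lemma tilted_eq: "tilted W V s x y = W x y powr (1 - s) * V x y powr s / normalizer s x"
  by (simp add: tilted_def normalizer_def)

lemma tilted_pos: "0 < tilted W V s x y"
  unfolding tilted_eq using W_pos[of x y] V_pos[of x y] normalizer_pos[of s x] by (simp add: less_le)

lemma tilted_sum: "(\<Sum>y\<in>UNIV. tilted W V s x y) = 1"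
  unfolding tilted_eq sum_divide_distrib[symmetric] normalizer_def[symmetric]
  using normalizer_pos[of s x] by simp

lemma stochastic_tilted: "stochastic (tilted W V s)"
  by (simp add: stochastic_def tilted_sum tilted_pos less_imp_le)

lemma tilted_0: "tilted W V 0 = W" and tilted_1: "tilted W V 1 = V"
  using W_pos V_pos
  by (auto simp: fun_eq_iff tilted_def stochastic_sum[OF W] stochastic_sum[OF V] less_imp_le abs_of_pos
      less_imp_neq[symmetric])

text \<open>A weighted geometric mean of numbers that are at least \<open>c\<close> is at least
  \<open>c\<close>, and the normalizer is a sum of terms at most 1. Uniformity in \<open>s\<close>
  is the point: one blocklength must serve all tilted channels in the connectedness
  argument.\<close>

lemma tilted_ge:
  assumes "s \<in> {0..1}"
  shows "c / real CARD('y) \<le> tilted W V s x y"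
proof -
  have num: "c \<le> W x y powr (1 - s) * V x y powr s"
  proof -
    have "c = c powr (1 - s) * c powr s" using c_pos by (simp flip: powr_add)
    also have "\<dots> \<le> W x y powr (1 - s) * V x y powr s"
      using assms c_pos W_ge V_ge by (intro mult_mono powr_mono2) auto
    finally show ?thesis .
  qed
  have le1: "W x y powr (1 - s) * V x y powr s \<le> 1" for y
    using assms W_pos V_pos stochastic_le_1[OF W] stochastic_le_1[OF V]
    by (intro mult_le_one powr_le1) (auto simp: less_imp_le)
  have "normalizer s x \<le> real CARD('y)"
    using sum_bounded_above[of UNIV "\<lambda>y. W x y powr (1 - s) * V x y powr s" 1] le1
    by (simp add: normalizer_def)
  then show ?thesis
    unfolding tilted_eq using num normalizer_pos[of s x] c_pos by (intro frac_le) auto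
qed

lemma continuous_tilted: "continuous_on UNIV (\<lambda>s. tilted W V s x y)"
  unfolding tilted_def
  by (intro continuous_intros) (use W_pos V_pos normalizer_pos[unfolded normalizer_def] in \<open>auto simp: less_imp_neq[symmetric]\<close>)

lemma continuous_kl_tilted:
  assumes "\<And>y. 0 < q y"
  shows "continuous_on UNIV (\<lambda>s. kl (tilted W V s x) q)"
  unfolding kl_def
  by (intro continuous_intros continuous_tilted)
     (use assms tilted_pos in \<open>auto simp: less_imp_neq[symmetric]\<close>)

lemma c_div_card_le: "c / real CARD('y) \<le> c"
  using c_pos by (simp add: divide_le_eq)

text \<open>The threshold \<open>(1 - \<tau>) / 2\<close> for a set to count as likely serves all
  \<open>s\<close> at once: it is at most 1/2, so \<open>A\<close> or its complement passes it for
  every \<open>s\<close>, and it is at most \<open>1 - \<tau>\<close>, which is all that is known at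
  the two ends.\<close>

lemma test_exponents_converse:
  assumes xs: "length xs = n" "0 < n" and A: "A \<subseteq> seqs n"
    and \<tau>: "(\<Sum>ys\<in>A. prodch W xs ys) \<le> \<tau>" "(\<Sum>ys\<in>seqs n - A. prodch V xs ys) \<le> \<tau>" "\<tau> < 1"
    and large: "0 < \<gamma>" "(ln (c / real CARD('y)))\<^sup>2 / (real n * \<gamma>\<^sup>2) \<le> (1 - \<tau>) / 4"
      "- ln ((1 - \<tau>) / 4) \<le> real n * \<gamma>"
  obtains s where "s \<in> {0..1}"
    "- ln (\<Sum>ys\<in>A. prodch W xs ys) / real n \<le> cond_div (tilted W V s) W (letter_freq xs) + 2 * \<gamma>"
    "- ln (\<Sum>ys\<in>seqs n - A. prodch V xs ys) / real n \<le> cond_div (tilted W V s) V (letter_freq xs) + 2 * \<gamma>"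
proof -
  let ?c = "c / real CARD('y)"
  let ?e0 = "\<Sum>ys\<in>A. prodch W xs ys" and ?e1 = "\<Sum>ys\<in>seqs n - A. prodch V xs ys"
  let ?D0 = "\<lambda>s. cond_div (tilted W V s) W (letter_freq xs)"
  let ?D1 = "\<lambda>s. cond_div (tilted W V s) V (letter_freq xs)"
  define S0 where "S0 = {s\<in>{0..1}. - ln ?e0 / real n \<le> ?D0 s + 2 * \<gamma>}"
  define S1 where "S1 = {s\<in>{0..1}. - ln ?e1 / real n \<le> ?D1 s + 2 * \<gamma>}"
  have cpos: "0 < ?c" using c_pos by simp
  have Wc: "?c \<le> W x y" and Vc: "?c \<le> V x y" for x y
    using c_div_card_le W_ge[of x y] V_ge[of x y] by linarith+
  have \<tau>0: "0 \<le> \<tau>"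
    using \<tau>(1) sum_nonneg[of A "prodch W xs"] prodch_nonneg[OF W] by (meson order_trans)
  have in_S0: "s \<in> S0" if "s \<in> {0..1}" "(1 - \<tau>) / 2 \<le> (\<Sum>ys\<in>A. prodch (tilted W V s) xs ys)" for s
  proof -
    have "- ln ?e0 / real n \<le> ?D0 s + 2 * \<gamma>"
      by (rule error_exponent_le_cond_div[OF stochastic_tilted tilted_ge W Wc cpos xs, where \<kappa> = "(1 - \<tau>) / 2"])
         (use that \<tau> large A in auto)
    then show ?thesis using that(1) by (simp add: S0_def)
  qed
  have in_S1: "s \<in> S1" if "s \<in> {0..1}" "(1 - \<tau>) / 2 \<le> (\<Sum>ys\<in>seqs n - A. prodch (tilted W V s) xs ys)" for s
  proof -
    have "- ln ?e1 / real n \<le> ?D1 s + 2 * \<gamma>"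
      by (rule error_exponent_le_cond_div[OF stochastic_tilted tilted_ge V Vc cpos xs, where \<kappa> = "(1 - \<tau>) / 2"])
         (use that \<tau> large A in auto)
    then show ?thesis using that(1) by (simp add: S1_def)
  qed
  have cover: "{0..1} \<subseteq> S0 \<union> S1"
  proof
    fix s :: real assume s: "s \<in> {0..1}"
    have "(\<Sum>ys\<in>seqs n - A. prodch (tilted W V s) xs ys) = 1 - (\<Sum>ys\<in>A. prodch (tilted W V s) xs ys)"
      by (rule sum_prodch_Diff[OF stochastic_tilted xs(1) A])
    then have "1 / 2 \<le> (\<Sum>ys\<in>A. prodch (tilted W V s) xs ys)
        \<or> 1 / 2 \<le> (\<Sum>ys\<in>seqs n - A. prodch (tilted W V s) xs ys)"
      by auto
    moreover have "(1 - \<tau>) / 2 \<le> 1 / 2" using \<tau>0 by simp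
    ultimately have "(1 - \<tau>) / 2 \<le> (\<Sum>ys\<in>A. prodch (tilted W V s) xs ys)
        \<or> (1 - \<tau>) / 2 \<le> (\<Sum>ys\<in>seqs n - A. prodch (tilted W V s) xs ys)"
      by (meson order_trans)
    then show "s \<in> S0 \<union> S1" using in_S0 in_S1 s by blast
  qed
  \<comment> \<open>At \<open>s = 1\<close> the tilted channel is \<open>V\<close>, under which
    \<open>A\<close> has probability at least \<open>1 - \<tau>\<close>; at \<open>s = 0\<close> it
    is \<open>W\<close>, under which the complement has.\<close>
  have "1 \<in> S0"
    by (rule in_S0) (use \<tau> sum_prodch_Diff[OF V xs(1) A] in \<open>auto simp: tilted_1\<close>)
  moreover have "0 \<in> S1"
    by (rule in_S1) (use \<tau> sum_prodch_Diff[OF W xs(1) A] in \<open>auto simp: tilted_0\<close>)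
  moreover have "closed S0" "closed S1"
    unfolding S0_def S1_def cond_div_eq_kl
    by (intro continuous_on_closed_Collect_le;
        intro continuous_intros continuous_on_subset[OF continuous_kl_tilted] W_pos V_pos; simp)+
  moreover have "S0 \<inter> {0..1} \<noteq> {}" "S1 \<inter> {0..1} \<noteq> {}"
    using calculation(1,2) by (simp_all add: disjoint_iff) (meson atLeastAtMost_iff order_refl zero_le_one)+
  ultimately have "S0 \<inter> S1 \<inter> {0..1} \<noteq> {}"
    using connected_closedD[OF connected_Icc[of 0 "1::real"], of S0 S1] cover by blast
  then show thesis using that unfolding S0_def S1_def by blast
qed

section \<open>The likelihood ratio test\<close>

definition llr_mean :: "real \<Rightarrow> 'x \<Rightarrow> real" where
  "llr_mean s x = (\<Sum>y\<in>UNIV. tilted W V s x y * ln (V x y / W x y))"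

lemma ln_tilted: "ln (tilted W V s x y) = (1 - s) * ln (W x y) + s * ln (V x y) - ln (normalizer s x)"
  unfolding tilted_eq using W_pos[of x y] V_pos[of x y] normalizer_pos[of s x]
  by (simp add: ln_div ln_mult ln_powr)

text \<open>A Legendre transform: \<open>llr_mean s x\<close> is the derivative of
  \<open>ln (normalizer s x)\<close> in \<open>s\<close>, so the right-hand side is the large
  deviation rate of the log-likelihood ratio at its tilted mean.\<close>

lemma kl_tilted_W: "kl (tilted W V s x) (W x) = s * llr_mean s x - ln (normalizer s x)"
proof -
  have "tilted W V s x y * ln (tilted W V s x y / W x y)
      = s * (tilted W V s x y * ln (V x y / W x y)) - tilted W V s x y * ln (normalizer s x)" for y
    using W_pos[of x y] V_pos[of x y] tilted_pos[of s x y]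
    by (simp add: ln_div ln_tilted algebra_simps)
  then have "kl (tilted W V s x) (W x)
      = s * llr_mean s x - (\<Sum>y\<in>UNIV. tilted W V s x y) * ln (normalizer s x)"
    by (simp add: kl_def llr_mean_def sum_subtractf sum_distrib_left sum_distrib_right)
  then show ?thesis by (simp add: tilted_sum)
qed

lemma kl_tilted_V: "kl (tilted W V s x) (V x) = - (1 - s) * llr_mean s x - ln (normalizer s x)"
proof -
  have "tilted W V s x y * ln (tilted W V s x y / V x y)
      = - (1 - s) * (tilted W V s x y * ln (V x y / W x y)) - tilted W V s x y * ln (normalizer s x)" for y
    using W_pos[of x y] V_pos[of x y] tilted_pos[of s x y]
    by (simp add: ln_div ln_tilted algebra_simps)
  then have "kl (tilted W V s x) (V x)
      = - (1 - s) * llr_mean s x - (\<Sum>y\<in>UNIV. tilted W V s x y) * ln (normalizer s x)"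
    by (simp only: kl_def llr_mean_def sum_subtractf sum_distrib_left sum_distrib_right)
  then show ?thesis by (simp add: tilted_sum)
qed

lemma W_eq_tilted:
  "W x y = tilted W V s x y * exp (- s * ln (V x y / W x y) + ln (normalizer s x))"
proof -
  have "ln (W x y) = ln (tilted W V s x y) + (- s * ln (V x y / W x y) + ln (normalizer s x))"
    using W_pos[of x y] V_pos[of x y] by (simp add: ln_tilted ln_div algebra_simps)
  then have "exp (ln (W x y)) = exp (ln (tilted W V s x y)) * exp (- s * ln (V x y / W x y) + ln (normalizer s x))"
    by (simp only: exp_add)
  then show ?thesis using W_pos tilted_pos by simp
qed

lemma V_eq_tilted:
  "V x y = tilted W V s x y * exp ((1 - s) * ln (V x y / W x y) + ln (normalizer s x))"
proof -
  have "ln (V x y) = ln (tilted W V s x y) + ((1 - s) * ln (V x y / W x y) + ln (normalizer s x))"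
    using W_pos[of x y] V_pos[of x y] by (simp add: ln_tilted ln_div algebra_simps)
  then have "exp (ln (V x y)) = exp (ln (tilted W V s x y)) * exp ((1 - s) * ln (V x y / W x y) + ln (normalizer s x))"
    by (simp only: exp_add)
  then show ?thesis using V_pos tilted_pos by simp
qed

text \<open>Both \<open>W\<close> (with \<open>\<alpha> = - s\<close>) and \<open>V\<close> (with
  \<open>\<alpha> = 1 - s\<close>) are the tilted channel times the exponential of an affine
  function of the log-likelihood ratio. On the proper side of the threshold that factor is at most
  its value at the mean, and the tilted probability of \<open>A\<close> is at most 1.\<close>

lemma prodch_le_tilted:
  assumes U: "\<And>x y. U x y = tilted W V s x y * exp (\<alpha> * ln (V x y / W x y) + ln (normalizer s x))"
    and n: "length xs = n" "A \<subseteq> seqs n"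
    and le: "\<And>ys. ys \<in> A \<Longrightarrow> \<alpha> * (\<Sum>i<n. ln (V (xs ! i) (ys ! i) / W (xs ! i) (ys ! i)))
               \<le> \<alpha> * (\<Sum>i<n. llr_mean s (xs ! i))"
  shows "(\<Sum>ys\<in>A. prodch U xs ys) \<le> exp (\<Sum>i<n. \<alpha> * llr_mean s (xs ! i) + ln (normalizer s (xs ! i)))"
    (is "_ \<le> exp ?E")
proof -
  have "prodch U xs ys \<le> exp ?E * prodch (tilted W V s) xs ys" if "ys \<in> A" for ys
  proof -
    let ?l = "\<lambda>i. \<alpha> * ln (V (xs ! i) (ys ! i) / W (xs ! i) (ys ! i)) + ln (normalizer s (xs ! i))"
    have "prodch U xs ys = (\<Prod>i<n. tilted W V s (xs ! i) (ys ! i) * exp (?l i))"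
      unfolding prodch_def n(1) by (intro prod.cong refl U)
    also have "\<dots> = prodch (tilted W V s) xs ys * exp (\<Sum>i<n. ?l i)"
      by (simp add: prodch_def n(1) prod.distrib exp_sum)
    also have "\<dots> \<le> prodch (tilted W V s) xs ys * exp ?E"
      using le[OF that] by (intro mult_left_mono prodch_nonneg stochastic_tilted)
        (simp add: sum.distrib flip: sum_distrib_left)
    finally show ?thesis by (simp add: mult.commute)
  qed
  then have "(\<Sum>ys\<in>A. prodch U xs ys) \<le> (\<Sum>ys\<in>A. exp ?E * prodch (tilted W V s) xs ys)"
    by (rule sum_mono)
  also have "\<dots> \<le> (\<Sum>ys\<in>seqs n. exp ?E * prodch (tilted W V s) xs ys)"
    by (intro sum_mono2) (use n in \<open>auto intro!: mult_nonneg_nonneg prodch_nonneg stochastic_tilted\<close>)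
  also have "\<dots> = exp ?E"
    by (simp add: sum_prodch[OF stochastic_tilted n(1)] flip: sum_distrib_left)
  finally show ?thesis .
qed

lemma chernoff_test:
  assumes "s \<in> {0..1}" "length xs = n"
  obtains A where "A \<subseteq> seqs n"
    "(\<Sum>ys\<in>A. prodch W xs ys) \<le> exp (- (\<Sum>i<n. kl (tilted W V s (xs ! i)) (W (xs ! i))))"
    "(\<Sum>ys\<in>seqs n - A. prodch V xs ys) \<le> exp (- (\<Sum>i<n. kl (tilted W V s (xs ! i)) (V (xs ! i))))"
proof -
  let ?l = "\<lambda>ys. \<Sum>i<n. ln (V (xs ! i) (ys ! i) / W (xs ! i) (ys ! i))"
  let ?t = "\<Sum>i<n. llr_mean s (xs ! i)"
  \<comment> \<open>The threshold is the mean of the log-likelihood ratio under the tilted channel.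
    The signs of \<open>- s\<close> and \<open>1 - s\<close> are opposite, so \<open>A\<close> is
    the proper side for \<open>W\<close> and the complement for \<open>V\<close>.\<close>
  define A where "A = {ys \<in> seqs n. ?t \<le> ?l ys}"
  have "(\<Sum>ys\<in>A. prodch W xs ys)
      \<le> exp (\<Sum>i<n. - s * llr_mean s (xs ! i) + ln (normalizer s (xs ! i)))"
    by (rule prodch_le_tilted[OF W_eq_tilted assms(2)])
       (use assms(1) in \<open>auto simp: A_def intro!: mult_left_mono\<close>)
  moreover have "(\<Sum>ys\<in>seqs n - A. prodch V xs ys)
      \<le> exp (\<Sum>i<n. (1 - s) * llr_mean s (xs ! i) + ln (normalizer s (xs ! i)))"
    by (rule prodch_le_tilted[OF V_eq_tilted assms(2)])
       (use assms(1) in \<open>auto simp: A_def intro!: mult_left_mono\<close>)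
  ultimately show thesis
    by (intro that[of A]) (auto simp: A_def kl_tilted_W kl_tilted_V algebra_simps simp flip: sum_negf)
qed

section \<open>Tests with prescribed exponents\<close>

lemma letter_le:
  assumes "u \<noteq> v"
  shows "W x u \<le> 1 - c" "V x u \<le> 1 - c"
proof -
  have "W x u + W x v \<le> 1"
    using sum_mono2[of UNIV "{u, v}" "W x"] assms W by (simp add: stochastic_def)
  then show "W x u \<le> 1 - c" using W_ge[of x v] by linarith
  have "V x u + V x v \<le> 1"
    using sum_mono2[of UNIV "{u, v}" "V x"] assms V by (simp add: stochastic_def)
  then show "V x u \<le> 1 - c" using V_ge[of x v] by linarith
qed

text \<open>Looking at one letter only, both errors stay between \<open>c\<close> and
  \<open>1 - c\<close> at every blocklength. This provides the exponents (0, 0) and the short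
  blocklengths.\<close>

lemma first_letter_test:
  assumes "(u::'y) \<noteq> v" "length xs = n" "0 < n"
  defines "A \<equiv> {ys \<in> seqs n. ys ! 0 = u}"
  shows "c \<le> (\<Sum>ys\<in>A. prodch W xs ys)" "(\<Sum>ys\<in>A. prodch W xs ys) \<le> 1 - c"
    "c \<le> (\<Sum>ys\<in>seqs n - A. prodch V xs ys)" "(\<Sum>ys\<in>seqs n - A. prodch V xs ys) \<le> 1 - c"
proof -
  have A: "A = cylinder u (\<lambda>_. u) n 1" by (auto simp: A_def cylinder_def)
  have "A \<subseteq> seqs n" by (auto simp: A_def)
  have *: "(\<Sum>ys\<in>A. prodch U xs ys) = U (xs ! 0) u" if "stochastic U" for U :: "'x \<Rightarrow> 'y \<Rightarrow> real"
    unfolding prodch_eq_prod_weight[OF assms(2)] A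
    by (subst sum_cylinder) (use assms that in \<open>auto simp: stochastic_sum\<close>)
  show "c \<le> (\<Sum>ys\<in>A. prodch W xs ys)" "(\<Sum>ys\<in>A. prodch W xs ys) \<le> 1 - c"
    "c \<le> (\<Sum>ys\<in>seqs n - A. prodch V xs ys)" "(\<Sum>ys\<in>seqs n - A. prodch V xs ys) \<le> 1 - c"
    using W_ge V_ge letter_le[OF assms(1), of "xs ! 0"]
    unfolding sum_prodch_Diff[OF V assms(2) \<open>A \<subseteq> seqs n\<close>] *[OF V] *[OF W] by (auto simp: algebra_simps)
qed

text \<open>Adding \<open>S\<close> to the Chernoff set raises the \<open>W\<close>-error to the
  order \<open>exp (- n e0)\<close>, and removing \<open>S'\<close> raises the
  \<open>V\<close>-error to the order \<open>exp (- n e1)\<close>. The first letters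
  \<open>u\<close> and \<open>v\<close> make the two sets disjoint, so neither change undoes the
  other, and they bound the added errors by \<open>1 - c\<close>. The slack \<open>\<beta>\<close>
  makes the Chernoff errors at most \<open>exp (- n \<beta>)\<close>, so the totals stay away from 1
  for large \<open>n\<close>.\<close>

lemma test_with_exponents:
  assumes uv: "(u::'y) \<noteq> v" and xs: "length xs = n" "0 < n" and s: "s \<in> {0..1}"
    and e: "0 \<le> e0" "0 \<le> e1" "0 \<le> \<beta>"
    and D0: "real n * (e0 + \<beta>) \<le> (\<Sum>i<n. kl (tilted W V s (xs ! i)) (W (xs ! i)))"
    and D1: "real n * (e1 + \<beta>) \<le> (\<Sum>i<n. kl (tilted W V s (xs ! i)) (V (xs ! i)))"
  obtains A where "A \<subseteq> seqs n"
    "c * exp (- real n * e0) \<le> (\<Sum>ys\<in>A. prodch W xs ys)"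
    "(\<Sum>ys\<in>A. prodch W xs ys) \<le> (1 + 1 / c) * exp (- real n * e0)"
    "(\<Sum>ys\<in>A. prodch W xs ys) \<le> 1 - c + exp (- real n * \<beta>)"
    "c * exp (- real n * e1) \<le> (\<Sum>ys\<in>seqs n - A. prodch V xs ys)"
    "(\<Sum>ys\<in>seqs n - A. prodch V xs ys) \<le> (1 + 1 / c) * exp (- real n * e1)"
    "(\<Sum>ys\<in>seqs n - A. prodch V xs ys) \<le> 1 - c + exp (- real n * \<beta>)"
proof -
  have cyl: "\<exists>S. S \<subseteq> {ys \<in> seqs n. ys ! 0 = w} \<and> c * exp (- real n * e) \<le> (\<Sum>ys\<in>S. prodch U xs ys)
      \<and> (\<Sum>ys\<in>S. prodch U xs ys) \<le> exp (- real n * e) / c \<and> (\<Sum>ys\<in>S. prodch U xs ys) \<le> U (xs ! 0) w"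
    if U: "stochastic U" "\<And>x y. c \<le> U x y" and "0 \<le> e"
      and D: "real n * (e + \<beta>) \<le> (\<Sum>i<n. kl (tilted W V s (xs ! i)) (U (xs ! i)))"
    for U :: "'x \<Rightarrow> 'y \<Rightarrow> real" and w e
  proof -
    have U_pos: "0 < U x y" for x y using U(2)[of x y] c_pos by linarith
    have "0 \<le> real n * \<beta>" using e by simp
    then have "real n * e \<le> (\<Sum>i<n. kl (tilted W V s (xs ! i)) (U (xs ! i)))"
      using D unfolding distrib_left by linarith
    then obtain a where a: "(\<Prod>i<n. U (xs ! i) (a i)) \<le> exp (- (real n * e))"
      by (rule prod_min_letter_le[OF stochastic_tilted tilted_pos U_pos])
    show ?thesis
      unfolding prodch_eq_prod_weight[OF xs(1)]
      by (rule cylinder_of_weight[of n "\<lambda>i. U (xs ! i)" c "exp (- real n * e)" a w])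
         (use U c_pos xs a \<open>0 \<le> e\<close> in \<open>auto simp: stochastic_sum\<close>)
  qed
  obtain S where S: "S \<subseteq> {ys \<in> seqs n. ys ! 0 = u}" "c * exp (- real n * e0) \<le> (\<Sum>ys\<in>S. prodch W xs ys)"
      "(\<Sum>ys\<in>S. prodch W xs ys) \<le> exp (- real n * e0) / c" "(\<Sum>ys\<in>S. prodch W xs ys) \<le> W (xs ! 0) u"
    using cyl[OF W W_ge e(1) D0, of u] by blast
  obtain S' where S': "S' \<subseteq> {ys \<in> seqs n. ys ! 0 = v}" "c * exp (- real n * e1) \<le> (\<Sum>ys\<in>S'. prodch V xs ys)"
      "(\<Sum>ys\<in>S'. prodch V xs ys) \<le> exp (- real n * e1) / c" "(\<Sum>ys\<in>S'. prodch V xs ys) \<le> V (xs ! 0) v"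
    using cyl[OF V V_ge e(2) D1, of v] by blast
  obtain A0 where A0: "A0 \<subseteq> seqs n"
    "(\<Sum>ys\<in>A0. prodch W xs ys) \<le> exp (- (\<Sum>i<n. kl (tilted W V s (xs ! i)) (W (xs ! i))))"
    "(\<Sum>ys\<in>seqs n - A0. prodch V xs ys) \<le> exp (- (\<Sum>i<n. kl (tilted W V s (xs ! i)) (V (xs ! i))))"
    by (rule chernoff_test[OF s xs(1)])
  have disj: "S \<inter> S' = {}" using S(1) S'(1) uv by auto
  have fin: "finite S" "finite S'" "finite A0"
    using S(1) S'(1) A0(1) finite_seqs by (auto intro: finite_subset[of _ "seqs n"])
  have A0W: "(\<Sum>ys\<in>A0. prodch W xs ys) \<le> exp (- real n * e0) * exp (- real n * \<beta>)"
  proof -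
    have "exp (- (\<Sum>i<n. kl (tilted W V s (xs ! i)) (W (xs ! i)))) \<le> exp (- real n * e0 + - real n * \<beta>)"
      using D0 by (simp add: algebra_simps)
    then show ?thesis using A0(2) unfolding exp_add by linarith
  qed
  have A0V: "(\<Sum>ys\<in>seqs n - A0. prodch V xs ys) \<le> exp (- real n * e1) * exp (- real n * \<beta>)"
  proof -
    have "exp (- (\<Sum>i<n. kl (tilted W V s (xs ! i)) (V (xs ! i)))) \<le> exp (- real n * e1 + - real n * \<beta>)"
      using D1 by (simp add: algebra_simps)
    then show ?thesis using A0(3) unfolding exp_add by linarith
  qed
  have e_le: "exp (- real n * x) \<le> 1" if "0 \<le> x" for x using that by simp
  \<comment> \<open>\<open>S\<close> survives the removal of \<open>S'\<close> by disjointness, so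
    \<open>A\<close> contains \<open>S\<close> and its complement contains \<open>S'\<close>; these
    inclusions give the two lower bounds.\<close>
  define A where "A = (A0 \<union> S) - S'"
  have compl: "seqs n - A = (seqs n - A0 - S) \<union> S'" using S'(1) disj by (auto simp: A_def)
  have upW: "(\<Sum>ys\<in>A. prodch W xs ys) \<le> (\<Sum>ys\<in>A0. prodch W xs ys) + (\<Sum>ys\<in>S. prodch W xs ys)"
  proof -
    have "(\<Sum>ys\<in>A. prodch W xs ys) \<le> (\<Sum>ys\<in>A0 \<union> S. prodch W xs ys)"
      unfolding A_def by (intro sum_mono2) (use fin in \<open>auto intro: prodch_nonneg W\<close>)
    also have "\<dots> \<le> (\<Sum>ys\<in>A0. prodch W xs ys) + (\<Sum>ys\<in>S. prodch W xs ys)"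
      by (rule sum_Un_le) (use fin in \<open>auto intro: prodch_nonneg W\<close>)
    finally show ?thesis .
  qed
  have upV: "(\<Sum>ys\<in>seqs n - A. prodch V xs ys) \<le> (\<Sum>ys\<in>seqs n - A0. prodch V xs ys) + (\<Sum>ys\<in>S'. prodch V xs ys)"
  proof -
    have "(\<Sum>ys\<in>seqs n - A. prodch V xs ys) \<le> (\<Sum>ys\<in>(seqs n - A0) \<union> S'. prodch V xs ys)"
      unfolding compl by (intro sum_mono2) (use fin in \<open>auto intro: prodch_nonneg V\<close>)
    also have "\<dots> \<le> (\<Sum>ys\<in>seqs n - A0. prodch V xs ys) + (\<Sum>ys\<in>S'. prodch V xs ys)"
      by (rule sum_Un_le) (use fin in \<open>auto intro: prodch_nonneg V\<close>)
    finally show ?thesis .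
  qed
  have b1: "exp (- real n * x) * exp (- real n * \<beta>) \<le> exp (- real n * x)" for x
    using e_le[OF e(3)] by (simp add: mult_left_le)
  have b2: "exp (- real n * x) * exp (- real n * \<beta>) \<le> exp (- real n * \<beta>)" if "0 \<le> x" for x
    using e_le[OF that] by (simp add: mult_left_le_one_le)
  show thesis
  proof (rule that)
    show "A \<subseteq> seqs n" using A0 S(1) by (auto simp: A_def)
    have "(\<Sum>ys\<in>S. prodch W xs ys) \<le> (\<Sum>ys\<in>A. prodch W xs ys)"
      unfolding A_def by (intro sum_mono2) (use fin disj in \<open>auto intro: prodch_nonneg W\<close>)
    then show "c * exp (- real n * e0) \<le> (\<Sum>ys\<in>A. prodch W xs ys)" using S(2) by linarith
    show "(\<Sum>ys\<in>A. prodch W xs ys) \<le> (1 + 1 / c) * exp (- real n * e0)"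
      using upW A0W b1[of e0] S(3) unfolding distrib_right times_divide_eq_left mult_1_left by linarith
    show "(\<Sum>ys\<in>A. prodch W xs ys) \<le> 1 - c + exp (- real n * \<beta>)"
      using upW A0W b2[OF e(1)] S(4) letter_le(1)[OF uv, of "xs ! 0"] by linarith
    have "(\<Sum>ys\<in>S'. prodch V xs ys) \<le> (\<Sum>ys\<in>seqs n - A. prodch V xs ys)"
      unfolding compl by (intro sum_mono2) (use fin in \<open>auto intro: prodch_nonneg V\<close>)
    then show "c * exp (- real n * e1) \<le> (\<Sum>ys\<in>seqs n - A. prodch V xs ys)" using S'(2) by linarith
    show "(\<Sum>ys\<in>seqs n - A. prodch V xs ys) \<le> (1 + 1 / c) * exp (- real n * e1)"
      using upV A0V b1[of e1] S'(3) unfolding distrib_right times_divide_eq_left mult_1_left by linarith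
    show "(\<Sum>ys\<in>seqs n - A. prodch V xs ys) \<le> 1 - c + exp (- real n * \<beta>)"
      using upV A0V b2[OF e(2)] S'(4) letter_le(2)[OF uv[symmetric], of "xs ! 0"] by linarith
  qed
qed

text \<open>Two-sided bounds up to constants turn the exponents into limits, and
  \<open>1 - c / 2\<close> will be the constant \<tau>.\<close>

definition exponent_test :: "nat \<Rightarrow> 'x list \<Rightarrow> real \<Rightarrow> real \<Rightarrow> 'y list set \<Rightarrow> bool" where
  "exponent_test n xs e0 e1 A \<longleftrightarrow> A \<subseteq> seqs n \<and>
     c * exp (- real n * e0) \<le> (\<Sum>ys\<in>A. prodch W xs ys) \<and>
     (\<Sum>ys\<in>A. prodch W xs ys) \<le> (1 + 1 / c) * exp (- real n * e0) \<and>
     (\<Sum>ys\<in>A. prodch W xs ys) \<le> 1 - c / 2 \<and>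
     c * exp (- real n * e1) \<le> (\<Sum>ys\<in>seqs n - A. prodch V xs ys) \<and>
     (\<Sum>ys\<in>seqs n - A. prodch V xs ys) \<le> (1 + 1 / c) * exp (- real n * e1) \<and>
     (\<Sum>ys\<in>seqs n - A. prodch V xs ys) \<le> 1 - c / 2"

lemma tests_exist:
  assumes uv: "(u::'y) \<noteq> v" and adm: "admissible_exponents W V P e0 e1"
  obtains \<delta> N where "0 < \<delta>"
    "\<And>n xs. \<lbrakk>N \<le> n; 0 < n; xs \<in> near_type P n \<delta>\<rbrakk> \<Longrightarrow> Ex (exponent_test n xs e0 e1)"
proof (cases "e0 = 0 \<and> e1 = 0")
  case True
  show thesis
  proof (rule that[of 1 0])
    fix n xs assume n: "0 < n" "xs \<in> near_type P n 1"
    have "0 < 1 / c" using c_pos by simp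
    then have "1 - c \<le> 1 - c / 2" "1 - c \<le> 1 + 1 / c" using c_pos by linarith+
    then show "Ex (exponent_test n xs e0 e1)"
      using first_letter_test[OF uv near_type_length[OF n(2)] n(1)] True
      by (intro exI[of _ "{ys \<in> seqs n. ys ! 0 = u}"]) (auto simp: exponent_test_def)
  qed simp
next
  case False
  then obtain s where s: "s \<in> {0..1}" "e0 < cond_div (tilted W V s) W P" "e1 < cond_div (tilted W V s) V P"
    and e: "0 \<le> e0" "0 \<le> e1"
    using adm by (auto simp: admissible_exponents_def)
  define d0 where "d0 x = kl (tilted W V s x) (W x)" for x
  define d1 where "d1 x = kl (tilted W V s x) (V x)" for x
  \<comment> \<open>Each gap between divergence and exponent is at least \<open>2 * \<beta>\<close>:
    one \<open>\<beta>\<close> pays for the letter frequencies deviating from \<open>P\<close>, the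
    other is the slack of the Chernoff errors.\<close>
  define \<beta> where "\<beta> = min (cond_div (tilted W V s) W P - e0) (cond_div (tilted W V s) V P - e1) / 2"
  have \<beta>: "0 < \<beta>" "e0 + \<beta> \<le> cond_div (tilted W V s) W P - \<beta>" "e1 + \<beta> \<le> cond_div (tilted W V s) V P - \<beta>"
    using s by (auto simp: \<beta>_def min_def)
  define \<Phi> where "\<Phi> = (\<Sum>x\<in>UNIV. \<bar>d0 x\<bar>) + (\<Sum>x\<in>UNIV. \<bar>d1 x\<bar>) + 1"
  have S_nn: "0 \<le> (\<Sum>x\<in>UNIV. \<bar>d0 x\<bar>)" "0 \<le> (\<Sum>x\<in>UNIV. \<bar>d1 x\<bar>)" by (auto intro: sum_nonneg)
  have \<Phi>: "(\<Sum>x\<in>UNIV. \<bar>d0 x\<bar>) \<le> \<Phi>" "(\<Sum>x\<in>UNIV. \<bar>d1 x\<bar>) \<le> \<Phi>" "0 < \<Phi>"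
    using S_nn unfolding \<Phi>_def by linarith+
  \<comment> \<open>From \<open>N\<close> on, \<open>exp (- n \<beta>) \<le> c / 2\<close>, which
    turns the bound \<open>1 - c + exp (- n \<beta>)\<close> into \<open>1 - c / 2\<close>.\<close>
  define N where "N = nat \<lceil>ln (2 / c) / \<beta>\<rceil>"
  show thesis
  proof (rule that[of "\<beta> / \<Phi>" N])
    show "0 < \<beta> / \<Phi>" using \<beta> \<Phi> by simp
    fix n xs assume n: "N \<le> n" "0 < n" and xs: "xs \<in> near_type P n (\<beta> / \<Phi>)"
    have "ln (2 / c) / \<beta> \<le> real n" using n(1) by (simp add: N_def ceiling_le_iff nat_le_iff)
    then have "- (real n * \<beta>) \<le> - ln (2 / c)" using \<beta>(1) by (simp add: divide_le_eq)
    then have "exp (- (real n * \<beta>)) \<le> exp (- ln (2 / c))" by simp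
    also have "\<dots> = c / 2" using c_pos by (simp add: exp_minus)
    finally have small: "exp (- real n * \<beta>) \<le> c / 2" by simp
    have bound: "real n * (e + \<beta>) \<le> (\<Sum>i<n. d (xs ! i))"
      if "e + \<beta> \<le> (\<Sum>x\<in>UNIV. P x * d x) - \<beta>" "(\<Sum>x\<in>UNIV. \<bar>d x\<bar>) \<le> \<Phi>" for e and d :: "'x \<Rightarrow> real"
    proof -
      have "\<beta> / \<Phi> * (\<Sum>x\<in>UNIV. \<bar>d x\<bar>) \<le> \<beta> / \<Phi> * \<Phi>" using that(2) \<beta>(1) \<Phi>(3) by (intro mult_left_mono) auto
      then have "real n * (\<beta> / \<Phi> * (\<Sum>x\<in>UNIV. \<bar>d x\<bar>)) \<le> real n * \<beta>"
        using \<Phi>(3) by (intro mult_left_mono) auto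
      moreover have "real n * (e + \<beta>) \<le> real n * ((\<Sum>x\<in>UNIV. P x * d x) - \<beta>)"
        using that(1) by (intro mult_left_mono) auto
      ultimately show ?thesis
        using near_type_average[OF xs n(2), of d] unfolding right_diff_distrib by linarith
    qed
    obtain A where "A \<subseteq> seqs n"
      "c * exp (- real n * e0) \<le> (\<Sum>ys\<in>A. prodch W xs ys)"
      "(\<Sum>ys\<in>A. prodch W xs ys) \<le> (1 + 1 / c) * exp (- real n * e0)"
      "(\<Sum>ys\<in>A. prodch W xs ys) \<le> 1 - c + exp (- real n * \<beta>)"
      "c * exp (- real n * e1) \<le> (\<Sum>ys\<in>seqs n - A. prodch V xs ys)"
      "(\<Sum>ys\<in>seqs n - A. prodch V xs ys) \<le> (1 + 1 / c) * exp (- real n * e1)"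
      "(\<Sum>ys\<in>seqs n - A. prodch V xs ys) \<le> 1 - c + exp (- real n * \<beta>)"
    proof (rule test_with_exponents[OF uv near_type_length[OF xs] n(2) s(1) e, of \<beta>])
      show "real n * (e0 + \<beta>) \<le> (\<Sum>i<n. kl (tilted W V s (xs ! i)) (W (xs ! i)))"
        using bound[of e0 d0] \<beta> \<Phi> by (simp add: cond_div_eq_kl d0_def)
      show "real n * (e1 + \<beta>) \<le> (\<Sum>i<n. kl (tilted W V s (xs ! i)) (V (xs ! i)))"
        using bound[of e1 d1] \<beta> \<Phi> by (simp add: cond_div_eq_kl d1_def)
    qed (use \<beta> in auto)
    then show "Ex (exponent_test n xs e0 e1)"
      using small by (intro exI[of _ A]) (auto simp: exponent_test_def)
  qed
qed

section \<open>Achievability of triples with admissible exponents\<close>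

lemma achievable_point:
  fixes Q :: "'x \<Rightarrow> 'z::finite \<Rightarrow> real" and b :: "'x \<Rightarrow> real"
  assumes Q: "stochastic Q" and P: "distribution P" and uv: "(u::'y) \<noteq> v"
    and cost: "0 < \<delta>0" "\<And>n xs. \<lbrakk>0 < n; xs \<in> near_type P n \<delta>0\<rbrakk> \<Longrightarrow> (\<Sum>i<n. b (xs ! i)) / real n \<le> B"
    and x0: "b x0 \<le> B" and R: "0 \<le> R" "R = 0 \<or> R < mutual_info P Q"
    and adm: "admissible_exponents W V P e0 e1"
  shows "(R, e0, e1) \<in> achievable Q W V b B"
proof -
  obtain \<delta>1 N1 where \<delta>1: "0 < \<delta>1" and tests: "\<And>n xs. \<lbrakk>N1 \<le> n; 0 < n; xs \<in> near_type P n \<delta>1\<rbrakk> \<Longrightarrow>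
       Ex (exponent_test n xs e0 e1)"
    using tests_exist[OF uv adm] by blast
  obtain \<delta>2 w where \<delta>2: "0 < \<delta>2" and codes:
    "\<And>\<delta> n. \<lbrakk>0 < \<delta>; \<delta> \<le> \<delta>2; 0 < n; 1 / 2 \<le> (\<Sum>xs\<in>near_type P n \<delta>. prod_weight (\<lambda>_. P) n xs)\<rbrakk> \<Longrightarrow>
      \<exists>f phi. (\<forall>m\<in>{1..nat \<lfloor>exp (real n * R)\<rfloor>}. f m \<in> near_type P n \<delta> \<and>
         (\<Sum>z\<in>{z\<in>seqs n. phi z \<noteq> m}. prodch Q (f m) z) \<le> w / real n) \<and>
         (\<forall>z. phi z \<in> {1..nat \<lfloor>exp (real n * R)\<rfloor>})"
    using code_exists_at_admissible_rate[OF Q P R] by blast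
  define \<delta> where "\<delta> = min \<delta>0 (min \<delta>1 \<delta>2)"
  have \<delta>: "0 < \<delta>" "\<delta> \<le> \<delta>0" "\<delta> \<le> \<delta>1" "\<delta> \<le> \<delta>2" using cost(1) \<delta>1 \<delta>2 by (auto simp: \<delta>_def)
  \<comment> \<open>The second bound makes the nearly \<open>P\<close>-typical inputs have
    probability at least 1/2, as the code construction demands.\<close>
  define N where "N = max N1 (nat \<lceil>2 * real CARD('x) / \<delta>\<^sup>2\<rceil>)"
  define L where "L n e = exp (- real n * e)" for n :: nat and e :: real
  define good where "good n M f phi psi \<longleftrightarrow>
     is_code b B n M f phi psi \<and>
     eps_code (eps0 W psi) M f \<le> 1 - c / 2 \<and> eps_code (eps1 V psi) M f \<le> 1 - c / 2 \<and>
     (N \<le> n \<longrightarrow> M = nat \<lfloor>exp (real n * R)\<rfloor> \<and> 0 \<le> max_dec_err Q n M f phi \<and> max_dec_err Q n M f phi \<le> w / real n \<and>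
       c * L n e0 \<le> eps_code (eps0 W psi) M f \<and> eps_code (eps0 W psi) M f \<le> (1 + 1 / c) * L n e0 \<and>
       c * L n e1 \<le> eps_code (eps1 V psi) M f \<and> eps_code (eps1 V psi) M f \<le> (1 + 1 / c) * L n e1)"
    for n M and f :: "nat \<Rightarrow> 'x list" and phi :: "'z list \<Rightarrow> nat" and psi :: "'y list \<Rightarrow> 'x list \<Rightarrow> bool"
  have "\<exists>M f phi psi. good n M f phi psi" if n: "1 \<le> n" for n
  proof (cases "N \<le> n")
    case False
    \<comment> \<open>Codes are required at every positive blocklength. Below \<open>N\<close> a
      single constant codeword with the first-letter test respects cost and error bounds; the limits
      ignore these blocklengths.\<close>
    let ?f = "\<lambda>_::nat. replicate n x0" and ?psi = "\<lambda>ys (xs::'x list). ys ! 0 = u"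
    have n0: "0 < n" and len: "length (replicate n x0) = n" using n by auto
    have "is_code b B n 1 ?f (\<lambda>_. 1) ?psi"
      using n x0 by (auto simp: is_code_def)
    moreover have "eps_code (eps0 W ?psi) 1 ?f \<le> 1 - c / 2" "eps_code (eps1 V ?psi) 1 ?f \<le> 1 - c / 2"
      using first_letter_test[OF uv len n0] c_pos
      by (auto simp: eps_code_def eps0_eq[OF len] eps1_eq[OF len])
    ultimately have "good n 1 ?f (\<lambda>_. 1) ?psi" using False by (auto simp: good_def)
    then show ?thesis by blast
  next
    case True
    let ?M = "nat \<lfloor>exp (real n * R)\<rfloor>" and ?T = "near_type P n \<delta>"
    have n0: "0 < n" using n by simp
    have "2 * real CARD('x) / \<delta>\<^sup>2 \<le> real n" using True by (simp add: N_def ceiling_le_iff nat_le_iff)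
    then have "real CARD('x) / (real n * \<delta>\<^sup>2) \<le> 1 / 2" using \<delta>(1) n by (simp add: field_simps)
    then have "1 / 2 \<le> (\<Sum>xs\<in>?T. prod_weight (\<lambda>_. P) n xs)"
      using near_type_prob[OF P n0 \<delta>(1)] by linarith
    then obtain f phi where f: "\<And>m. m \<in> {1..?M} \<Longrightarrow> f m \<in> ?T"
        "\<And>m. m \<in> {1..?M} \<Longrightarrow> (\<Sum>z\<in>{z\<in>seqs n. phi z \<noteq> m}. prodch Q (f m) z) \<le> w / real n"
      and phi: "\<And>z. phi z \<in> {1..?M}"
      using codes[OF \<delta>(1,4) n0] by blast
    have M1: "1 \<le> ?M" using phi[of undefined] by auto
    have len: "length (f m) = n" if "m \<in> {1..?M}" for m by (rule near_type_length[OF f(1)[OF that]])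
    have "N1 \<le> n" using True by (simp add: N_def)
    then have "\<forall>xs\<in>?T. Ex (exponent_test n xs e0 e1)"
      using tests[of n] n0 near_type_mono[OF \<delta>(3)] by blast
    \<comment> \<open>The test may depend on the codeword, so it is chosen separately for each
      sequence of the nearly fixed type.\<close>
    from bchoice[OF this] obtain A where A: "\<forall>xs\<in>?T. exponent_test n xs e0 e1 (A xs)" by blast
    let ?psi = "\<lambda>ys xs. ys \<in> A xs"
    have psi_set: "{ys \<in> seqs n. ys \<in> A xs} = A xs" if "xs \<in> ?T" for xs using A that by (auto simp: exponent_test_def)
    have e0: "eps0 W ?psi (f m) = (\<Sum>ys\<in>A (f m). prodch W (f m) ys)"
      and e1: "eps1 V ?psi (f m) = (\<Sum>ys\<in>seqs n - A (f m). prodch V (f m) ys)" if "m \<in> {1..?M}" for m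
      unfolding eps0_eq[OF len[OF that]] eps1_eq[OF len[OF that]] psi_set[OF f(1)[OF that]] by simp_all
    have A': "A (f m) \<subseteq> seqs n \<and>
       c * L n e0 \<le> eps0 W ?psi (f m) \<and> eps0 W ?psi (f m) \<le> (1 + 1 / c) * L n e0 \<and>
       eps0 W ?psi (f m) \<le> 1 - c / 2 \<and>
       c * L n e1 \<le> eps1 V ?psi (f m) \<and> eps1 V ?psi (f m) \<le> (1 + 1 / c) * L n e1 \<and>
       eps1 V ?psi (f m) \<le> 1 - c / 2" if "m \<in> {1..?M}" for m
      unfolding e0[OF that] e1[OF that] L_def using A f(1)[OF that] by (simp add: exponent_test_def)
    have err: "0 \<le> max_dec_err Q n ?M f phi \<and> max_dec_err Q n ?M f phi \<le> w / real n"
    proof -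
      let ?E = "(\<lambda>m. \<Sum>z\<in>{z\<in>seqs n. phi z \<noteq> m}. prodch Q (f m) z) ` {1..?M}"
      have ne: "?E \<noteq> {}" using M1 by simp
      have "Max ?E \<in> ?E" by (rule Max_in) (use ne in auto)
      moreover have "\<forall>x\<in>?E. 0 \<le> x \<and> x \<le> w / real n"
        using f(2) by (auto intro!: sum_nonneg prodch_nonneg Q)
      ultimately show ?thesis unfolding max_dec_err_def by blast
    qed
    have "(\<Sum>i<n. b (f m ! i)) / real n \<le> B" if "m \<in> {1..?M}" for m
      using cost(2)[OF n0] f(1)[OF that] near_type_mono[OF \<delta>(2)] by blast
    then have "is_code b B n ?M f phi ?psi"
      using M1 len phi by (auto simp: is_code_def)
    moreover have "eps_code (eps0 W ?psi) ?M f \<le> 1 - c / 2"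
      "c * L n e0 \<le> eps_code (eps0 W ?psi) ?M f" "eps_code (eps0 W ?psi) ?M f \<le> (1 + 1 / c) * L n e0"
      "eps_code (eps1 V ?psi) ?M f \<le> 1 - c / 2"
      "c * L n e1 \<le> eps_code (eps1 V ?psi) ?M f" "eps_code (eps1 V ?psi) ?M f \<le> (1 + 1 / c) * L n e1"
      using A' by (blast intro: eps_code_bounds[OF M1])+
    ultimately have "good n ?M f phi ?psi" using err by (simp add: good_def)
    then show ?thesis by blast
  qed
  then have "\<forall>n. \<exists>M f phi psi. 1 \<le> n \<longrightarrow> good n M f phi psi" by blast
  then obtain M f phi psi where all_good: "\<And>n. 1 \<le> n \<Longrightarrow> good n (M n) (f n) (phi n) (psi n)"
    by metis
  have ev: "\<forall>\<^sub>F n in sequentially. 1 \<le> n \<and> N \<le> n"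
    using eventually_ge_at_top[of 1] eventually_ge_at_top[of N] by eventually_elim simp
  have large: "M n = nat \<lfloor>exp (real n * R)\<rfloor>"
      "0 \<le> max_dec_err Q n (M n) (f n) (phi n)" "max_dec_err Q n (M n) (f n) (phi n) \<le> w / real n"
      "c * L n e0 \<le> eps_code (eps0 W (psi n)) (M n) (f n) \<and> eps_code (eps0 W (psi n)) (M n) (f n) \<le> (1 + 1 / c) * L n e0"
      "c * L n e1 \<le> eps_code (eps1 V (psi n)) (M n) (f n) \<and> eps_code (eps1 V (psi n)) (M n) (f n) \<le> (1 + 1 / c) * L n e1"
    if "1 \<le> n \<and> N \<le> n" for n
    using all_good[of n] that unfolding good_def by blast+
  show ?thesis
    unfolding achievable_def mem_Collect_eq prod.case
  proof (intro exI conjI allI impI)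
    fix n :: nat assume "1 \<le> n"
    then show "is_code b B n (M n) (f n) (phi n) (psi n)"
      "max (eps_code (eps0 W (psi n)) (M n) (f n)) (eps_code (eps1 V (psi n)) (M n) (f n)) \<le> 1 - c / 2"
      using all_good[of n] by (auto simp: good_def)
  next
    show "1 - c / 2 < 1" using c_pos by simp
    show "(\<lambda>n. max_dec_err Q n (M n) (f n) (phi n)) \<longlonglongrightarrow> 0"
    proof (rule tendsto_sandwich)
      show "\<forall>\<^sub>F n in sequentially. 0 \<le> max_dec_err Q n (M n) (f n) (phi n)"
        "\<forall>\<^sub>F n in sequentially. max_dec_err Q n (M n) (f n) (phi n) \<le> w / real n"
        by (rule eventually_mono[OF ev], erule large)+
      show "(\<lambda>n. w / real n) \<longlonglongrightarrow> 0" by real_asymp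
    qed simp
    show "ereal R = liminf (\<lambda>n. ereal (ln (real (M n)) / real n))"
    proof (intro liminf_eq_of_tendsto ln_over_n_tendsto[of "1/2" 1])
      \<comment> \<open>Rounding down a number that is at least 1 loses at most a factor 2.\<close>
      show "\<forall>\<^sub>F n in sequentially. 1 / 2 * exp (real n * R) \<le> real (M n) \<and> real (M n) \<le> 1 * exp (real n * R)"
        using ev
      proof eventually_elim
        case (elim n)
        have M: "real (M n) = real_of_int \<lfloor>exp (real n * R)\<rfloor>"
          using large(1)[OF elim] by simp
        have "1 \<le> exp (real n * R)" using R by simp
        then have "1 \<le> real_of_int \<lfloor>exp (real n * R)\<rfloor>" by simp
        moreover have "exp (real n * R) < real_of_int \<lfloor>exp (real n * R)\<rfloor> + 1" by linarith
        ultimately show ?case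
          unfolding M using of_int_floor_le[of "exp (real n * R)"] by (intro conjI) linarith+
      qed
    qed auto
    have "(\<lambda>n. ln (eps_code (eps0 W (psi n)) (M n) (f n)) / real n) \<longlonglongrightarrow> - e0"
    proof (rule ln_over_n_tendsto[of c "1 + 1 / c"])
      show "0 < c" "0 < 1 + 1 / c" using c_pos by (auto intro: add_pos_pos)
    qed (rule eventually_mono[OF ev], use large in \<open>simp add: L_def\<close>)
    from liminf_eq_of_tendsto[OF tendsto_minus[OF this]]
    show "ereal e0 = liminf (\<lambda>n. ereal (- ln (eps_code (eps0 W (psi n)) (M n) (f n)) / real n))"
      by simp
    have "(\<lambda>n. ln (eps_code (eps1 V (psi n)) (M n) (f n)) / real n) \<longlonglongrightarrow> - e1"
    proof (rule ln_over_n_tendsto[of c "1 + 1 / c"])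
      show "0 < c" "0 < 1 + 1 / c" using c_pos by (auto intro: add_pos_pos)
    qed (rule eventually_mono[OF ev], use large in \<open>simp add: L_def\<close>)
    from liminf_eq_of_tendsto[OF tendsto_minus[OF this]]
    show "ereal e1 = liminf (\<lambda>n. ereal (- ln (eps_code (eps1 V (psi n)) (M n) (f n)) / real n))"
      by simp
  qed
qed

section \<open>Converse for sequences of codes\<close>

lemma sum_prodch_pos:
  fixes U :: "'x \<Rightarrow> 'y \<Rightarrow> real"
  assumes U: "stochastic U" "\<And>x y. c \<le> U x y" and xs: "length xs = n" and A: "A \<subseteq> seqs n" "A \<noteq> {}"
  shows "0 < (\<Sum>ys\<in>A. prodch U xs ys)"
proof (rule sum_pos)
  show "finite A" using A(1) finite_seqs by (rule finite_subset)
  fix ys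
  have "0 < U x y" for x y using U(2)[of x y] c_pos by linarith
  then show "0 < prodch U xs ys" by (auto simp: prodch_def intro!: prod_pos)
qed (rule A(2))

lemma achievable_nonneg:
  fixes Q :: "'x \<Rightarrow> 'z::finite \<Rightarrow> real"
  assumes "(R, E0, E1) \<in> achievable Q W V b B"
  shows "0 \<le> R" "0 \<le> E0" "0 \<le> E1"
proof -
  obtain M f phi psi \<tau> where
    code: "\<And>n. 1 \<le> n \<Longrightarrow> is_code b B n (M n) (f n) (phi n :: 'z list \<Rightarrow> nat) (psi n)" and \<tau>: "\<tau> < 1"
    and eps: "\<And>n. 1 \<le> n \<Longrightarrow> max (eps_code (eps0 W (psi n)) (M n) (f n)) (eps_code (eps1 V (psi n)) (M n) (f n)) \<le> \<tau>"
    and R: "ereal R = liminf (\<lambda>n. ereal (ln (real (M n)) / real n))"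
    and E0: "ereal E0 = liminf (\<lambda>n. ereal (- ln (eps_code (eps0 W (psi n)) (M n) (f n)) / real n))"
    and E1: "ereal E1 = liminf (\<lambda>n. ereal (- ln (eps_code (eps1 V (psi n)) (M n) (f n)) / real n))"
    using assms by (rule achievableE) blast
  have M1: "1 \<le> M n" if "1 \<le> n" for n using code[OF that] by (simp add: is_code_def)
  have nonneg: "0 \<le> - ln (eps_code e (M n) (f n)) / real n"
    if "1 \<le> n" "\<And>xs. 0 \<le> e xs" "eps_code e (M n) (f n) \<le> \<tau>" for e n
  proof -
    have "0 \<le> eps_code e (M n) (f n)"
      using eps_code_ge[of 1 "M n" e "f n"] M1[OF that(1)] that(2)[of "f n 1"] by auto
    \<comment> \<open>An error equal to 0 is harmless here because \<open>ln 0 = 0\<close>.\<close>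
    then have "ln (eps_code e (M n) (f n)) \<le> 0"
      using that(3) \<tau> by (cases "eps_code e (M n) (f n) = 0") auto
    then show ?thesis by (simp add: divide_nonpos_nonneg)
  qed
  have "ereal 0 \<le> ereal R" unfolding R
    by (rule Liminf_bounded, rule eventually_mono[OF eventually_ge_at_top[of 1]]) (use M1 in auto)
  then show "0 \<le> R" by simp
  have "ereal 0 \<le> ereal E0" unfolding E0
  proof (rule Liminf_bounded, rule eventually_mono[OF eventually_ge_at_top[of 1]])
    fix n :: nat assume n: "1 \<le> n"
    show "ereal 0 \<le> ereal (- ln (eps_code (eps0 W (psi n)) (M n) (f n)) / real n)"
      using nonneg[OF n, of "eps0 W (psi n)"] eps[OF n]
      by (auto simp: eps0_def intro!: sum_nonneg prodch_nonneg W)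
  qed
  then show "0 \<le> E0" by simp
  have "ereal 0 \<le> ereal E1" unfolding E1
  proof (rule Liminf_bounded, rule eventually_mono[OF eventually_ge_at_top[of 1]])
    fix n :: nat assume n: "1 \<le> n"
    show "ereal 0 \<le> ereal (- ln (eps_code (eps1 V (psi n)) (M n) (f n)) / real n)"
      using nonneg[OF n, of "eps1 V (psi n)"] eps[OF n]
      by (auto simp: eps1_def intro!: sum_nonneg prodch_nonneg V)
  qed
  then show "0 \<le> E1" by simp
qed

text \<open>Any codeword will do: its errors are at most the maximal ones, so its exponents are at
  least those of the code. The choice of \<open>m\<close> is left to the rate bound.\<close>

lemma code_exponents_le:
  assumes code: "is_code b B n M f phi psi" and n0: "0 < n" and \<gamma>: "0 < \<gamma>" and m: "m \<in> {1..M}"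
    and eps: "max (eps_code (eps0 W psi) M f) (eps_code (eps1 V psi) M f) \<le> \<tau>" and \<tau>: "\<tau> < 1"
    and n1: "(ln (c / real CARD('y)))\<^sup>2 / real n < \<gamma>\<^sup>2 * ((1 - \<tau>) / 4)"
    and n2: "- ln ((1 - \<tau>) / 4) / real n < \<gamma>"
  obtains s where "s \<in> {0..1}"
    "- ln (eps_code (eps0 W psi) M f) / real n \<le> cond_div (tilted W V s) W (letter_freq (f m)) + 2 * \<gamma>"
    "- ln (eps_code (eps1 V psi) M f) / real n \<le> cond_div (tilted W V s) V (letter_freq (f m)) + 2 * \<gamma>"
proof -
  let ?k = "(ln (c / real CARD('y)))\<^sup>2"
  have n0': "0 < real n" using n0 by simp
  define xs where "xs = f m"
  have xs: "length xs = n" using code m by (simp add: is_code_def xs_def)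
  define A where "A = {ys \<in> seqs n. psi ys xs}"
  have A: "A \<subseteq> seqs n" by (auto simp: A_def)
  have e0: "eps0 W psi xs = (\<Sum>ys\<in>A. prodch W xs ys)" unfolding A_def by (rule eps0_eq[OF xs])
  have e1: "eps1 V psi xs = (\<Sum>ys\<in>seqs n - A. prodch V xs ys)" unfolding A_def by (rule eps1_eq[OF xs])
  have le0: "(\<Sum>ys\<in>A. prodch W xs ys) \<le> eps_code (eps0 W psi) M f"
    using eps_code_ge[OF m, of "eps0 W psi" f] e0 by (simp add: xs_def)
  have le1: "(\<Sum>ys\<in>seqs n - A. prodch V xs ys) \<le> eps_code (eps1 V psi) M f"
    using eps_code_ge[OF m, of "eps1 V psi" f] e1 by (simp add: xs_def)
  have t0: "(\<Sum>ys\<in>A. prodch W xs ys) \<le> \<tau>" and t1: "(\<Sum>ys\<in>seqs n - A. prodch V xs ys) \<le> \<tau>"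
    using le0 le1 eps by linarith+
  \<comment> \<open>A test deciding always the same way has an error equal to 1. Excluding this
    makes both errors positive, without which \<open>ln 0 = 0\<close> would break the monotonicity
    of \<open>- ln\<close> used at the end.\<close>
  have "A \<noteq> {}" using t1 \<tau> sum_prodch[OF V xs] by auto
  then have pos0: "0 < (\<Sum>ys\<in>A. prodch W xs ys)" by (intro sum_prodch_pos[OF W W_ge xs A])
  have "seqs n - A \<noteq> {}"
  proof
    assume "seqs n - A = {}"
    then have "A = seqs n" using A by blast
    then show False using t0 \<tau> sum_prodch[OF W xs] by simp
  qed
  then have pos1: "0 < (\<Sum>ys\<in>seqs n - A. prodch V xs ys)" by (intro sum_prodch_pos[OF V V_ge xs]) auto
  obtain s where s: "s \<in> {0..1}"
    "- ln (\<Sum>ys\<in>A. prodch W xs ys) / real n \<le> cond_div (tilted W V s) W (letter_freq xs) + 2 * \<gamma>"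
    "- ln (\<Sum>ys\<in>seqs n - A. prodch V xs ys) / real n \<le> cond_div (tilted W V s) V (letter_freq xs) + 2 * \<gamma>"
  proof (rule test_exponents_converse[OF xs n0 A t0 t1 \<tau> \<gamma>])
    show "?k / (real n * \<gamma>\<^sup>2) \<le> (1 - \<tau>) / 4"
      using n1 n0 \<gamma> by (simp add: field_simps)
    show "- ln ((1 - \<tau>) / 4) \<le> real n * \<gamma>"
      using n2[unfolded pos_divide_less_eq[OF n0']] by (subst mult.commute) linarith
  qed blast
  have mono: "- ln y / real n \<le> - ln x / real n" if "0 < x" "x \<le> y" for x y
    using that n0 by (intro divide_right_mono) auto
  show thesis
    by (rule that[OF s(1)]) (use s(2,3) mono[OF pos0 le0] mono[OF pos1 le1] in \<open>simp_all add: xs_def\<close>)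
qed

text \<open>A liminf lies below all late terms up to one \<open>\<gamma>\<close>, so a single large
  blocklength meeting all requirements suffices; the bounds at that blocklength cost
  \<open>2 * \<gamma>\<close> more.\<close>

lemma achievable_converse:
  fixes Q :: "'x \<Rightarrow> 'z::finite \<Rightarrow> real"
  assumes Q: "stochastic Q" and ach: "(R, E0, E1) \<in> achievable Q W V b B" and \<gamma>: "0 < \<gamma>"
  obtains P s where "dominated_by Q W V b B P s (R - 3 * \<gamma>) (E0 - 3 * \<gamma>) (E1 - 3 * \<gamma>)"
proof -
  obtain M f phi psi \<tau> where
    code: "\<And>n. 1 \<le> n \<Longrightarrow> is_code b B n (M n) (f n) (phi n :: 'z list \<Rightarrow> nat) (psi n)" and \<tau>: "\<tau> < 1"
    and eps: "\<And>n. 1 \<le> n \<Longrightarrow> max (eps_code (eps0 W (psi n)) (M n) (f n)) (eps_code (eps1 V (psi n)) (M n) (f n)) \<le> \<tau>"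
    and err: "(\<lambda>n. max_dec_err Q n (M n) (f n) (phi n)) \<longlonglongrightarrow> 0"
    and R: "ereal R = liminf (\<lambda>n. ereal (ln (real (M n)) / real n))"
    and E0: "ereal E0 = liminf (\<lambda>n. ereal (- ln (eps_code (eps0 W (psi n)) (M n) (f n)) / real n))"
    and E1: "ereal E1 = liminf (\<lambda>n. ereal (- ln (eps_code (eps1 V (psi n)) (M n) (f n)) / real n))"
    using ach by (rule achievableE) blast
  obtain q where q: "0 < q" "q \<le> 1" "\<And>x z. 0 < Q x z \<Longrightarrow> q \<le> Q x z"
    using positive_entries_ge[of Q] by blast
  have lim_ev: "\<forall>\<^sub>F n in sequentially. X n < \<epsilon>" if "X \<longlonglongrightarrow> 0" "0 < \<epsilon>" for X :: "nat \<Rightarrow> real" and \<epsilon>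
    by (rule order_tendstoD(2)[OF that])
  have liminf_ev: "\<forall>\<^sub>F n in sequentially. E - \<gamma> < X n" if "ereal E = liminf (\<lambda>n. ereal (X n))" for X and E :: real
    using less_LiminfD[of "ereal (E - \<gamma>)" sequentially "\<lambda>n. ereal (X n)"] \<gamma>
    unfolding that[symmetric] by simp
  let ?k = "(ln (c / real CARD('y)))\<^sup>2"
  have l1: "(\<lambda>n. ?k / real n) \<longlonglongrightarrow> 0" by real_asymp
  have l2: "(\<lambda>n. - ln ((1 - \<tau>) / 4) / real n) \<longlonglongrightarrow> 0" by real_asymp
  have l3: "(\<lambda>n. (ln (real n) - ln q)\<^sup>2 / real n) \<longlonglongrightarrow> 0" by real_asymp
  have l4: "(\<lambda>n. (ln 4 + real CARD('x) * ln (real n + 1)) / real n) \<longlonglongrightarrow> 0" by real_asymp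
  have "\<forall>\<^sub>F n in sequentially. 1 \<le> n \<and> ?k / real n < \<gamma>\<^sup>2 * ((1 - \<tau>) / 4) \<and>
      - ln ((1 - \<tau>) / 4) / real n < \<gamma> \<and> (ln (real n) - ln q)\<^sup>2 / real n < \<gamma>\<^sup>2 / 4 \<and>
      (ln 4 + real CARD('x) * ln (real n + 1)) / real n < \<gamma> \<and>
      max_dec_err Q n (M n) (f n) (phi n) < 1 / 2 \<and> R - \<gamma> < ln (real (M n)) / real n \<and>
      E0 - \<gamma> < - ln (eps_code (eps0 W (psi n)) (M n) (f n)) / real n \<and>
      E1 - \<gamma> < - ln (eps_code (eps1 V (psi n)) (M n) (f n)) / real n"
    by (intro eventually_conj eventually_ge_at_top lim_ev l1 l2 l3 l4 err liminf_ev R E0 E1)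
       (use \<gamma> \<tau> in auto)
  then obtain n where n: "1 \<le> n" and n1: "?k / real n < \<gamma>\<^sup>2 * ((1 - \<tau>) / 4)"
    and n2: "- ln ((1 - \<tau>) / 4) / real n < \<gamma>" and n3: "(ln (real n) - ln q)\<^sup>2 / real n < \<gamma>\<^sup>2 / 4"
    and n4: "(ln 4 + real CARD('x) * ln (real n + 1)) / real n < \<gamma>"
    and nerr: "max_dec_err Q n (M n) (f n) (phi n) < 1 / 2" and nR: "R - \<gamma> < ln (real (M n)) / real n"
    and nE0: "E0 - \<gamma> < - ln (eps_code (eps0 W (psi n)) (M n) (f n)) / real n"
    and nE1: "E1 - \<gamma> < - ln (eps_code (eps1 V (psi n)) (M n) (f n)) / real n"
    using eventually_happens'[OF sequentially_bot] by blast
  have n0: "0 < n" "0 < real n" using n by auto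
  \<comment> \<open>The same \<open>m\<close> is used for the exponents below, so that all three
    bounds refer to one type.\<close>
  obtain m where m: "m \<in> {1..M n}" "ln (real (M n)) / real n \<le> mutual_info (letter_freq (f n m)) Q + 2 * \<gamma>"
    by (rule code_rate_le[OF Q q code[OF n] n0(1) \<gamma> nerr n3 n4])
  obtain s where s: "s \<in> {0..1}"
    "- ln (eps_code (eps0 W (psi n)) (M n) (f n)) / real n \<le> cond_div (tilted W V s) W (letter_freq (f n m)) + 2 * \<gamma>"
    "- ln (eps_code (eps1 V (psi n)) (M n) (f n)) / real n \<le> cond_div (tilted W V s) V (letter_freq (f n m)) + 2 * \<gamma>"
    by (rule code_exponents_le[OF code[OF n] n0(1) \<gamma> m(1) eps[OF n] \<tau> n1 n2])
  have len: "length (f n m) = n" and cost: "(\<Sum>i<n. b (f n m ! i)) / real n \<le> B"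
    using code[OF n] m(1) by (auto simp: is_code_def)
  have "(\<Sum>x\<in>UNIV. letter_freq (f n m) x * b x) \<le> B"
    using cost sum_over_letters[OF len n0(1), of b] n0 by simp
  moreover have "R - 3 * \<gamma> \<le> mutual_info (letter_freq (f n m)) Q" using nR m(2) by linarith
  moreover have "E0 - 3 * \<gamma> \<le> cond_div (tilted W V s) W (letter_freq (f n m))" using nE0 s(2) by linarith
  moreover have "E1 - 3 * \<gamma> \<le> cond_div (tilted W V s) V (letter_freq (f n m))" using nE1 s(3) by linarith
  ultimately show thesis
    using that distribution_letter_freq[OF len n0(1)] s(1) unfolding dominated_by_def by blast
qed

section \<open>Degenerate letters, limits and perturbations\<close>

lemma tilted_eq_self: "W x = V x \<Longrightarrow> tilted W V s x = W x"
proof -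
  assume "W x = V x"
  then have "W x y powr (1 - s) * V x y powr s = W x y" for y
    using W_pos[of x y] V_pos[of x y] by (simp flip: powr_add)
  then show "tilted W V s x = W x" by (simp add: tilted_def stochastic_sum[OF W] fun_eq_iff)
qed

text \<open>If the tilted law coincides with either end, the log-likelihood ratio is constant in
  \<open>y\<close>, so \<open>V x\<close> is a multiple of \<open>W x\<close>; as both sum to 1,
  they are equal.\<close>

lemma tilted_neq:
  assumes "W x \<noteq> V x" "0 < s" "s < 1"
  shows "tilted W V s x \<noteq> W x" "tilted W V s x \<noteq> V x"
proof -
  have const: False if "\<And>y. ln (V x y) = ln (W x y) + \<kappa>" for \<kappa>
  proof -
    have eq: "V x y = W x y * exp \<kappa>" for y
    proof -
      have "exp (ln (V x y)) = exp (ln (W x y)) * exp \<kappa>" unfolding that by (rule exp_add)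
      then show ?thesis using W_pos V_pos by simp
    qed
    have "1 = (\<Sum>y\<in>UNIV. W x y * exp \<kappa>)" using stochastic_sum[OF V, of x] eq by simp
    also have "\<dots> = exp \<kappa>" using stochastic_sum[OF W, of x] by (simp flip: sum_distrib_right)
    finally show False using eq assms(1) by (auto simp: fun_eq_iff)
  qed
  show "tilted W V s x \<noteq> W x"
  proof
    assume eq: "tilted W V s x = W x"
    have "ln (V x y) = ln (W x y) + ln (normalizer s x) / s" for y
      using ln_tilted[of s x y] assms unfolding eq by (simp add: field_simps)
    then show False by (rule const)
  qed
  show "tilted W V s x \<noteq> V x"
  proof
    assume eq: "tilted W V s x = V x"
    have "(1 - s) * (ln (V x y) - ln (W x y)) = - ln (normalizer s x)" for y
      using ln_tilted[of s x y] unfolding eq by (simp add: algebra_simps)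
    then have "ln (V x y) - ln (W x y) = - ln (normalizer s x) / (1 - s)" for y
      using assms by (subst eq_divide_eq) (simp add: mult.commute)
    then have "ln (V x y) = ln (W x y) + - ln (normalizer s x) / (1 - s)" for y
      by (simp add: algebra_simps)
    then show False by (rule const)
  qed
qed

lemma kl_tilted_nonneg: "0 \<le> kl (tilted W V s x) (W x)" "0 \<le> kl (tilted W V s x) (V x)"
  using tilted_pos W_pos V_pos tilted_sum stochastic_sum[OF W] stochastic_sum[OF V] by (auto intro!: kl_nonneg(1))

lemma cond_div_tilted_pos:
  assumes "distribution P" "0 < P x" "W x \<noteq> V x" "0 < s" "s < 1"
  shows "0 < cond_div (tilted W V s) W P" "0 < cond_div (tilted W V s) V P"
proof -
  have P: "0 \<le> P x" for x using assms(1) by (simp add: distribution_def)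
  have "0 < kl (tilted W V s x) (W x)"
    by (rule kl_nonneg(2)) (use tilted_pos W_pos tilted_sum stochastic_sum[OF W] tilted_neq assms in auto)
  then show "0 < cond_div (tilted W V s) W P"
    unfolding cond_div_eq_kl using assms(2) P kl_tilted_nonneg by (intro sum_pos2[of _ x]) auto
  have "0 < kl (tilted W V s x) (V x)"
    by (rule kl_nonneg(2)) (use tilted_pos V_pos tilted_sum stochastic_sum[OF V] tilted_neq assms in auto)
  then show "0 < cond_div (tilted W V s) V P"
    unfolding cond_div_eq_kl using assms(2) P kl_tilted_nonneg by (intro sum_pos2[of _ x]) auto
qed

lemma cond_div_tilted_tendsto:
  fixes P :: "nat \<Rightarrow> 'x \<Rightarrow> real"
  assumes P: "\<And>x. (\<lambda>k. P k x) \<longlonglongrightarrow> P' x" and s: "\<sigma> \<longlonglongrightarrow> s"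
  shows "(\<lambda>k. cond_div (tilted W V (\<sigma> k)) W (P k)) \<longlonglongrightarrow> cond_div (tilted W V s) W P'"
    "(\<lambda>k. cond_div (tilted W V (\<sigma> k)) V (P k)) \<longlonglongrightarrow> cond_div (tilted W V s) V P'"
proof -
  have kl: "(\<lambda>k. kl (tilted W V (\<sigma> k) x) q) \<longlonglongrightarrow> kl (tilted W V s x) q" if "\<And>y. 0 < q y" for x q
    by (rule continuous_on_tendsto_compose[OF continuous_kl_tilted[OF that] s]) auto
  show "(\<lambda>k. cond_div (tilted W V (\<sigma> k)) W (P k)) \<longlonglongrightarrow> cond_div (tilted W V s) W P'"
    "(\<lambda>k. cond_div (tilted W V (\<sigma> k)) V (P k)) \<longlonglongrightarrow> cond_div (tilted W V s) V P'"
    unfolding cond_div_eq_kl by (intro tendsto_sum tendsto_mult P kl W_pos V_pos)+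
qed

lemma dominated_by_limit:
  fixes Q :: "'x \<Rightarrow> 'z::finite \<Rightarrow> real"
  assumes Q: "stochastic Q"
    and approx: "\<And>\<gamma>. 0 < \<gamma> \<Longrightarrow> \<exists>P s. dominated_by Q W V b B P s (R - \<gamma>) (E0 - \<gamma>) (E1 - \<gamma>)"
  obtains P s where "dominated_by Q W V b B P s R E0 E1"
proof -
  define \<gamma> where "\<gamma> k = 1 / real (Suc k)" for k
  have "\<forall>k. \<exists>P s. dominated_by Q W V b B P s (R - \<gamma> k) (E0 - \<gamma> k) (E1 - \<gamma> k)"
    using approx by (simp add: \<gamma>_def)
  then obtain P s where Ps: "\<And>k. dominated_by Q W V b B (P k) (s k) (R - \<gamma> k) (E0 - \<gamma> k) (E1 - \<gamma> k)"
    by metis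
  \<comment> \<open>Encoding distributions as vectors places each pair in the product of a cube and
    an interval, whose compactness gives one subsequence for both components.\<close>
  define w :: "nat \<Rightarrow> (real ^ 'x) \<times> real" where "w k = (\<chi> x. P k x, s k)" for k
  let ?K = "cbox (0 :: real ^ 'x) 1 \<times> {0..1::real}"
  have P: "distribution (P k)" "s k \<in> {0..1}" for k using Ps[of k] by (auto simp: dominated_by_def)
  have P_le: "P k x \<le> 1" for k x
    using member_le_sum[of x UNIV "P k"] P(1)[of k] by (simp add: distribution_def)
  have "w k \<in> ?K" for k
    using P[of k] P_le[of k] by (auto simp: w_def mem_box_cart distribution_def)
  moreover have "seq_compact ?K"
    by (intro compact_imp_seq_compact compact_Times compact_cbox compact_Icc)
  ultimately obtain l r where l: "l \<in> ?K" and r: "strict_mono r" and lim: "(w \<circ> r) \<longlonglongrightarrow> l"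
    unfolding seq_compact_def by metis
  define P' where "P' x = fst l $ x" for x
  have limP: "(\<lambda>k. P (r k) x) \<longlonglongrightarrow> P' x" for x
    using tendsto_vec_nth[OF tendsto_fst[OF lim], of x] by (simp add: w_def P'_def)
  have limS: "(\<lambda>k. s (r k)) \<longlonglongrightarrow> snd l"
    using tendsto_snd[OF lim] by (simp add: w_def)
  have "(\<lambda>k. \<Sum>x\<in>UNIV. P (r k) x) \<longlonglongrightarrow> (\<Sum>x\<in>UNIV. P' x)" by (intro tendsto_sum limP)
  moreover have "(\<lambda>k. \<Sum>x\<in>UNIV. P (r k) x) = (\<lambda>k. 1)" using P(1) by (simp add: distribution_def)
  ultimately have "(\<Sum>x\<in>UNIV. P' x) = 1" using LIMSEQ_unique tendsto_const by metis
  then have P': "distribution P'"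
    using l by (auto simp: distribution_def P'_def mem_box_cart mem_Times_iff)
  have lim\<gamma>: "(\<lambda>k. e - \<gamma> (r k)) \<longlonglongrightarrow> e" for e :: real
  proof -
    have "(\<lambda>k. e - \<gamma> k) \<longlonglongrightarrow> e - 0" unfolding \<gamma>_def by (intro tendsto_intros LIMSEQ_Suc lim_1_over_n)
    from LIMSEQ_subseq_LIMSEQ[OF this r] show ?thesis by (simp add: o_def)
  qed
  have "dominated_by Q W V b B P' (snd l) R E0 E1"
    unfolding dominated_by_def
  proof (intro conjI)
    show "(\<Sum>x\<in>UNIV. P' x * b x) \<le> B"
      by (rule LIMSEQ_le_const2[of "\<lambda>k. \<Sum>x\<in>UNIV. P (r k) x * b x"])
         (use Ps in \<open>auto simp: dominated_by_def intro!: tendsto_intros limP\<close>)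
    show "R \<le> mutual_info P' Q"
      by (rule LIMSEQ_le[OF lim\<gamma> mutual_info_tendsto[OF Q P(1) P' limP]])
         (use Ps in \<open>auto simp: dominated_by_def\<close>)
    show "E0 \<le> cond_div (tilted W V (snd l)) W P'"
      by (rule LIMSEQ_le[OF lim\<gamma> cond_div_tilted_tendsto(1)[OF limP limS]])
         (use Ps in \<open>auto simp: dominated_by_def\<close>)
    show "E1 \<le> cond_div (tilted W V (snd l)) V P'"
      by (rule LIMSEQ_le[OF lim\<gamma> cond_div_tilted_tendsto(2)[OF limP limS]])
         (use Ps in \<open>auto simp: dominated_by_def\<close>)
  qed (use l P' in \<open>auto simp: mem_Times_iff\<close>)
  then show thesis by (rule that)
qed

text \<open>Continuity at \<open>P\<close> and \<open>s\<close> lets both be perturbed at a loss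
  below \<open>\<gamma>\<close> in every bound, and lowering the triple by \<open>\<gamma>\<close>,
  cut off at 0, makes the inequalities strict wherever this is possible.\<close>

lemma dominated_by_approx_achievable:
  fixes Q :: "'x \<Rightarrow> 'z::finite \<Rightarrow> real"
  assumes Q: "stochastic Q" and uv: "(u::'y) \<noteq> v" and dom: "dominated_by Q W V b B P s R E0 E1"
    and nn: "0 \<le> R" "0 \<le> E0" "0 \<le> E1" and \<gamma>: "0 < \<gamma>"
  obtains R' e0 e1 where "(R', e0, e1) \<in> achievable Q W V b B" "\<bar>R' - R\<bar> \<le> \<gamma>" "\<bar>e0 - E0\<bar> \<le> \<gamma>" "\<bar>e1 - E1\<bar> \<le> \<gamma>"
proof -
  have P: "distribution P" and cost: "(\<Sum>x\<in>UNIV. P x * b x) \<le> B" and s: "s \<in> {0..1}"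
    and R: "R \<le> mutual_info P Q" and E0: "E0 \<le> cond_div (tilted W V s) W P" and E1: "E1 \<le> cond_div (tilted W V s) V P"
    using dom by (auto simp: dominated_by_def)
  have P_nn: "0 \<le> P x" and P_sum: "(\<Sum>x\<in>UNIV. P x) = 1" for x using P by (auto simp: distribution_def)
  obtain x0 where x0: "b x0 < B \<or> 0 < P x0 \<and> (\<forall>x. 0 < P x \<longrightarrow> b x = B)"
    using cheap_letter[OF P cost] by metis
  then have bx0: "b x0 \<le> B" by auto
  \<comment> \<open>The offset 2 keeps \<open>\<mu> k\<close> strictly between 0 and 1, so that
    letters in the support of \<open>P\<close> keep positive weight in the mixture.\<close>
  define \<mu> where "\<mu> k = 1 / (real k + 2)" for k :: nat
  have \<mu>: "0 < \<mu> k" "\<mu> k < 1" for k by (auto simp: \<mu>_def)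
  have lim: "\<mu> \<longlonglongrightarrow> 0" unfolding \<mu>_def by real_asymp
  \<comment> \<open>Mixing in a cheap letter makes the cost constraint slack (or keeps all letters at cost \<open>B\<close>);
    moving \<open>s\<close> into the open interval makes both divergences positive.\<close>
  define P' where "P' k x = (1 - \<mu> k) * P x + \<mu> k * (if x = x0 then 1 else 0)" for k x
  define \<sigma> where "\<sigma> k = s + \<mu> k * (1 / 2 - s)" for k
  have limP: "(\<lambda>k. P' k x) \<longlonglongrightarrow> P x" for x
  proof -
    have "(\<lambda>k. P' k x) \<longlonglongrightarrow> (1 - 0) * P x + 0 * (if x = x0 then 1 else 0)"
      unfolding P'_def by (intro tendsto_intros lim)
    then show ?thesis by simp
  qed
  have limS: "\<sigma> \<longlonglongrightarrow> s"
  proof -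
    have "(\<lambda>k. s + \<mu> k * (1 / 2 - s)) \<longlonglongrightarrow> s + 0 * (1 / 2 - s)" by (intro tendsto_intros lim)
    then show ?thesis by (simp add: \<sigma>_def[abs_def])
  qed
  have \<sigma>: "0 < \<sigma> k" "\<sigma> k < 1" for k
  proof -
    have eq: "\<sigma> k = (1 - \<mu> k) * s + \<mu> k / 2" by (simp add: \<sigma>_def algebra_simps)
    have "0 \<le> (1 - \<mu> k) * s" "(1 - \<mu> k) * s \<le> 1 - \<mu> k"
      using \<mu>[of k] s by (auto intro!: mult_left_le)
    then show "0 < \<sigma> k" "\<sigma> k < 1" unfolding eq using \<mu>[of k] by linarith+
  qed
  have avg: "(\<Sum>x\<in>UNIV. P' k x * g x) = (1 - \<mu> k) * (\<Sum>x\<in>UNIV. P x * g x) + \<mu> k * g x0" for k and g :: "'x \<Rightarrow> real"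
  proof -
    have "P' k x * g x = (1 - \<mu> k) * (P x * g x) + (if x = x0 then \<mu> k * g x else 0)" for x
      by (simp add: P'_def algebra_simps)
    then show ?thesis by (simp add: sum.distrib sum_distrib_left)
  qed
  have P': "distribution (P' k)" for k
    using avg[of k "\<lambda>_. 1"] P_nn P_sum \<mu>[of k] by (auto simp: distribution_def P'_def)
  have "\<forall>\<^sub>F k in sequentially. mutual_info P Q - \<gamma> < mutual_info (P' k) Q \<and>
      cond_div (tilted W V s) W P - \<gamma> < cond_div (tilted W V (\<sigma> k)) W (P' k) \<and>
      cond_div (tilted W V s) V P - \<gamma> < cond_div (tilted W V (\<sigma> k)) V (P' k)"
    using \<gamma>
    by (intro eventually_conj order_tendstoD(1)[OF mutual_info_tendsto[OF Q P' P limP]]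
        order_tendstoD(1)[OF cond_div_tilted_tendsto(1)[OF limP limS]]
        order_tendstoD(1)[OF cond_div_tilted_tendsto(2)[OF limP limS]]) auto
  then obtain k where k: "mutual_info P Q - \<gamma> < mutual_info (P' k) Q"
      "cond_div (tilted W V s) W P - \<gamma> < cond_div (tilted W V (\<sigma> k)) W (P' k)"
      "cond_div (tilted W V s) V P - \<gamma> < cond_div (tilted W V (\<sigma> k)) V (P' k)"
    using eventually_happens'[OF sequentially_bot] by blast
  have "(\<Sum>x\<in>UNIV. P' k x * b x) < B \<or> (\<forall>x. 0 < P' k x \<longrightarrow> b x = B)"
    using x0
  proof
    assume "b x0 < B"
    then have "\<mu> k * b x0 < \<mu> k * B" using \<mu>[of k] by simp
    moreover have "(1 - \<mu> k) * (\<Sum>x\<in>UNIV. P x * b x) \<le> (1 - \<mu> k) * B"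
      using cost \<mu>[of k] by (intro mult_left_mono) auto
    ultimately show ?thesis unfolding avg by (simp add: algebra_simps)
  next
    assume x0: "0 < P x0 \<and> (\<forall>x. 0 < P x \<longrightarrow> b x = B)"
    have "0 < P x" if "0 < P' k x" for x
    proof (rule ccontr)
      assume "\<not> 0 < P x"
      then have "P x = 0" "x \<noteq> x0" using P_nn[of x] x0 by auto
      then show False using that by (simp add: P'_def)
    qed
    then show ?thesis using x0 by blast
  qed
  then obtain \<delta> where \<delta>: "0 < \<delta>"
    "\<And>n xs. \<lbrakk>0 < n; xs \<in> near_type (P' k) n \<delta>\<rbrakk> \<Longrightarrow> (\<Sum>i<n. b (xs ! i)) / real n \<le> B"
    using near_type_cost[of "P' k" b B] by blast
  \<comment> \<open>Cutting off at 0 keeps the rate non-negative, and rate 0 is allowed without a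
    strict inequality.\<close>
  define R' where "R' = max 0 (R - \<gamma>)"
  have R': "0 \<le> R'" "R' = 0 \<or> R' < mutual_info (P' k) Q" "\<bar>R' - R\<bar> \<le> \<gamma>"
    using k(1) R nn(1) \<gamma> by (auto simp: R'_def max_def)
  have "\<exists>e0 e1. admissible_exponents W V (P' k) e0 e1 \<and> \<bar>e0 - E0\<bar> \<le> \<gamma> \<and> \<bar>e1 - E1\<bar> \<le> \<gamma>"
  proof (cases "E0 = 0 \<and> E1 = 0")
    case True
    then show ?thesis using \<gamma> by (intro exI[of _ 0]) (simp add: admissible_exponents_def)
  next
    case False
    \<comment> \<open>If \<open>W\<close> and \<open>V\<close> agreed on the support of
      \<open>P\<close>, tilting would change nothing there, both divergences would be 0, and so
      would \<open>E0\<close> and \<open>E1\<close>.\<close>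
    have "\<exists>x. 0 < P x \<and> W x \<noteq> V x"
    proof (rule ccontr)
      assume contra: "\<not> ?thesis"
      have "P x * kl (tilted W V s x) (W x) = 0" "P x * kl (tilted W V s x) (V x) = 0" for x
      proof -
        have "P x = 0 \<or> W x = V x" using contra P_nn[of x] by (metis less_eq_real_def)
        then show "P x * kl (tilted W V s x) (W x) = 0" "P x * kl (tilted W V s x) (V x) = 0"
          using tilted_eq_self[of x s] kl_self[of "W x"] W_pos[of x] by auto
      qed
      then have "cond_div (tilted W V s) W P = 0" "cond_div (tilted W V s) V P = 0"
        by (simp_all only: cond_div_eq_kl sum.neutral_const)
      then show False using E0 E1 nn False by simp
    qed
    then obtain x where x: "0 < P x" "W x \<noteq> V x" by blast
    have "0 < (1 - \<mu> k) * P x" using x(1) \<mu>[of k] by simp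
    moreover have "0 \<le> \<mu> k * (if x = x0 then 1 else 0)" using \<mu>[of k] by simp
    ultimately have "0 < P' k x" unfolding P'_def by linarith
    note pos = cond_div_tilted_pos[OF P' this x(2) \<sigma>[of k]]
    have "max 0 (E0 - \<gamma>) < cond_div (tilted W V (\<sigma> k)) W (P' k)"
      "max 0 (E1 - \<gamma>) < cond_div (tilted W V (\<sigma> k)) V (P' k)"
      using pos k(2,3) E0 E1 by auto
    then have "admissible_exponents W V (P' k) (max 0 (E0 - \<gamma>)) (max 0 (E1 - \<gamma>))"
      unfolding admissible_exponents_def using \<sigma>[of k] by (auto intro!: disjI2 bexI[of _ "\<sigma> k"])
    moreover have "\<bar>max 0 (E0 - \<gamma>) - E0\<bar> \<le> \<gamma>" "\<bar>max 0 (E1 - \<gamma>) - E1\<bar> \<le> \<gamma>" using nn \<gamma> by auto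
    ultimately show ?thesis by blast
  qed
  then obtain e0 e1 where e: "admissible_exponents W V (P' k) e0 e1" "\<bar>e0 - E0\<bar> \<le> \<gamma>" "\<bar>e1 - E1\<bar> \<le> \<gamma>"
    by blast
  show thesis
    by (rule that[OF achievable_point[OF Q P' uv \<delta> bx0 R'(1,2) e(1)] R'(3) e(2,3)])
qed

end

theorem theorem1:
  fixes PZX :: "'x::finite \<Rightarrow> 'z::finite \<Rightarrow> real"
    and W V :: "'x \<Rightarrow> 'y::finite \<Rightarrow> real"
    and b :: "'x \<Rightarrow> real" and B :: real
  assumes "stochastic PZX" and "stochastic W" and "stochastic V"
    and "\<And>x y. W x y * V x y \<noteq> 0"
    and "\<And>x. 0 \<le> b x" and "0 \<le> B"
    and "CARD('y) \<ge> 2"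
  shows "rate_exp_region PZX W V b B =
    {(R, E0, E1). 0 \<le> R \<and> 0 \<le> E0 \<and> 0 \<le> E1 \<and>
       (\<exists>PX s. distribution PX \<and> (\<Sum>x\<in>UNIV. PX x * b x) \<le> B \<and> s \<in> {0..1} \<and>
          R \<le> mutual_info PX PZX \<and>
          E0 \<le> cond_div (tilted W V s) W PX \<and>
          E1 \<le> cond_div (tilted W V s) V PX)}"
proof -
  have pos: "0 < W x y" "0 < V x y" for x y
    using assms(4)[of x y] stochastic_nonneg[OF assms(2), of x y] stochastic_nonneg[OF assms(3), of x y]
    by (auto simp: less_le)
  obtain cW where cW: "0 < cW" "\<And>x y. cW \<le> W x y" using positive_entries_ge[of W] pos(1) by metis
  obtain cV where cV: "0 < cV" "\<And>x y. cV \<le> V x y" using positive_entries_ge[of V] pos(2) by metis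
  define c where "c = min cW cV"
  have c: "0 < c" "\<And>x y. c \<le> W x y" "\<And>x y. c \<le> V x y"
    using cW cV by (auto simp: c_def intro: min.coboundedI1 min.coboundedI2)
  \<comment> \<open>With a single output letter, one of the two errors would always equal 1, against
    \<tau> < 1; two distinct letters are what the tests are built from.\<close>
  have "\<not> CARD('y) \<le> Suc 0" using assms(7) by simp
  then obtain u v :: 'y where uv: "u \<noteq> v" using card_le_Suc0_iff_eq[of "UNIV :: 'y set"] by auto
  let ?A = "achievable PZX W V b B"
  have region: "(R, E0, E1) \<in> closure ?A \<longleftrightarrow> 0 \<le> R \<and> 0 \<le> E0 \<and> 0 \<le> E1 \<and>
      (\<exists>P s. dominated_by PZX W V b B P s R E0 E1)" for R E0 E1
  proof
    assume "(R, E0, E1) \<in> closure ?A"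
    have near: "\<exists>R' e0 e1. (R', e0, e1) \<in> ?A \<and> \<bar>R' - R\<bar> < \<gamma> \<and> \<bar>e0 - E0\<bar> < \<gamma> \<and> \<bar>e1 - E1\<bar> < \<gamma>"
      if "0 < \<gamma>" for \<gamma>
    proof -
      obtain R' e0 e1 where a: "(R', e0, e1) \<in> ?A" "dist (R', e0, e1) (R, E0, E1) < \<gamma>"
        using \<open>(R, E0, E1) \<in> closure ?A\<close> \<open>0 < \<gamma>\<close> unfolding closure_approachable by (metis prod_cases3)
      have "dist R' R \<le> dist (R', e0, e1) (R, E0, E1)" "dist (e0, e1) (E0, E1) \<le> dist (R', e0, e1) (R, E0, E1)"
        "dist e0 E0 \<le> dist (e0, e1) (E0, E1)" "dist e1 E1 \<le> dist (e0, e1) (E0, E1)"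
        using dist_fst_le[of "(R', e0, e1)" "(R, E0, E1)"] dist_snd_le[of "(R', e0, e1)" "(R, E0, E1)"]
          dist_fst_le[of "(e0, e1)" "(E0, E1)"] dist_snd_le[of "(e0, e1)" "(E0, E1)"] by auto
      then show ?thesis using a by (intro exI[of _ R'] exI[of _ e0] exI[of _ e1]) (simp add: dist_real_def)
    qed
    have "0 \<le> R" "0 \<le> E0" "0 \<le> E1"
    proof -
      have *: "0 \<le> R + \<gamma>" "0 \<le> E0 + \<gamma>" "0 \<le> E1 + \<gamma>" if \<gamma>: "0 < \<gamma>" for \<gamma>
      proof -
        obtain R' e0 e1 where a: "(R', e0, e1) \<in> ?A" "\<bar>R' - R\<bar> < \<gamma>" "\<bar>e0 - E0\<bar> < \<gamma>" "\<bar>e1 - E1\<bar> < \<gamma>"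
          using near[OF \<gamma>] by blast
        show "0 \<le> R + \<gamma>" "0 \<le> E0 + \<gamma>" "0 \<le> E1 + \<gamma>"
          using achievable_nonneg[OF assms(2,3) c a(1)] a(2-4) by linarith+
      qed
      show "0 \<le> R" "0 \<le> E0" "0 \<le> E1" by (rule field_le_epsilon, erule *)+
    qed
    moreover have "\<exists>P s. dominated_by PZX W V b B P s (R - \<gamma>) (E0 - \<gamma>) (E1 - \<gamma>)" if "0 < \<gamma>" for \<gamma>
    proof -
      \<comment> \<open>One quarter pays for approximating the closure point, three for the loss in
        the converse.\<close>
      have \<gamma>4: "0 < \<gamma> / 4" using that by simp
      obtain R' e0 e1 where a: "(R', e0, e1) \<in> ?A" "\<bar>R' - R\<bar> < \<gamma> / 4" "\<bar>e0 - E0\<bar> < \<gamma> / 4" "\<bar>e1 - E1\<bar> < \<gamma> / 4"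
        using near[OF \<gamma>4] by blast
      obtain P s where "dominated_by PZX W V b B P s (R' - 3 * (\<gamma> / 4)) (e0 - 3 * (\<gamma> / 4)) (e1 - 3 * (\<gamma> / 4))"
        using achievable_converse[OF assms(2,3) c assms(1) a(1) \<gamma>4] by blast
      then have "dominated_by PZX W V b B P s (R - \<gamma>) (E0 - \<gamma>) (E1 - \<gamma>)"
        unfolding dominated_by_def using a(2-4) by linarith
      then show ?thesis by blast
    qed
    then have "\<exists>P s. dominated_by PZX W V b B P s R E0 E1"
      by (rule dominated_by_limit[OF assms(2,3) c assms(1)]) blast+
    ultimately show "0 \<le> R \<and> 0 \<le> E0 \<and> 0 \<le> E1 \<and> (\<exists>P s. dominated_by PZX W V b B P s R E0 E1)" by blast
  next
    assume r: "0 \<le> R \<and> 0 \<le> E0 \<and> 0 \<le> E1 \<and> (\<exists>P s. dominated_by PZX W V b B P s R E0 E1)"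
    then obtain P s where dom: "dominated_by PZX W V b B P s R E0 E1" by blast
    show "(R, E0, E1) \<in> closure ?A"
      unfolding closure_approachable
    proof (intro allI impI)
      fix \<epsilon> :: real assume "0 < \<epsilon>"
      \<comment> \<open>Three coordinates within \<open>\<epsilon> / 4\<close> keep the distance
        below \<open>\<epsilon>\<close>.\<close>
      then have \<epsilon>4: "0 < \<epsilon> / 4" by simp
      obtain R' e0 e1 where a: "(R', e0, e1) \<in> ?A" "\<bar>R' - R\<bar> \<le> \<epsilon> / 4" "\<bar>e0 - E0\<bar> \<le> \<epsilon> / 4" "\<bar>e1 - E1\<bar> \<le> \<epsilon> / 4"
        by (rule dominated_by_approx_achievable[OF assms(2,3) c assms(1) uv dom _ _ _ \<epsilon>4]) (use r in blast)+
      have "dist (R', e0, e1) (R, E0, E1) \<le> dist R' R + dist (e0, e1) (E0, E1)"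
        unfolding dist_Pair_Pair[of R'] by (rule sqrt_sum_squares_le_sum) auto
      also have "dist (e0, e1) (E0, E1) \<le> dist e0 E0 + dist e1 E1"
        unfolding dist_Pair_Pair by (rule sqrt_sum_squares_le_sum) auto
      finally have "dist (R', e0, e1) (R, E0, E1) < \<epsilon>"
        using a(2-4) \<open>0 < \<epsilon>\<close> by (simp add: dist_real_def)
      then show "\<exists>y\<in>?A. dist y (R, E0, E1) < \<epsilon>" using a(1) by blast
    qed
  qed
  show ?thesis
    unfolding rate_exp_region_def
    by (intro set_eqI) (simp only: split_paired_all mem_Collect_eq prod.case region dominated_by_def)
qed

unused_thms

end
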